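(* Let $m,n\ge 1$, $q=\min\{m,n\}$, $1\le k\le q$, and let $F$ be a complex $m\times n$ matrix. Suppose that $\Phi$ is a strictly convex symmetric gauge function on $\mathbb{R}^q$. Then every minimizer of the problem $$\min\{\,\|F-X\|_\Phi \,:\, X\in\mathcal{I}_{m,n}^k\,\}$$ has the form $$U_k=V\begin{bmatrix} I_k & 0\\ 0 & 0_{m-k,n-k}\end{bmatrix}W^*,$$ where $V$ and $W$ are a pair of unitary matrices (depending on the minimizer) such that $F=V\Sigma W^*$ is a singular value decomposition of $F$.
   Context: A complex $m\times n$ matrix $X$ is a partial isometry if $\|Xf\|=\|f\|$ for all $f\in\ker(X)^\perp$; $\mathcal{I}_{m,n}^k$ denotes the set of $m\times n$ partial isometries of rank $k$. For $F$ of rank $r$, $s_1(F)\ge\dots\ge s_q(F)\ge 0$ are the singular values of $F$ (the $q$ largest eigenvalues of $(F^*F)^{1/2}$, with multiplicity). A singular value decomposition (SVD) of $F$ is a factorization $F=V\Sigma W^*$ with $V$ an $m\times m$ unitary matrix, $W$ an $n\times n$ unitary matrix, and $\Sigma=\begin{bmatrix}\Sigma_r&0\\0&0_{m-r,n-r}\end{bmatrix}$, $\Sigma_r=\mathrm{diag}(s_1(F),\dots,s_r(F))$; the unitaries $V,W$ are not unique. A symmetric gauge function is a norm $\Phi$ on $\mathbb{R}^q$ with $\Phi(x_1,\dots,x_q)=\Phi(|x_{\sigma(1)}|,\dots,|x_{\sigma(q)}|)$ for every permutation $\sigma$ of $\{1,\dots,q\}$; it defines the unitarily invariant norm $\|F\|_\Phi=\Phi(s_1(F),\dots,s_q(F))$.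 $\Phi$ is strictly convex if $\Phi(\lambda x+(1-\lambda)y)<1$ whenever $x\ne y$, $\Phi(x)=\Phi(y)=1$ and $\lambda\in(0,1)$. *)

theory Defs
  imports
    "Jordan_Normal_Form.Schur_Decomposition"
    "Jordan_Normal_Form.Matrix_Kernel"
    "Jordan_Normal_Form.DL_Rank"
    "HOL-Computational_Algebra.Polynomial"
    "HOL-Combinatorics.Permutations"
begin

text \<open>All indices are 0-based: the singular value \<open>s_i\<close> of the
  literature is component \<open>i - 1\<close> of \<open>singular_values\<close>.\<close>

definition unitary_mat :: "nat \<Rightarrow> complex mat \<Rightarrow> bool" where
  "unitary_mat d U \<longleftrightarrow> U \<in> carrier_mat d d
     \<and> mat_adjoint U * U = 1\<^sub>m d \<and> U * mat_adjoint U = 1\<^sub>m d"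

definition eucl_norm :: "complex vec \<Rightarrow> real" where
  "eucl_norm v = sqrt (Re (v \<bullet>c v))"

definition mat_rank :: "complex mat \<Rightarrow> nat" where
  "mat_rank A = vec_space.rank (dim_row A) A"

definition orth_complement :: "nat \<Rightarrow> complex vec set \<Rightarrow> complex vec set" where
  "orth_complement d S = {f \<in> carrier_vec d. \<forall>g \<in> S. f \<bullet>c g = 0}"

definition partial_isometry :: "complex mat \<Rightarrow> bool" where
  "partial_isometry X \<longleftrightarrow>
     (\<forall>f \<in> orth_complement (dim_col X) (mat_kernel X). eucl_norm (X *\<^sub>v f) = eucl_norm f)"

definition partial_isometries :: "nat \<Rightarrow> nat \<Rightarrow> nat \<Rightarrow> complex mat set" where
  "partial_isometries m n k =
     {X \<in> carrier_mat m n. partial_isometry X \<and> mat_rank X = k}"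

definition psd_mat :: "nat \<Rightarrow> complex mat \<Rightarrow> bool" where
  "psd_mat d P \<longleftrightarrow> P \<in> carrier_mat d d \<and> mat_adjoint P = P
     \<and> (\<forall>v \<in> carrier_vec d. Re ((P *\<^sub>v v) \<bullet>c v) \<ge> 0)"

text \<open>The positive semidefinite square root of a positive semidefinite matrix
  exists and is unique; for other arguments the value is unspecified.\<close>

definition psd_sqrt :: "complex mat \<Rightarrow> complex mat" where
  "psd_sqrt A = (THE P. psd_mat (dim_row A) P \<and> P * P = A)"

text \<open>The roots of the characteristic polynomial, counted with multiplicity. Taking
  real parts loses nothing for Hermitian matrices.\<close>

definition eigenvalues_desc :: "complex mat \<Rightarrow> real list" where
  "eigenvalues_desc A = rev (sorted_list_of_multiset (image_mset Re (proots (char_poly A))))"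

definition singular_values :: "complex mat \<Rightarrow> real vec" where
  "singular_values F = vec (min (dim_row F) (dim_col F))
     (\<lambda>i. eigenvalues_desc (psd_sqrt (mat_adjoint F * F)) ! i)"

definition top_left_block :: "nat \<Rightarrow> nat \<Rightarrow> nat \<Rightarrow> complex mat \<Rightarrow> complex mat" where
  "top_left_block m n r A =
     four_block_mat A (0\<^sub>m r (n - r)) (0\<^sub>m (m - r) r) (0\<^sub>m (m - r) (n - r))"

definition is_SVD :: "complex mat \<Rightarrow> complex mat \<Rightarrow> complex mat \<Rightarrow> complex mat \<Rightarrow> bool" where
  "is_SVD F V S W \<longleftrightarrow>
     unitary_mat (dim_row F) V \<and> unitary_mat (dim_col F) W
     \<and> S = top_left_block (dim_row F) (dim_col F) (mat_rank F)
             (mat_diag (mat_rank F) (\<lambda>i. complex_of_real (singular_values F $ i)))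
     \<and> F = V * S * mat_adjoint W"

definition norm_on_Rq :: "nat \<Rightarrow> (real vec \<Rightarrow> real) \<Rightarrow> bool" where
  "norm_on_Rq q \<Phi> \<longleftrightarrow>
     (\<forall>x \<in> carrier_vec q. \<Phi> x \<ge> 0 \<and> (\<Phi> x = 0 \<longleftrightarrow> x = 0\<^sub>v q))
     \<and> (\<forall>c. \<forall>x \<in> carrier_vec q. \<Phi> (c \<cdot>\<^sub>v x) = \<bar>c\<bar> * \<Phi> x)
     \<and> (\<forall>x \<in> carrier_vec q. \<forall>y \<in> carrier_vec q. \<Phi> (x + y) \<le> \<Phi> x + \<Phi> y)"

definition symmetric_gauge :: "nat \<Rightarrow> (real vec \<Rightarrow> real) \<Rightarrow> bool" where
  "symmetric_gauge q \<Phi> \<longleftrightarrow> norm_on_Rq q \<Phi>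
     \<and> (\<forall>x \<in> carrier_vec q. \<forall>\<sigma>. \<sigma> permutes {..<q} \<longrightarrow>
          \<Phi> x = \<Phi> (vec q (\<lambda>i. \<bar>x $ \<sigma> i\<bar>)))"

definition strictly_convex_gauge :: "nat \<Rightarrow> (real vec \<Rightarrow> real) \<Rightarrow> bool" where
  "strictly_convex_gauge q \<Phi> \<longleftrightarrow>
     (\<forall>x \<in> carrier_vec q. \<forall>y \<in> carrier_vec q. \<forall>t.
        x \<noteq> y \<and> \<Phi> x = 1 \<and> \<Phi> y = 1 \<and> 0 < t \<and> t < 1
          \<longrightarrow> \<Phi> (t \<cdot>\<^sub>v x + (1 - t) \<cdot>\<^sub>v y) < 1)"

definition gauge_norm :: "(real vec \<Rightarrow> real) \<Rightarrow> complex mat \<Rightarrow> real" where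
  "gauge_norm \<Phi> F = \<Phi> (singular_values F)"

end

theory Submission
  imports Defs
begin

text \<open>Let \<open>s\<^sub>1 \<ge> s\<^sub>2 \<ge> \<dots>\<close> be the singular values of \<open>F\<close>; those of a partial isometry of rank \<open>k\<close> are
  \<open>1\<close> (\<open>k\<close> times) and \<open>0\<close>. Mirsky's inequality says that the vector of the numbers \<open>\<bar>s\<^sub>i - 1\<bar>\<close> for
  \<open>i \<le> k\<close> and \<open>s\<^sub>i\<close> for \<open>i > k\<close> is weakly majorized by the singular values of \<open>F - U\<close>, for every partial
  isometry \<open>U\<close> of rank \<open>k\<close> (lemma \<open>mirsky\<close>). The same vector, sorted, consists of the singular values of
  \<open>F - X\<close> for the \<open>X\<close> that is built from singular bases of \<open>F\<close>. A symmetric gauge is monotone under weak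
  majorization, and a strictly convex one is strictly monotone (lemma \<open>gauge_majorization\<close>). So a
  minimizer \<open>U\<close> can do as well as \<open>X\<close> only if \<open>F - U\<close> and \<open>F - X\<close> have the same singular values.

  From here on the gauge no longer matters. Equal singular values give equal Frobenius norms, and
  expanding \<open>\<parallel>F - U\<parallel>\<^sup>2\<close> turns this into \<open>Re tr (U\<^sup>\<dagger> F) = s\<^sub>1 + \<dots> + s\<^sub>k\<close>. This is the equality case of the
  trace inequality \<open>Re tr (P\<^sup>\<dagger> F Q) \<le> s\<^sub>1 + \<dots> + s\<^sub>k\<close> for matrices \<open>P, Q\<close> with \<open>k\<close> orthonormal columns, where
  \<open>U = P Q\<^sup>\<dagger>\<close> (lemma \<open>trace_inequality\<close>). Equality forces \<open>F Q = P A\<close> and \<open>F\<^sup>\<dagger> P = Q A\<close> with one positive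
  semidefinite \<open>A\<close>. Diagonalizing \<open>A\<close> and the remaining diagonal block of \<open>F\<close> yields a singular value
  decomposition of \<open>F\<close> whose leading \<open>k\<close> singular vectors also represent \<open>U\<close>
  (lemma \<open>trace_equality_common_svd\<close>).

  Mirsky's inequality follows from the Lidskii--Wielandt inequality for the Hermitian dilation, whose
  eigenvalues are \<open>\<plusminus>s\<^sub>i\<close> and zeros; that inequality in turn needs only the spectral theorem and Weyl's
  monotonicity principle.\<close>

section \<open>Adjoints, unitary matrices and traces\<close>

abbreviation dagger :: "complex mat \<Rightarrow> complex mat" (\<open>(_\<^sup>\<dagger>)\<close> [1000] 999)
  where "A\<^sup>\<dagger> \<equiv> mat_adjoint A"

lemma adjoint_dim [simp]: "dim_row (A\<^sup>\<dagger>) = dim_col A" "dim_col (A\<^sup>\<dagger>) = dim_row A"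
  by (auto simp: mat_adjoint_def)

lemma adjoint_carrier [simp, intro]: "A \<in> carrier_mat m n \<Longrightarrow> A\<^sup>\<dagger> \<in> carrier_mat n m"
  by (auto simp: mat_adjoint_def)

lemma adjoint_index [simp]:
  "i < dim_col A \<Longrightarrow> j < dim_row A \<Longrightarrow> A\<^sup>\<dagger> $$ (i, j) = cnj (A $$ (j, i))"
  by (simp add: mat_adjoint_def mat_of_rows_index conjugate_complex_def)

lemma adjoint_adjoint [simp]: "(A\<^sup>\<dagger>)\<^sup>\<dagger> = A"
  by (rule eq_matI) auto

lemma index_mult_sum:
  fixes A B :: "'a :: semiring_0 mat"
  assumes "A \<in> carrier_mat m n" "B \<in> carrier_mat n p" "i < m" "j < p"
  shows "(A * B) $$ (i, j) = (\<Sum>l<n. A $$ (i, l) * B $$ (l, j))"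
  using assms by (simp add: scalar_prod_def atLeast0LessThan)

lemma adjoint_mult:
  assumes "A \<in> carrier_mat m n" "B \<in> carrier_mat n p"
  shows "(A * B)\<^sup>\<dagger> = B\<^sup>\<dagger> * A\<^sup>\<dagger>"
proof (rule eq_matI)
  fix i j assume "i < dim_row (B\<^sup>\<dagger> * A\<^sup>\<dagger>)" "j < dim_col (B\<^sup>\<dagger> * A\<^sup>\<dagger>)"
  then have ij: "i < p" "j < m" using assms by auto
  have "(A * B)\<^sup>\<dagger> $$ (i, j) = cnj ((A * B) $$ (j, i))"
    using assms ij by (intro adjoint_index) auto
  also have "\<dots> = (\<Sum>l<n. cnj (A $$ (j, l)) * cnj (B $$ (l, i)))"
    using assms ij by (simp add: index_mult_sum[OF assms] del: index_mult_mat(1))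
  also have "\<dots> = (B\<^sup>\<dagger> * A\<^sup>\<dagger>) $$ (i, j)"
    using assms ij by (subst index_mult_sum[of _ p n _ m]) (auto intro!: sum.cong)
  finally show "(A * B)\<^sup>\<dagger> $$ (i, j) = (B\<^sup>\<dagger> * A\<^sup>\<dagger>) $$ (i, j)" .
qed (use assms in auto)

text \<open>Conditions on dimensions, unlike carrier conditions, are decided by rewriting; in this form
  associativity and the rule for adjoints of products normalise matrix words.\<close>

lemma mult_assoc_dim:
  fixes A B C :: "'a :: semiring_0 mat"
  assumes "dim_col A = dim_row B" "dim_col B = dim_row C"
  shows "A * B * C = A * (B * C)"
  by (metis assms assoc_mult_mat carrier_mat_triv)

lemma mult_mat_vec_assoc_dim:
  fixes A B :: "'a :: semiring_0 mat"
  assumes "dim_col A = dim_row B" "dim_col B = dim_vec v"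
  shows "A * B *\<^sub>v v = A *\<^sub>v (B *\<^sub>v v)"
  by (metis assms assoc_mult_mat_vec carrier_mat_triv carrier_vec_dim_vec)

lemma adjoint_mult_dim:
  assumes "dim_col A = dim_row B"
  shows "(A * B)\<^sup>\<dagger> = B\<^sup>\<dagger> * A\<^sup>\<dagger>"
  by (metis assms adjoint_mult carrier_mat_triv)

lemmas mat_word = mult_assoc_dim mult_mat_vec_assoc_dim adjoint_mult_dim

lemma isometry_cancel:
  assumes "A \<in> carrier_mat m n" "A\<^sup>\<dagger> * A = 1\<^sub>m n"
  shows "dim_row X = n \<Longrightarrow> A\<^sup>\<dagger> * (A * X) = X" "dim_vec v = n \<Longrightarrow> A\<^sup>\<dagger> *\<^sub>v (A *\<^sub>v v) = v"
proof -
  have dims: "dim_row A = m" "dim_col A = n" using assms(1) by auto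
  show "A\<^sup>\<dagger> * (A * X) = X" if X: "dim_row X = n"
  proof -
    have "A\<^sup>\<dagger> * (A * X) = A\<^sup>\<dagger> * A * X"
      by (rule mult_assoc_dim[symmetric]) (simp_all only: adjoint_dim dims X)
    also have "\<dots> = 1\<^sub>m n * X" by (simp only: assms(2))
    also have "\<dots> = X" by (rule left_mult_one_mat[OF carrier_matI[OF X refl]])
    finally show ?thesis .
  qed
  show "A\<^sup>\<dagger> *\<^sub>v (A *\<^sub>v v) = v" if v: "dim_vec v = n"
  proof -
    have "A\<^sup>\<dagger> *\<^sub>v (A *\<^sub>v v) = A\<^sup>\<dagger> * A *\<^sub>v v"
      by (rule mult_mat_vec_assoc_dim[symmetric]) (simp_all only: adjoint_dim dims v)
    also have "\<dots> = 1\<^sub>m n *\<^sub>v v" by (simp only: assms(2))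
    also have "\<dots> = v" by (rule one_mult_mat_vec[OF carrier_vecI[OF v]])
    finally show ?thesis .
  qed
qed

lemma adjoint_minus:
  assumes "A \<in> carrier_mat m n" "B \<in> carrier_mat m n"
  shows "(A - B)\<^sup>\<dagger> = A\<^sup>\<dagger> - B\<^sup>\<dagger>"
  using assms by (intro eq_matI) auto

lemma adjoint_one [simp]: "(1\<^sub>m n)\<^sup>\<dagger> = 1\<^sub>m n"
  by (rule eq_matI) auto

lemma adjoint_mat_diag_real [simp]:
  "(mat_diag n (\<lambda>i. complex_of_real (f i)))\<^sup>\<dagger> = mat_diag n (\<lambda>i. complex_of_real (f i))"
  by (rule eq_matI) (auto simp: mat_diag_def)

lemma mat_diag_dims [simp]: "dim_row (mat_diag n f) = n" "dim_col (mat_diag n f) = n"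
  by (auto simp: mat_diag_def)

lemma unitary_matD:
  assumes "unitary_mat n U"
  shows "U \<in> carrier_mat n n" "U\<^sup>\<dagger> * U = 1\<^sub>m n" "U * U\<^sup>\<dagger> = 1\<^sub>m n"
  using assms by (auto simp: unitary_mat_def)

lemma unitary_matI:
  assumes "U \<in> carrier_mat n n" "U\<^sup>\<dagger> * U = 1\<^sub>m n"
  shows "unitary_mat n U"
  using assms mat_mult_left_right_inverse[of "U\<^sup>\<dagger>" n U] by (auto simp: unitary_mat_def)

lemma mult_cancel_inner:
  fixes A :: "'a :: semiring_1 mat"
  assumes "A \<in> carrier_mat m n" "B \<in> carrier_mat n p" "C \<in> carrier_mat p n"
    "D \<in> carrier_mat n q" "B * C = 1\<^sub>m n"
  shows "(A * B) * (C * D) = A * D"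
proof -
  have "(A * B) * (C * D) = A * (B * (C * D))" using assms by (intro assoc_mult_mat) auto
  also have "B * (C * D) = (B * C) * D" using assms by (intro assoc_mult_mat[symmetric]) auto
  finally show ?thesis using assms by simp
qed

lemma isometry_mult:
  assumes "A \<in> carrier_mat m n" "A\<^sup>\<dagger> * A = 1\<^sub>m n" "B \<in> carrier_mat n p" "B\<^sup>\<dagger> * B = 1\<^sub>m p"
  shows "A * B \<in> carrier_mat m p" "(A * B)\<^sup>\<dagger> * (A * B) = 1\<^sub>m p"
  using assms mult_cancel_inner[of "B\<^sup>\<dagger>" p n "A\<^sup>\<dagger>" m A B p] by (auto simp: adjoint_mult)

lemma unitary_mult:
  assumes "unitary_mat n A" "unitary_mat n B"
  shows "unitary_mat n (A * B)"
  using isometry_mult[of A n n B n] unitary_matD[OF assms(1)] unitary_matD[OF assms(2)]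
  by (intro unitary_matI) auto

lemma isometry_iff:
  assumes "A \<in> carrier_mat m n"
  shows "A\<^sup>\<dagger> * A = 1\<^sub>m n \<longleftrightarrow>
    (\<forall>i<n. \<forall>j<n. (\<Sum>l<m. cnj (A $$ (l, i)) * A $$ (l, j)) = (if i = j then 1 else 0))"
proof -
  have e: "(A\<^sup>\<dagger> * A) $$ (i, j) = (\<Sum>l<m. cnj (A $$ (l, i)) * A $$ (l, j))"
    if "i < n" "j < n" for i j
    using assms that by (subst index_mult_sum[of _ n m _ n]) (auto intro!: sum.cong)
  have "A\<^sup>\<dagger> * A = 1\<^sub>m n \<longleftrightarrow> (\<forall>i<n. \<forall>j<n. (A\<^sup>\<dagger> * A) $$ (i, j) = 1\<^sub>m n $$ (i, j))"
    using assms by (auto simp del: index_mult_mat(1) intro!: eq_matI)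
  also have "\<dots> \<longleftrightarrow> (\<forall>i<n. \<forall>j<n.
      (\<Sum>l<m. cnj (A $$ (l, i)) * A $$ (l, j)) = (if i = j then 1 else 0))"
    by (auto simp: e simp del: index_mult_mat(1))
  finally show ?thesis .
qed

lemma isometry_col_norm:
  assumes "A \<in> carrier_mat m n" "A\<^sup>\<dagger> * A = 1\<^sub>m n" "j < n"
  shows "(\<Sum>l<m. (cmod (A $$ (l, j)))\<^sup>2) = 1"
proof -
  have "(\<Sum>l<m. cnj (A $$ (l, j)) * A $$ (l, j)) = 1"
    using assms isometry_iff[OF assms(1)] by auto
  also have "(\<Sum>l<m. cnj (A $$ (l, j)) * A $$ (l, j)) = of_real (\<Sum>l<m. (cmod (A $$ (l, j)))\<^sup>2)"
    by (simp add: complex_norm_square mult.commute del: of_real_power)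
  finally show ?thesis by (metis of_real_eq_1_iff)
qed

lemma unitary_select_columns:
  assumes U: "unitary_mat m U" and tau: "inj_on \<tau> {..<k}" "\<And>j. j < k \<Longrightarrow> \<tau> j < m"
  shows "mat m k (\<lambda>(i, j). U $$ (i, \<tau> j)) \<in> carrier_mat m k"
    "(mat m k (\<lambda>(i, j). U $$ (i, \<tau> j)))\<^sup>\<dagger> * mat m k (\<lambda>(i, j). U $$ (i, \<tau> j)) = 1\<^sub>m k"
proof -
  define P where "P = mat m k (\<lambda>(i, j). U $$ (i, \<tau> j))"
  have P: "P \<in> carrier_mat m k" by (simp add: P_def)
  have "P\<^sup>\<dagger> * P = 1\<^sub>m k"
    unfolding isometry_iff[OF P]
  proof (intro allI impI)
    fix i j assume ij: "i < k" "j < k"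
    have "(\<Sum>l<m. cnj (P $$ (l, i)) * P $$ (l, j)) = (\<Sum>l<m. cnj (U $$ (l, \<tau> i)) * U $$ (l, \<tau> j))"
      using ij by (intro sum.cong) (simp_all add: P_def)
    also have "\<dots> = (if \<tau> i = \<tau> j then 1 else 0)"
      using isometry_iff[OF unitary_matD(1)[OF U]] unitary_matD(2)[OF U] tau(2) ij by blast
    also have "\<tau> i = \<tau> j \<longleftrightarrow> i = j" using inj_onD[OF tau(1)] ij by auto
    finally show "(\<Sum>l<m. cnj (P $$ (l, i)) * P $$ (l, j)) = (if i = j then 1 else 0)" .
  qed
  then show "mat m k (\<lambda>(i, j). U $$ (i, \<tau> j)) \<in> carrier_mat m k"
    "(mat m k (\<lambda>(i, j). U $$ (i, \<tau> j)))\<^sup>\<dagger> * mat m k (\<lambda>(i, j). U $$ (i, \<tau> j)) = 1\<^sub>m k"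
    using P by (simp_all only: P_def)
qed

lemma mult_block_diag:
  fixes A B C D :: "'a :: semiring_1 mat"
  assumes "A \<in> carrier_mat m1 n1" "B \<in> carrier_mat n1 p1"
    "C \<in> carrier_mat m2 n2" "D \<in> carrier_mat n2 p2"
  shows "four_block_mat A (0\<^sub>m m1 n2) (0\<^sub>m m2 n1) C * four_block_mat B (0\<^sub>m n1 p2) (0\<^sub>m n2 p1) D =
    four_block_mat (A * B) (0\<^sub>m m1 p2) (0\<^sub>m m2 p1) (C * D)"
  using assms by (subst mult_four_block_mat[of A m1 n1 _ n2 _ m2 C B p1 _ p2 _ D]) auto

lemma adjoint_block_diag:
  assumes "A \<in> carrier_mat m1 n1" "C \<in> carrier_mat m2 n2"
  shows "(four_block_mat A (0\<^sub>m m1 n2) (0\<^sub>m m2 n1) C)\<^sup>\<dagger> =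
    four_block_mat (A\<^sup>\<dagger>) (0\<^sub>m n1 m2) (0\<^sub>m n2 m1) (C\<^sup>\<dagger>)"
  using assms by (intro eq_matI) auto

definition sq_norm :: "complex vec \<Rightarrow> real" where
  "sq_norm v = (\<Sum>i<dim_vec v. (cmod (v $ i))\<^sup>2)"

lemma cscalar_self: "v \<bullet>c v = complex_of_real (sq_norm v)"
  by (simp add: sq_norm_def scalar_prod_def atLeast0LessThan conjugate_complex_def
      complex_norm_square del: of_real_power)

lemma eucl_norm_sq_norm: "eucl_norm v = sqrt (sq_norm v)"
  by (simp add: eucl_norm_def cscalar_self)

lemma sq_norm_nonneg [simp]: "0 \<le> sq_norm v"
  by (simp add: sq_norm_def sum_nonneg)

lemma sq_norm_eq_0: "v \<in> carrier_vec n \<Longrightarrow> sq_norm v = 0 \<longleftrightarrow> v = 0\<^sub>v n"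
  using conjugate_square_eq_0_vec[of v n] by (simp add: cscalar_self)

lemma cscalar_adjoint:
  assumes "A \<in> carrier_mat m n" "v \<in> carrier_vec n" "w \<in> carrier_vec m"
  shows "(A *\<^sub>v v) \<bullet>c w = v \<bullet>c (A\<^sup>\<dagger> *\<^sub>v w)"
proof -
  have "(A *\<^sub>v v) \<bullet>c w = (\<Sum>i<m. \<Sum>j<n. A $$ (i, j) * v $ j * cnj (w $ i))"
    using assms by (auto simp: scalar_prod_def atLeast0LessThan conjugate_complex_def
        sum_distrib_right intro!: sum.cong)
  also have "\<dots> = (\<Sum>j<n. \<Sum>i<m. A $$ (i, j) * v $ j * cnj (w $ i))"
    by (rule sum.swap)
  also have "\<dots> = v \<bullet>c (A\<^sup>\<dagger> *\<^sub>v w)"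
    using assms by (auto simp: scalar_prod_def atLeast0LessThan conjugate_complex_def
        sum_distrib_left mult_ac intro!: sum.cong)
  finally show ?thesis .
qed

lemma isometry_sq_norm:
  assumes "A \<in> carrier_mat m n" "A\<^sup>\<dagger> * A = 1\<^sub>m n" "v \<in> carrier_vec n"
  shows "sq_norm (A *\<^sub>v v) = sq_norm v"
proof -
  have "(A *\<^sub>v v) \<bullet>c (A *\<^sub>v v) = v \<bullet>c v"
    using assms isometry_cancel(2)[OF assms(1,2), of v] cscalar_adjoint[of A m n v "A *\<^sub>v v"]
    by simp
  then show ?thesis by (simp add: cscalar_self)
qed

definition mat_trace :: "complex mat \<Rightarrow> complex" where
  "mat_trace A = (\<Sum>i<dim_row A. A $$ (i, i))"

lemma mat_trace_comm:
  assumes "A \<in> carrier_mat m n" "B \<in> carrier_mat n m"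
  shows "mat_trace (A * B) = mat_trace (B * A)"
proof -
  have "mat_trace (A * B) = (\<Sum>i<m. \<Sum>j<n. A $$ (i, j) * B $$ (j, i))"
    using assms by (simp add: mat_trace_def index_mult_sum del: index_mult_mat(1))
  also have "\<dots> = (\<Sum>j<n. \<Sum>i<m. B $$ (j, i) * A $$ (i, j))"
    by (subst sum.swap) (simp add: mult.commute)
  also have "\<dots> = mat_trace (B * A)"
    using assms by (simp add: mat_trace_def index_mult_sum del: index_mult_mat(1))
  finally show ?thesis .
qed

lemma mat_trace_add:
  "A \<in> carrier_mat n n \<Longrightarrow> B \<in> carrier_mat n n \<Longrightarrow> mat_trace (A + B) = mat_trace A + mat_trace B"
  by (simp add: mat_trace_def sum.distrib)

lemma mat_trace_minus:
  "A \<in> carrier_mat n n \<Longrightarrow> B \<in> carrier_mat n n \<Longrightarrow> mat_trace (A - B) = mat_trace A - mat_trace B"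
  by (simp add: mat_trace_def sum_subtractf)

lemma mat_trace_adjoint: "A \<in> carrier_mat n n \<Longrightarrow> mat_trace (A\<^sup>\<dagger>) = cnj (mat_trace A)"
  by (simp add: mat_trace_def)

section \<open>The spectral theorem\<close>

text \<open>Gram--Schmidt applied to a basis that starts with \<open>v\<close> keeps \<open>v\<close>; normalizing the columns then
  makes the basis orthonormal.\<close>

lemma unitary_with_first_column:
  assumes v: "v \<in> carrier_vec n" "v \<noteq> 0\<^sub>v n"
  shows "\<exists>W c. unitary_mat n W \<and> c \<noteq> 0 \<and> col W 0 = c \<cdot>\<^sub>v v"
proof -
  have n: "n \<noteq> 0" using v by (cases n) auto
  interpret cof_vec_space n "TYPE(complex)" .
  define b where "b = basis_completion v"
  define ws where "ws = gram_schmidt n b"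
  from basis_completion[OF v, folded b_def]
  have dist_b: "distinct b" and indep: "\<not> lin_dep (set b)" and b: "set b \<subseteq> carrier_vec n"
    and hdb: "hd b = v" and len_b: "length b = n" by auto
  from hdb len_b n obtain vs where bv: "b = v # vs" by (cases b) auto
  from gram_schmidt_result[OF b dist_b indep refl, folded ws_def]
  have ws: "set ws \<subseteq> carrier_vec n" "corthogonal ws" "length ws = n"
    by (auto simp: len_b)
  from gram_schmidt_hd[OF v(1), of vs, folded bv] have hdws: "hd ws = v" unfolding ws_def .
  have wsc: "ws ! j \<in> carrier_vec n" if "j < n" for j using ws that by auto
  define r where "r j = sqrt (sq_norm (ws ! j))" for j
  have orth: "ws ! i \<bullet>c ws ! j = 0 \<longleftrightarrow> i \<noteq> j" if "i < n" "j < n" for i j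
    using corthogonalD[OF ws(2)] ws(3) that by auto
  have r: "r j > 0" if "j < n" for j
    using orth[OF that that] sq_norm_nonneg[of "ws ! j"]
    by (auto simp: cscalar_self r_def less_le)
  define W where "W = mat n n (\<lambda>(i, j). ws ! j $ i / of_real (r j))"
  have W: "W \<in> carrier_mat n n" by (simp add: W_def)
  have "W\<^sup>\<dagger> * W = 1\<^sub>m n"
    unfolding isometry_iff[OF W]
  proof (intro allI impI)
    fix i j assume ij: "i < n" "j < n"
    have "(\<Sum>l<n. cnj (W $$ (l, i)) * W $$ (l, j)) = (ws ! j \<bullet>c ws ! i) / of_real (r i * r j)"
      using ij wsc[OF ij(1)] wsc[OF ij(2)]
      by (simp add: W_def scalar_prod_def atLeast0LessThan conjugate_complex_def
          sum_divide_distrib mult_ac)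
    also have "\<dots> = (if i = j then 1 else 0)"
      using orth[OF ij(2,1)] r[OF ij(1)]
      by (auto simp: cscalar_self r_def of_real_mult[symmetric] simp del: of_real_mult)
    finally show "(\<Sum>l<n. cnj (W $$ (l, i)) * W $$ (l, j)) = (if i = j then 1 else 0)" .
  qed
  then have "unitary_mat n W" using W by (rule unitary_matI[rotated])
  moreover have "col W 0 = (1 / of_real (r 0)) \<cdot>\<^sub>v v"
  proof -
    have "ws ! 0 = v" using hdws ws(3) n by (cases ws) auto
    then show ?thesis using n v(1) by (intro eq_vecI) (auto simp: W_def)
  qed
  moreover have "1 / complex_of_real (r 0) \<noteq> 0" using r[of 0] n by auto
  ultimately show ?thesis by blast
qed

text \<open>Deflation: in an orthonormal basis that starts with an eigenvector, a Hermitian matrix is block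
  diagonal with a block of size one. The list of roots of the characteristic polynomial is
  prescribed, which leaves the order of the eigenvalues free.\<close>

lemma hermitian_diagonalizable:
  assumes "A \<in> carrier_mat n n" "A\<^sup>\<dagger> = A" "char_poly A = (\<Prod>e\<leftarrow>es. [:- e, 1:])"
  shows "\<exists>T. unitary_mat n T \<and> A = T * mat_diag n (\<lambda>i. es ! i) * T\<^sup>\<dagger> \<and> length es = n"
  using assms
proof (induction es arbitrary: n A)
  case Nil
  have n: "n = 0" using degree_monic_char_poly[OF Nil(1)] Nil(3) by auto
  then show ?case using Nil(1)
    by (intro exI[of _ "1\<^sub>m 0"]) (auto simp: unitary_mat_def intro!: eq_matI)
next
  case (Cons e es)
  note A = Cons.prems(1)
  define k where "k = n - 1"
  have mon: "monic (\<Prod>e\<leftarrow>es. [:- e, 1:])" by (rule monic_prod_list, auto)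
  have cp: "char_poly A = [: -e, 1 :] * (\<Prod>e \<leftarrow> es. [:- e, 1:])" using Cons.prems by auto
  have "degree (char_poly A) = Suc (degree (\<Prod>e\<leftarrow>es. [:- e, 1:]))" unfolding cp
    by (subst degree_mult_eq, insert mon, auto)
  with degree_monic_char_poly[OF A] have n: "n = 1 + k" by (auto simp: k_def)
  have "eigenvalue A e"
    unfolding eigenvalue_root_char_poly[OF A] cp by simp
  then obtain v where v: "v \<in> carrier_vec n" "v \<noteq> 0\<^sub>v n" and Av: "A *\<^sub>v v = e \<cdot>\<^sub>v v"
    using A by (auto simp: eigenvalue_def eigenvector_def)
  obtain W c where W: "unitary_mat n W" and c: "c \<noteq> 0" "col W 0 = c \<cdot>\<^sub>v v"
    using unitary_with_first_column[OF v] by blast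
  note Wc = unitary_matD(1)[OF W]
  define B where "B = W\<^sup>\<dagger> * A * W"
  have B: "B \<in> carrier_mat n n" using A Wc by (auto simp: B_def)
  have BH: "B\<^sup>\<dagger> = B"
    using A Wc Cons.prems(2) by (simp add: B_def mat_word)
  have AB: "A = W * B * W\<^sup>\<dagger>"
    using A Wc unitary_matD(3)[OF W] isometry_cancel(1)[of "W\<^sup>\<dagger>" n n A]
    by (simp add: B_def mat_word)
  have B0: "B $$ (i, 0) = (if i = 0 then e else 0)" if i: "i < n" for i
  proof -
    have "B $$ (i, 0) = (W\<^sup>\<dagger> *\<^sub>v (A *\<^sub>v col W 0)) $ i"
    proof -
      have "B = W\<^sup>\<dagger> * (A * W)" using A Wc by (simp add: B_def mult_assoc_dim)
      then have "B $$ (i, 0) = row (W\<^sup>\<dagger>) i \<bullet> col (A * W) 0" using i n A Wc by simp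
      also have "col (A * W) 0 = A *\<^sub>v col W 0" using n by (intro col_mult2[OF A Wc]) simp
      finally show ?thesis using i Wc by simp
    qed
    also have "A *\<^sub>v col W 0 = e \<cdot>\<^sub>v col W 0"
      using A v Av c by (simp add: mult_mat_vec[of _ n n] smult_smult_assoc mult.commute)
    also have "(W\<^sup>\<dagger> *\<^sub>v (e \<cdot>\<^sub>v col W 0)) $ i = e * (W\<^sup>\<dagger> * W) $$ (i, 0)"
      using i n Wc by simp
    finally show ?thesis using i n unitary_matD(2)[OF W] by simp
  qed
  have B0': "B $$ (0, i) = (if i = 0 then cnj e else 0)" if i: "i < n" for i
  proof -
    have "B $$ (0, i) = B\<^sup>\<dagger> $$ (0, i)" by (simp add: BH)
    also have "\<dots> = cnj (B $$ (i, 0))" using B i n by (intro adjoint_index) auto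
    finally show ?thesis using B0[OF i] by auto
  qed
  define D where "D = mat k k (\<lambda>(i, j). B $$ (Suc i, Suc j))"
  have D: "D \<in> carrier_mat k k" by (simp add: D_def)
  have DH: "D\<^sup>\<dagger> = D"
  proof (rule eq_matI)
    fix i j assume "i < dim_row D" "j < dim_col D"
    then have ij: "i < k" "j < k" using D by auto
    have "D\<^sup>\<dagger> $$ (i, j) = cnj (B $$ (Suc j, Suc i))" using ij by (simp add: D_def)
    also have "\<dots> = B\<^sup>\<dagger> $$ (Suc i, Suc j)" using ij n B by (intro adjoint_index[symmetric]) auto
    finally show "D\<^sup>\<dagger> $$ (i, j) = D $$ (i, j)" using ij by (simp add: BH D_def)
  qed (use D in auto)
  define E1 where "E1 = mat 1 1 (\<lambda>_. e)"
  have E1: "E1 \<in> carrier_mat 1 1" by (simp add: E1_def)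
  have Bblk: "B = four_block_mat E1 (0\<^sub>m 1 k) (0\<^sub>m k 1) D"
  proof (rule eq_matI)
    fix i j
    assume ij: "i < dim_row (four_block_mat E1 (0\<^sub>m 1 k) (0\<^sub>m k 1) D)"
      "j < dim_col (four_block_mat E1 (0\<^sub>m 1 k) (0\<^sub>m k 1) D)"
    then have "i < n" "j < n" using n D E1 by auto
    then show "B $$ (i, j) = four_block_mat E1 (0\<^sub>m 1 k) (0\<^sub>m k 1) D $$ (i, j)"
      using ij n B0[of i] B0'[of j] by (cases i; cases j) (auto simp: E1_def D_def)
  qed (use B D E1 n in auto)
  have "char_poly A = char_poly B"
    using similar_mat_witI[OF unitary_matD(3,2)[OF W] AB A B Wc adjoint_carrier[OF Wc]]
    by (intro char_poly_similar) (auto simp: similar_mat_def)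
  also have "\<dots> = char_poly E1 * char_poly D"
    unfolding Bblk by (rule char_poly_four_block_zeros_col[OF E1 _ D]) auto
  also have "char_poly E1 = [: -e,1 :]"
    by (simp add: E1_def char_poly_defs det_def sign_def)
  finally have "char_poly D = (\<Prod>e \<leftarrow> es. [:- e, 1:])"
    using cp by (metis mult_cancel_left pCons_eq_0_iff zero_neq_one)
  from Cons.IH[OF D DH this] obtain T where T: "unitary_mat k T"
    and DT: "D = T * mat_diag k (\<lambda>i. es ! i) * T\<^sup>\<dagger>" and len: "length es = k" by blast
  note Tc = unitary_matD(1)[OF T]
  define S where "S = four_block_mat (1\<^sub>m 1) (0\<^sub>m 1 k) (0\<^sub>m k 1) T"
  have S: "S \<in> carrier_mat n n" using Tc n by (auto simp: S_def)
  have SH: "S\<^sup>\<dagger> = four_block_mat (1\<^sub>m 1) (0\<^sub>m 1 k) (0\<^sub>m k 1) (T\<^sup>\<dagger>)"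
    using adjoint_block_diag[of "1\<^sub>m 1" 1 1 T k k] Tc by (simp add: S_def)
  have "S\<^sup>\<dagger> * S = four_block_mat (1\<^sub>m 1) (0\<^sub>m 1 k) (0\<^sub>m k 1) (1\<^sub>m k)"
    using mult_block_diag[of "1\<^sub>m 1" 1 1 "1\<^sub>m 1" 1 "T\<^sup>\<dagger>" k k T k] Tc unitary_matD(2)[OF T]
    by (simp add: SH) (simp add: S_def)
  then have uS: "unitary_mat n S" using S n by (intro unitary_matI) auto
  have diag: "mat_diag n (\<lambda>i. (e # es) ! i) = four_block_mat E1 (0\<^sub>m 1 k) (0\<^sub>m k 1) (mat_diag k (\<lambda>i. es ! i))"
    using n by (intro eq_matI) (auto simp: mat_diag_def E1_def nth_Cons split: nat.split)
  have "S * mat_diag n (\<lambda>i. (e # es) ! i) * S\<^sup>\<dagger> = B"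
    using mult_block_diag[of "1\<^sub>m 1" 1 1 E1 1 T k k "mat_diag k (\<lambda>i. es ! i)" k]
      mult_block_diag[of E1 1 1 "1\<^sub>m 1" 1 "T * mat_diag k (\<lambda>i. es ! i)" k k "T\<^sup>\<dagger>" k] Tc E1
    by (simp add: diag SH Bblk DT[symmetric]) (simp add: S_def)
  then have "A = W * (S * mat_diag n (\<lambda>i. (e # es) ! i) * S\<^sup>\<dagger>) * W\<^sup>\<dagger>" using AB by simp
  also have "\<dots> = (W * S) * mat_diag n (\<lambda>i. (e # es) ! i) * (W * S)\<^sup>\<dagger>"
    using Wc S by (simp add: mat_word)
  finally show ?case using unitary_mult[OF W uS] len n by (intro exI[of _ "W * S"]) simp
qed

definition spectral_dec :: "nat \<Rightarrow> complex mat \<Rightarrow> complex mat \<Rightarrow> (nat \<Rightarrow> real) \<Rightarrow> bool" where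
  "spectral_dec n A T \<alpha> \<longleftrightarrow> unitary_mat n T \<and> antimono_on {..<n} \<alpha>
     \<and> A = T * mat_diag n (\<lambda>i. complex_of_real (\<alpha> i)) * T\<^sup>\<dagger>"

lemma conj_unitary_cancel:
  assumes "unitary_mat n T" "D \<in> carrier_mat n n"
  shows "T\<^sup>\<dagger> * (T * D * T\<^sup>\<dagger>) * T = D"
  using assms unitary_matD[OF assms(1)] isometry_cancel(1)[of T n n]
  by (simp add: mat_word)

text \<open>The eigenvalues are real because the diagonal matrix is Hermitian too, so their list can be sorted.\<close>

lemma hermitian_spectral_dec:
  assumes A: "A \<in> carrier_mat n n" "A\<^sup>\<dagger> = A"
  shows "\<exists>T \<alpha>. spectral_dec n A T \<alpha>"
proof -
  obtain es0 where es0: "char_poly A = (\<Prod>e\<leftarrow>es0. [:- e, 1:])"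
    using char_poly_factorized[OF A(1)] by blast
  define es where "es = rev (sort_key Re es0)"
  have "mset es = mset es0" by (simp add: es_def)
  then have "(\<Prod>e\<leftarrow>es. [:- e, 1:]) = (\<Prod>e\<leftarrow>es0. [:- e, 1:])"
    by (metis mset_map prod_mset_prod_list)
  then have "char_poly A = (\<Prod>e\<leftarrow>es. [:- e, 1:])" using es0 by simp
  from hermitian_diagonalizable[OF A this] obtain T where T: "unitary_mat n T"
    and AT: "A = T * mat_diag n (\<lambda>i. es ! i) * T\<^sup>\<dagger>" and len: "length es = n" by blast
  define D where "D = mat_diag n (\<lambda>i. es ! i)"
  have D: "D \<in> carrier_mat n n" by (simp add: D_def)
  note Tc = unitary_matD(1)[OF T]
  have DA: "T\<^sup>\<dagger> * A * T = D"
    unfolding AT using conj_unitary_cancel[OF T D] by (simp add: D_def)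
  have "D\<^sup>\<dagger> = T\<^sup>\<dagger> * A\<^sup>\<dagger> * T"
    using A(1) Tc by (simp add: DA[symmetric] mat_word)
  then have DH: "D\<^sup>\<dagger> = D" using A(2) DA by simp
  have real: "es ! i = of_real (Re (es ! i))" if "i < n" for i
  proof -
    have "cnj (D $$ (i, i)) = D\<^sup>\<dagger> $$ (i, i)" using that D by (intro adjoint_index[symmetric]) auto
    then have "cnj (D $$ (i, i)) = D $$ (i, i)" by (simp only: DH)
    then show ?thesis using that by (simp add: D_def mat_diag_def complex_eq_iff)
  qed
  have "antimono_on {..<n} (\<lambda>i. Re (es ! i))"
  proof (intro monotone_onI)
    fix i j assume ij: "i \<in> {..<n}" "j \<in> {..<n}" "i \<le> j"
    have "sorted (map Re (sort_key Re es0))" by simp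
    then have "map Re (sort_key Re es0) ! (n - Suc j) \<le> map Re (sort_key Re es0) ! (n - Suc i)"
      using ij len by (intro sorted_nth_mono) (auto simp: es_def)
    then show "Re (es ! i) \<ge> Re (es ! j)" using ij len by (simp add: es_def rev_nth)
  qed
  moreover have "mat_diag n (\<lambda>i. es ! i) = mat_diag n (\<lambda>i. complex_of_real (Re (es ! i)))"
    using real by (intro eq_matI) (auto simp: mat_diag_def)
  ultimately have "spectral_dec n A T (\<lambda>i. Re (es ! i))"
    using T AT by (simp add: spectral_dec_def)
  then show ?thesis by blast
qed

lemma spectral_dec_hermitian:
  assumes "unitary_mat n T"
  shows "T * mat_diag n (\<lambda>i. complex_of_real (\<alpha> i)) * T\<^sup>\<dagger> \<in> carrier_mat n n"
    "(T * mat_diag n (\<lambda>i. complex_of_real (\<alpha> i)) * T\<^sup>\<dagger>)\<^sup>\<dagger> = T * mat_diag n (\<lambda>i. complex_of_real (\<alpha> i)) * T\<^sup>\<dagger>"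
  using unitary_matD[OF assms] by (auto simp: mat_word)

section \<open>Eigenvalue inequalities for Hermitian matrices\<close>

lemma quadratic_form_diag:
  assumes "T \<in> carrier_mat m n" "v \<in> carrier_vec m"
  shows "((T * mat_diag n (\<lambda>i. complex_of_real (\<alpha> i)) * T\<^sup>\<dagger>) *\<^sub>v v) \<bullet>c v =
    of_real (\<Sum>i<n. \<alpha> i * (cmod ((T\<^sup>\<dagger> *\<^sub>v v) $ i))\<^sup>2)"
proof -
  define D where "D = mat_diag n (\<lambda>i. complex_of_real (\<alpha> i))"
  define w where "w = T\<^sup>\<dagger> *\<^sub>v v"
  have w: "w \<in> carrier_vec n" using assms by (auto simp: w_def intro!: mult_mat_vec_carrier)
  have D: "D \<in> carrier_mat n n" by (simp add: D_def)
  have "(T * D * T\<^sup>\<dagger>) *\<^sub>v v = T *\<^sub>v (D *\<^sub>v w)"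
    using assms D by (simp add: w_def mat_word)
  also have "\<dots> \<bullet>c v = (D *\<^sub>v w) \<bullet>c w"
    using assms w D by (simp add: cscalar_adjoint[of T m n] w_def)
  also have "\<dots> = (\<Sum>i<n. (D *\<^sub>v w) $ i * cnj (w $ i))"
    using w D by (simp add: scalar_prod_def atLeast0LessThan conjugate_complex_def)
  also have "\<dots> = (\<Sum>i<n. of_real (\<alpha> i * (cmod (w $ i))\<^sup>2))"
  proof (rule sum.cong[OF refl])
    fix i assume i: "i \<in> {..<n}"
    have "(D *\<^sub>v w) $ i = (\<Sum>j<n. (if i = j then of_real (\<alpha> j) else 0) * w $ j)"
      using i w D by (simp add: scalar_prod_def atLeast0LessThan D_def mat_diag_def)
    also have "\<dots> = (\<Sum>j<n. if j = i then of_real (\<alpha> i) * w $ i else 0)"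
      by (rule sum.cong) auto
    also have "\<dots> = of_real (\<alpha> i) * w $ i" using i by simp
    finally show "(D *\<^sub>v w) $ i * cnj (w $ i) = of_real (\<alpha> i * (cmod (w $ i))\<^sup>2)"
      by (simp add: complex_norm_square mult.assoc del: of_real_power)
  qed
  finally show ?thesis by (simp add: D_def w_def)
qed

lemma psd_mat_diag:
  assumes "unitary_mat n T" "\<And>i. i < n \<Longrightarrow> 0 \<le> \<alpha> i"
  shows "psd_mat n (T * mat_diag n (\<lambda>i. complex_of_real (\<alpha> i)) * T\<^sup>\<dagger>)"
  using spectral_dec_hermitian[OF assms(1)] assms unitary_matD(1)[OF assms(1)]
  by (auto simp: psd_mat_def quadratic_form_diag[of T n n] intro!: sum_nonneg)

text \<open>Appending a zero row gives a square matrix with vanishing determinant.\<close>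

lemma underdetermined_system:
  fixes M :: "complex mat"
  assumes "M \<in> carrier_mat i (Suc i)"
  shows "\<exists>x. x \<in> carrier_vec (Suc i) \<and> x \<noteq> 0\<^sub>v (Suc i) \<and> M *\<^sub>v x = 0\<^sub>v i"
proof -
  define N where "N = mat (Suc i) (Suc i) (\<lambda>(a, b). if a < i then M $$ (a, b) else 0)"
  have N: "N \<in> carrier_mat (Suc i) (Suc i)" by (simp add: N_def)
  have "row N i = 0\<^sub>v (Suc i)" by (intro eq_vecI) (auto simp: N_def)
  then have "det N = 0"
    using N laplace_expansion_row[OF N, of i] by (auto simp: N_def)
  then obtain x where x: "x \<in> carrier_vec (Suc i)" "x \<noteq> 0\<^sub>v (Suc i)" "N *\<^sub>v x = 0\<^sub>v (Suc i)"
    using det_0_iff_vec_prod_zero[OF N] by blast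
  have "(M *\<^sub>v x) $ a = 0" if "a < i" for a
  proof -
    have "row N a = row M a" using that assms by (intro eq_vecI) (auto simp: N_def)
    then have "(M *\<^sub>v x) $ a = (N *\<^sub>v x) $ a" using that assms N by simp
    then show ?thesis using x(3) that by simp
  qed
  then have "M *\<^sub>v x = 0\<^sub>v i" using assms by (intro eq_vecI) auto
  then show ?thesis using x by blast
qed

text \<open>Weyl's monotonicity: a vector in the span of the first \<open>i + 1\<close> eigenvectors of \<open>A\<close> that
  is orthogonal to the first \<open>i\<close> eigenvectors of \<open>B\<close> exists by counting dimensions, and its
  Rayleigh quotients compare the two eigenvalues.\<close>

lemma weyl_monotonicity:
  assumes A: "spectral_dec n A T \<alpha>" and B: "spectral_dec n B S \<beta>"
    and psd: "psd_mat n (B - A)" and i: "i < n"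
  shows "\<alpha> i \<le> \<beta> i"
proof -
  have T: "unitary_mat n T" and S: "unitary_mat n S"
    and anti: "antimono_on {..<n} \<alpha>" "antimono_on {..<n} \<beta>"
    using A B by (auto simp: spectral_dec_def)
  have Ac: "A \<in> carrier_mat n n" and Bc: "B \<in> carrier_mat n n"
    using spectral_dec_hermitian[OF T] spectral_dec_hermitian[OF S] A B
    by (auto simp: spectral_dec_def)
  note Tc = unitary_matD(1)[OF T] and Sc = unitary_matD(1)[OF S]
  define M where "M = mat i (Suc i) (\<lambda>(a, b). (S\<^sup>\<dagger> * T) $$ (a, b))"
  have M: "M \<in> carrier_mat i (Suc i)" by (simp add: M_def)
  obtain x where x: "x \<in> carrier_vec (Suc i)" "x \<noteq> 0\<^sub>v (Suc i)" "M *\<^sub>v x = 0\<^sub>v i"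
    using underdetermined_system[OF M] by blast
  define z where "z = vec n (\<lambda>j. if j \<le> i then x $ j else 0)"
  define v where "v = T *\<^sub>v z"
  have z: "z \<in> carrier_vec n" by (simp add: z_def)
  have v: "v \<in> carrier_vec n" unfolding v_def by (rule mult_mat_vec_carrier[OF Tc z])
  have Tv: "T\<^sup>\<dagger> *\<^sub>v v = z"
    using isometry_cancel(2)[OF Tc unitary_matD(2)[OF T], of z] z by (simp add: v_def)
  have Sv: "(S\<^sup>\<dagger> *\<^sub>v v) $ a = 0" if a: "a < i" for a
  proof -
    have "(S\<^sup>\<dagger> *\<^sub>v v) = (S\<^sup>\<dagger> * T) *\<^sub>v z" using Tc Sc z by (simp add: v_def mat_word)
    then have "(S\<^sup>\<dagger> *\<^sub>v v) $ a = (\<Sum>b<n. (S\<^sup>\<dagger> * T) $$ (a, b) * z $ b)"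
      using Tc Sc z a i by (simp add: scalar_prod_def atLeast0LessThan)
    also have "\<dots> = (\<Sum>b<Suc i. (S\<^sup>\<dagger> * T) $$ (a, b) * z $ b)"
      using i by (intro sum.mono_neutral_right) (auto simp: z_def)
    also have "\<dots> = (\<Sum>b<Suc i. M $$ (a, b) * x $ b)"
      using a i by (intro sum.cong) (auto simp: M_def z_def)
    also have "\<dots> = (M *\<^sub>v x) $ a"
      using M x(1) a by (simp add: scalar_prod_def atLeast0LessThan lessThan_Suc)
    finally show ?thesis using x(3) a by simp
  qed
  have Sv': "S\<^sup>\<dagger> *\<^sub>v v \<in> carrier_vec n"
    by (rule mult_mat_vec_carrier[OF adjoint_carrier[OF Sc] v])
  have "sq_norm (S\<^sup>\<dagger> *\<^sub>v v) = sq_norm v"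
    using isometry_sq_norm[of "S\<^sup>\<dagger>" n n v] Sc v unitary_matD(3)[OF S] by simp
  also have "\<dots> = sq_norm z"
    unfolding v_def using isometry_sq_norm[OF Tc unitary_matD(2)[OF T] z] .
  finally have norms: "sq_norm (S\<^sup>\<dagger> *\<^sub>v v) = sq_norm z" .
  have "z \<noteq> 0\<^sub>v n"
  proof
    assume "z = 0\<^sub>v n"
    have "x $ j = 0" if "j < Suc i" for j
    proof -
      have "z $ j = 0" using \<open>z = 0\<^sub>v n\<close> i that by simp
      then show ?thesis using i that by (simp add: z_def)
    qed
    then have "x = 0\<^sub>v (Suc i)" using x(1) by (intro eq_vecI) auto
    then show False using x(2) by simp
  qed
  then have pos: "0 < sq_norm z" using sq_norm_eq_0[OF z] sq_norm_nonneg[of z] by linarith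
  have "\<alpha> i * sq_norm z = (\<Sum>j<n. \<alpha> i * (cmod (z $ j))\<^sup>2)"
    using z by (simp add: sq_norm_def sum_distrib_left)
  also have "\<dots> \<le> (\<Sum>j<n. \<alpha> j * (cmod (z $ j))\<^sup>2)"
  proof (rule sum_mono)
    fix j assume "j \<in> {..<n}"
    then show "\<alpha> i * (cmod (z $ j))\<^sup>2 \<le> \<alpha> j * (cmod (z $ j))\<^sup>2"
      using monotone_onD[OF anti(1), of j i] i
      by (cases "j \<le> i") (auto simp: z_def intro: mult_right_mono)
  qed
  also have "\<dots> = Re ((A *\<^sub>v v) \<bullet>c v)"
    using A quadratic_form_diag[OF Tc v, of \<alpha>] by (simp add: spectral_dec_def Tv)
  also have "\<dots> \<le> Re ((B *\<^sub>v v) \<bullet>c v)"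
  proof -
    have "((B - A) *\<^sub>v v) \<bullet>c v = (B *\<^sub>v v) \<bullet>c v - (A *\<^sub>v v) \<bullet>c v"
      using Ac Bc v by (simp add: minus_mult_distrib_mat_vec[of _ n n]
          minus_scalar_prod_distrib[of _ n])
    then show ?thesis using psd v by (auto simp: psd_mat_def)
  qed
  also have "\<dots> = (\<Sum>j<n. \<beta> j * (cmod ((S\<^sup>\<dagger> *\<^sub>v v) $ j))\<^sup>2)"
    using B quadratic_form_diag[OF Sc v, of \<beta>] by (simp add: spectral_dec_def)
  also have "\<dots> \<le> (\<Sum>j<n. \<beta> i * (cmod ((S\<^sup>\<dagger> *\<^sub>v v) $ j))\<^sup>2)"
  proof (rule sum_mono)
    fix j assume "j \<in> {..<n}"
    then show "\<beta> j * (cmod ((S\<^sup>\<dagger> *\<^sub>v v) $ j))\<^sup>2 \<le> \<beta> i * (cmod ((S\<^sup>\<dagger> *\<^sub>v v) $ j))\<^sup>2"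
      using monotone_onD[OF anti(2), of i j] i Sv[of j]
      by (cases "j < i") (auto intro: mult_right_mono)
  qed
  also have "\<dots> = \<beta> i * sq_norm (S\<^sup>\<dagger> *\<^sub>v v)"
    unfolding sq_norm_def sum_distrib_left carrier_vecD[OF Sv'] ..
  also have "\<dots> = \<beta> i * sq_norm z" by (simp only: norms)
  finally show ?thesis using pos by simp
qed

lemma mat_trace_spectral_dec:
  assumes "spectral_dec n A T \<alpha>"
  shows "mat_trace A = of_real (\<Sum>i<n. \<alpha> i)"
proof -
  have T: "unitary_mat n T" and AT: "A = T * mat_diag n (\<lambda>i. complex_of_real (\<alpha> i)) * T\<^sup>\<dagger>"
    using assms by (auto simp: spectral_dec_def)
  define D where "D = mat_diag n (\<lambda>i. complex_of_real (\<alpha> i))"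
  have D: "D \<in> carrier_mat n n" by (simp add: D_def)
  note Tc = unitary_matD(1)[OF T]
  have "mat_trace A = mat_trace (T\<^sup>\<dagger> * (T * D))"
    unfolding AT D_def[symmetric] using Tc D by (intro mat_trace_comm[of _ n n]) auto
  also have "T\<^sup>\<dagger> * (T * D) = D"
    using isometry_cancel(1)[OF Tc unitary_matD(2)[OF T], of D] D by simp
  finally show ?thesis by (simp add: D_def mat_trace_def mat_diag_def)
qed

lemma spectral_dec_shift:
  assumes "spectral_dec n A T \<alpha>"
  shows "spectral_dec n (A + of_real t \<cdot>\<^sub>m 1\<^sub>m n) T (\<lambda>i. \<alpha> i + t)"
proof -
  have T: "unitary_mat n T" and AT: "A = T * mat_diag n (\<lambda>i. complex_of_real (\<alpha> i)) * T\<^sup>\<dagger>"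
    using assms by (auto simp: spectral_dec_def)
  note Tc = unitary_matD(1)[OF T]
  define D where "D = mat_diag n (\<lambda>i. complex_of_real (\<alpha> i))"
  have D: "D \<in> carrier_mat n n" by (simp add: D_def)
  have "mat_diag n (\<lambda>i. complex_of_real (\<alpha> i + t)) = D + of_real t \<cdot>\<^sub>m 1\<^sub>m n"
    by (intro eq_matI) (auto simp: mat_diag_def D_def)
  also have "T * \<dots> * T\<^sup>\<dagger> = T * D * T\<^sup>\<dagger> + of_real t \<cdot>\<^sub>m (T * T\<^sup>\<dagger>)"
    using Tc D by (simp add: mult_add_distrib_mat[of _ n n _ n] add_mult_distrib_mat[of _ n n _ _ n]
        mult_smult_distrib[of _ n n _ n] mult_smult_assoc_mat[of _ n n _ n])
  finally have "T * mat_diag n (\<lambda>i. complex_of_real (\<alpha> i + t)) * T\<^sup>\<dagger> =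
      A + of_real t \<cdot>\<^sub>m 1\<^sub>m n"
    by (simp add: AT D_def unitary_matD(3)[OF T])
  then show ?thesis using assms by (auto simp: spectral_dec_def monotone_on_def)
qed

lemma diag_conj_minus:
  assumes "unitary_mat n T"
  shows "T * mat_diag n (\<lambda>i. complex_of_real (f i)) * T\<^sup>\<dagger> - T * mat_diag n (\<lambda>i. complex_of_real (g i)) * T\<^sup>\<dagger>
    = T * mat_diag n (\<lambda>i. complex_of_real (f i - g i)) * T\<^sup>\<dagger>"
proof -
  note Tc = unitary_matD(1)[OF assms]
  define D E where "D = mat_diag n (\<lambda>i. complex_of_real (f i))"
    and "E = mat_diag n (\<lambda>i. complex_of_real (g i))"
  have D: "D \<in> carrier_mat n n" "E \<in> carrier_mat n n" by (simp_all add: D_def E_def)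
  have "mat_diag n (\<lambda>i. complex_of_real (f i - g i)) = D - E"
    by (intro eq_matI) (auto simp: mat_diag_def D_def E_def)
  also have "T * (D - E) * T\<^sup>\<dagger> = T * D * T\<^sup>\<dagger> - T * E * T\<^sup>\<dagger>"
    using Tc D by (simp add: mult_minus_distrib_mat[of _ n n _ n] minus_mult_distrib_mat[of _ n n _ _ n])
  finally show ?thesis by (simp add: D_def E_def)
qed

text \<open>The Lidskii--Wielandt inequality, after Li and Mathias. With \<open>t\<close> the \<open>card I\<close>-th largest eigenvalue of
  \<open>C - A\<close> and \<open>R\<close> the positive part of \<open>C - A - t\<close>, both \<open>C\<close> and \<open>A + t\<close> lie below \<open>A + R + t\<close>.
  Hence, by monotonicity, passing from \<open>A\<close> to \<open>A + R\<close> moves every eigenvalue up, and the sum of all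
  these moves is the trace of \<open>R\<close>.\<close>

lemma lidskii:
  assumes A: "spectral_dec n A T \<alpha>" and C: "spectral_dec n C S \<gamma>"
    and E: "spectral_dec n (C - A) U \<delta>" and I: "I \<subseteq> {..<n}"
  shows "(\<Sum>i\<in>I. \<gamma> i - \<alpha> i) \<le> (\<Sum>i<card I. \<delta> i)"
proof (cases "I = {}")
  case False
  have fin: "finite I" using I finite_subset by blast
  define p where "p = card I - 1"
  have p: "card I = Suc p" using False fin by (simp add: p_def card_gt_0_iff Suc_diff_1)
  have "card I \<le> n" using card_mono[OF _ I] by simp
  then have pn: "p < n" using p by simp
  define t where "t = \<delta> p"
  have uT: "unitary_mat n T" and uS: "unitary_mat n S" and uU: "unitary_mat n U"
    and anti: "antimono_on {..<n} \<delta>"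
    using A C E by (auto simp: spectral_dec_def)
  have Ac: "A \<in> carrier_mat n n" "A\<^sup>\<dagger> = A" and Cc: "C \<in> carrier_mat n n"
    using spectral_dec_hermitian[OF uT] spectral_dec_hermitian[OF uS] A C
    by (auto simp: spectral_dec_def)
  define R where "R = U * mat_diag n (\<lambda>i. complex_of_real (max (\<delta> i - t) 0)) * U\<^sup>\<dagger>"
  have R: "R \<in> carrier_mat n n" "R\<^sup>\<dagger> = R" using spectral_dec_hermitian[OF uU] by (auto simp: R_def)
  have anti_le: "\<delta> j \<le> \<delta> i" if "i \<le> j" "j < n" for i j
    using monotone_onD[OF anti, of i j] that by simp
  have specR: "spectral_dec n R U (\<lambda>i. max (\<delta> i - t) 0)"
  proof -
    have "antimono_on {..<n} (\<lambda>i. max (\<delta> i - t) 0)"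
    proof (rule monotone_onI)
      fix i j assume "i \<in> {..<n}" "j \<in> {..<n}" "i \<le> j"
      then have "\<delta> j \<le> \<delta> i" using anti_le by simp
      then show "max (\<delta> j - t) 0 \<le> max (\<delta> i - t) 0" by (intro max.mono) auto
    qed
    then show ?thesis using uU by (simp add: spectral_dec_def R_def)
  qed
  have psdR: "psd_mat n R" unfolding R_def by (rule psd_mat_diag[OF uU]) auto
  have "(A + R)\<^sup>\<dagger> = A + R"
  proof (rule eq_matI)
    fix i j assume "i < dim_row (A + R)" "j < dim_col (A + R)"
    then have ij: "i < n" "j < n" using R by auto
    have "(A + R)\<^sup>\<dagger> $$ (i, j) = A\<^sup>\<dagger> $$ (i, j) + R\<^sup>\<dagger> $$ (i, j)" using ij Ac(1) R(1) by simp
    then show "(A + R)\<^sup>\<dagger> $$ (i, j) = (A + R) $$ (i, j)" unfolding Ac R using ij Ac(1) R(1) by simp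
  qed (use Ac R in auto)
  then obtain W \<mu> where AR: "spectral_dec n (A + R) W \<mu>"
    using hermitian_spectral_dec[of "A + R" n] Ac R by auto
  have lower: "\<alpha> i \<le> \<mu> i" if "i < n" for i
  proof (rule weyl_monotonicity[OF A AR _ that])
    have "A + R - A = R" using Ac R by (intro eq_matI) auto
    then show "psd_mat n (A + R - A)" using psdR by simp
  qed
  have upper: "\<gamma> i \<le> \<mu> i + t" if "i < n" for i
  proof (rule weyl_monotonicity[OF C spectral_dec_shift[OF AR, of t] _ that])
    define Z where "Z = U * mat_diag n (\<lambda>i. complex_of_real (max (\<delta> i - t) 0 + t)) * U\<^sup>\<dagger>"
    from spectral_dec_shift[OF specR, of t] have Z: "R + of_real t \<cdot>\<^sub>m 1\<^sub>m n = Z"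
      by (simp add: spectral_dec_def Z_def)
    have "A + R + of_real t \<cdot>\<^sub>m 1\<^sub>m n - C = Z - (C - A)"
      unfolding Z[symmetric] using Ac Cc R by (intro eq_matI) auto
    also have "C - A = U * mat_diag n (\<lambda>i. complex_of_real (\<delta> i)) * U\<^sup>\<dagger>"
      using E by (simp add: spectral_dec_def)
    also have "Z - \<dots> = U * mat_diag n (\<lambda>i. complex_of_real (max (\<delta> i - t) 0 + t - \<delta> i)) * U\<^sup>\<dagger>"
      unfolding Z_def by (rule diag_conj_minus[OF uU])
    also have "psd_mat n \<dots>" by (rule psd_mat_diag[OF uU]) auto
    finally show "psd_mat n (A + R + of_real t \<cdot>\<^sub>m 1\<^sub>m n - C)" .
  qed
  have "(\<Sum>i<n. \<mu> i) = (\<Sum>i<n. \<alpha> i) + (\<Sum>i<n. max (\<delta> i - t) 0)"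
  proof -
    have "complex_of_real (\<Sum>i<n. \<mu> i) = of_real ((\<Sum>i<n. \<alpha> i) + (\<Sum>i<n. max (\<delta> i - t) 0))"
      using mat_trace_spectral_dec[OF specR]
        mat_trace_add[OF Ac(1) R(1)] mat_trace_spectral_dec[OF A] mat_trace_spectral_dec[OF AR]
      by simp
    then show ?thesis by (simp only: of_real_eq_iff)
  qed
  moreover have "(\<Sum>i<n. max (\<delta> i - t) 0) = (\<Sum>i<Suc p. \<delta> i - t)"
  proof -
    have "(\<Sum>i<n. max (\<delta> i - t) 0) = (\<Sum>i<Suc p. max (\<delta> i - t) 0)"
      using pn anti_le[of p] by (intro sum.mono_neutral_right) (auto simp: t_def max_def not_less)
    also have "\<dots> = (\<Sum>i<Suc p. \<delta> i - t)"
      using pn anti_le[of _ p] by (intro sum.cong) (auto simp: t_def max_absorb1 less_Suc_eq_le)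
    finally show ?thesis .
  qed
  ultimately have trace: "(\<Sum>i<n. \<mu> i - \<alpha> i) = (\<Sum>i<Suc p. \<delta> i) - Suc p * t"
    by (simp add: sum_subtractf)
  have "(\<Sum>i\<in>I. \<gamma> i - \<alpha> i) \<le> (\<Sum>i\<in>I. (\<mu> i - \<alpha> i) + t)"
    using upper I by (intro sum_mono) force
  also have "\<dots> = (\<Sum>i\<in>I. \<mu> i - \<alpha> i) + Suc p * t"
    using p by (simp add: sum.distrib)
  also have "(\<Sum>i\<in>I. \<mu> i - \<alpha> i) \<le> (\<Sum>i<n. \<mu> i - \<alpha> i)"
    using I lower by (intro sum_mono2) auto
  finally show ?thesis using trace p by simp
qed simp

section \<open>Singular value decompositions\<close>

lemma unitary_cancel:
  assumes "unitary_mat n U" "dim_row X = n"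
  shows "U\<^sup>\<dagger> * (U * X) = X" "U * (U\<^sup>\<dagger> * X) = X"
  using isometry_cancel(1)[of U n n X] isometry_cancel(1)[of "U\<^sup>\<dagger>" n n X] unitary_matD[OF assms(1)] assms(2)
  by auto

lemma initial_segment_eq_lessThan:
  fixes J :: "nat set"
  assumes "finite J" "\<And>i j. i \<le> j \<Longrightarrow> j \<in> J \<Longrightarrow> i \<in> J"
  shows "J = {..<card J}"
proof (cases "J = {}")
  case False
  then have "Max J \<in> J" using assms(1) by simp
  then have "J = {..Max J}" using assms by (auto intro: assms(2)[of _ "Max J"])
  then show ?thesis by (metis card_atMost lessThan_Suc_atMost)
qed simp

text \<open>Extending an orthonormal family to a basis. The projection \<open>Q Q\<^sup>\<dagger>\<close> has trace \<open>k\<close> and spectrum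
  in \<open>{0, 1}\<close>, so its eigenvectors beyond the first \<open>k\<close> span the orthogonal complement of the
  columns of \<open>Q\<close>.\<close>

lemma isometry_completion:
  assumes Q: "Q \<in> carrier_mat m k" "Q\<^sup>\<dagger> * Q = 1\<^sub>m k"
  shows "k \<le> m \<and> (\<exists>U. unitary_mat m U \<and> (\<forall>i<m. \<forall>j<k. U $$ (i, j) = Q $$ (i, j)))"
proof -
  define P where "P = Q * Q\<^sup>\<dagger>"
  have P: "P \<in> carrier_mat m m" "P\<^sup>\<dagger> = P" using Q(1) by (auto simp: P_def mat_word)
  have PP: "P * P = P"
    using Q isometry_cancel(1)[OF Q, of "Q\<^sup>\<dagger>"] by (simp add: P_def mat_word)
  obtain T \<nu> where sd: "spectral_dec m P T \<nu>" using hermitian_spectral_dec[OF P] by blast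
  then have T: "unitary_mat m T" and anti: "antimono_on {..<m} \<nu>"
    and PT: "P = T * mat_diag m (\<lambda>i. complex_of_real (\<nu> i)) * T\<^sup>\<dagger>"
    by (auto simp: spectral_dec_def)
  note Tc = unitary_matD(1)[OF T]
  define D where "D = mat_diag m (\<lambda>i. complex_of_real (\<nu> i))"
  have D: "D \<in> carrier_mat m m" by (simp add: D_def)
  have DP: "D = T\<^sup>\<dagger> * P * T" unfolding PT using conj_unitary_cancel[OF T D] by (simp add: D_def)
  have "D * D = T\<^sup>\<dagger> * (P * P) * T"
    using isometry_cancel(1)[of "T\<^sup>\<dagger>" m m "P * T"] Tc P(1) unitary_matD(3)[OF T]
    by (simp add: DP mat_word)
  then have DD: "D * D = D" by (simp add: PP DP)
  have l01: "\<nu> j = 0 \<or> \<nu> j = 1" if "j < m" for j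
  proof -
    have "(D * D) $$ (j, j) = complex_of_real (\<nu> j) * complex_of_real (\<nu> j)"
      using that by (simp add: D_def) (simp add: mat_diag_def)
    moreover have "D $$ (j, j) = complex_of_real (\<nu> j)"
      using that by (simp add: D_def mat_diag_def)
    ultimately have "complex_of_real (\<nu> j) * complex_of_real (\<nu> j) = complex_of_real (\<nu> j)"
      by (simp only: DD)
    then show ?thesis by auto
  qed
  define J where "J = {j. j < m \<and> \<nu> j = 1}"
  have finJ: "finite J" by (simp add: J_def)
  have J: "J = {..<card J}"
  proof (rule initial_segment_eq_lessThan[OF finJ])
    fix i j assume ij: "i \<le> j" "j \<in> J"
    then have "\<nu> j \<le> \<nu> i" using monotone_onD[OF anti, of i j] by (auto simp: J_def)
    then show "i \<in> J" using ij l01[of i] by (auto simp: J_def)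
  qed
  have "of_real (\<Sum>j<m. \<nu> j) = mat_trace P" using mat_trace_spectral_dec[OF sd] by simp
  also have "mat_trace P = mat_trace (Q\<^sup>\<dagger> * Q)"
    unfolding P_def by (rule mat_trace_comm[OF Q(1) adjoint_carrier[OF Q(1)]])
  also have "\<dots> = of_nat k" by (simp add: Q(2) mat_trace_def)
  finally have "(\<Sum>j<m. \<nu> j) = real k"
    by (metis of_real_of_nat_eq of_real_eq_iff)
  moreover have "(\<Sum>j<m. \<nu> j) = (\<Sum>j\<in>J. 1)"
    using l01 by (intro sum.mono_neutral_cong_right) (auto simp: J_def)
  ultimately have cardJ: "card J = k" by simp
  then have Jk: "J = {..<k}" using J by simp
  have km: "k \<le> m" using card_mono[of "{..<m}" J] cardJ by (auto simp: J_def)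
  have l0: "\<nu> j = 0" if "j < m" "k \<le> j" for j
  proof -
    have "j \<notin> J" using Jk that by simp
    then show ?thesis using l01[OF that(1)] that by (auto simp: J_def)
  qed
  have QT: "(Q\<^sup>\<dagger> * T) $$ (j, l) = 0" if "j < k" "l < m" "k \<le> l" for j l
  proof -
    have "Q\<^sup>\<dagger> * T = Q\<^sup>\<dagger> * (P * T)"
      using isometry_cancel(1)[OF Q, of "Q\<^sup>\<dagger> * T"] Q(1) Tc by (simp add: P_def mat_word)
    also have "P * T = T * D"
      unfolding PT D_def[symmetric] using isometry_cancel(1)[OF Tc unitary_matD(2)[OF T], of "1\<^sub>m m"]
        Tc D unitary_matD(2)[OF T] by (simp add: mat_word)
    also have "Q\<^sup>\<dagger> * (T * D) = Q\<^sup>\<dagger> * T * D"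
      using Q(1) Tc D by (simp add: mult_assoc_dim)
    finally have "(Q\<^sup>\<dagger> * T) $$ (j, l) = (Q\<^sup>\<dagger> * T * D) $$ (j, l)" by (rule arg_cong)
    also have "\<dots> = (Q\<^sup>\<dagger> * T) $$ (j, l) * \<nu> l"
      unfolding D_def
      using that mat_diag_mult_right[OF mult_carrier_mat[OF adjoint_carrier[OF Q(1)] Tc]]
      by (simp del: index_mult_mat(1))
    finally show ?thesis using l0[OF that(2,3)] by simp
  qed
  have orthQT: "(\<Sum>i<m. cnj (Q $$ (i, j)) * T $$ (i, l)) = 0" if "j < k" "l < m" "k \<le> l" for j l
    using QT[OF that] index_mult_sum[of "Q\<^sup>\<dagger>" k m T m j l] Q(1) Tc that by simp
  define U where "U = mat m m (\<lambda>(i, j). if j < k then Q $$ (i, j) else T $$ (i, j))"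
  have U: "U \<in> carrier_mat m m" by (simp add: U_def)
  have "U\<^sup>\<dagger> * U = 1\<^sub>m m"
    unfolding isometry_iff[OF U]
  proof (intro allI impI)
    fix i j assume ij: "i < m" "j < m"
    have QQ: "(\<Sum>l<m. cnj (Q $$ (l, i)) * Q $$ (l, j)) = (if i = j then 1 else 0)" if "i < k" "j < k"
      using isometry_iff[OF Q(1)] Q(2) that by auto
    have TT: "(\<Sum>l<m. cnj (T $$ (l, i)) * T $$ (l, j)) = (if i = j then 1 else 0)"
      using isometry_iff[OF Tc] unitary_matD(2)[OF T] ij by auto
    have TQ: "(\<Sum>l<m. cnj (T $$ (l, i)) * Q $$ (l, j)) = 0" if "\<not> i < k" "j < k"
    proof -
      have "cnj (\<Sum>l<m. cnj (Q $$ (l, j)) * T $$ (l, i)) = 0"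
        using orthQT[of j i] that ij by simp
      then show ?thesis by (simp add: mult.commute)
    qed
    show "(\<Sum>l<m. cnj (U $$ (l, i)) * U $$ (l, j)) = (if i = j then 1 else 0)"
      using ij QQ TT TQ orthQT[of i j] by (cases "i < k"; cases "j < k") (auto simp: U_def)
  qed
  then have "unitary_mat m U" using U by (rule unitary_matI[rotated])
  moreover have "\<forall>i<m. \<forall>j<k. U $$ (i, j) = Q $$ (i, j)" using km by (auto simp: U_def)
  ultimately show ?thesis using km by blast
qed

definition rdiag :: "nat \<Rightarrow> nat \<Rightarrow> (nat \<Rightarrow> real) \<Rightarrow> complex mat" where
  "rdiag m n d = mat m n (\<lambda>(i, j). if i = j then complex_of_real (d i) else 0)"

lemma rdiag_carrier [simp]: "rdiag m n d \<in> carrier_mat m n"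
  by (simp add: rdiag_def)

lemma rdiag_dims [simp]: "dim_row (rdiag m n d) = m" "dim_col (rdiag m n d) = n"
  by (simp_all add: rdiag_def)

lemma rdiag_index: "i < m \<Longrightarrow> j < n \<Longrightarrow> rdiag m n d $$ (i, j) = (if i = j then of_real (d i) else 0)"
  by (simp add: rdiag_def)

lemma adjoint_rdiag [simp]: "(rdiag m n d)\<^sup>\<dagger> = rdiag n m d"
  by (rule eq_matI) (auto simp: rdiag_def)

lemma mult_rdiag_index:
  assumes "A \<in> carrier_mat p m" "i < p" "j < n"
  shows "(A * rdiag m n d) $$ (i, j) = (if j < m then A $$ (i, j) * of_real (d j) else 0)"
proof -
  have "(A * rdiag m n d) $$ (i, j) = (\<Sum>l<m. A $$ (i, l) * rdiag m n d $$ (l, j))"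
    using assms by (intro index_mult_sum) auto
  also have "\<dots> = (\<Sum>l<m. if l = j then A $$ (i, j) * of_real (d j) else 0)"
    using assms by (intro sum.cong) (auto simp: rdiag_index)
  also have "\<dots> = (if j < m then A $$ (i, j) * of_real (d j) else 0)" by simp
  finally show ?thesis .
qed

lemma rdiag_sandwich_index:
  assumes "V \<in> carrier_mat p m" "W \<in> carrier_mat p' n" "i < p" "l < p'"
  shows "(V * rdiag m n d * W\<^sup>\<dagger>) $$ (i, l) =
    (\<Sum>j<min m n. V $$ (i, j) * of_real (d j) * cnj (W $$ (l, j)))"
proof -
  have "(V * rdiag m n d * W\<^sup>\<dagger>) $$ (i, l) = (\<Sum>j<n. (V * rdiag m n d) $$ (i, j) * W\<^sup>\<dagger> $$ (j, l))"
    using assms by (intro index_mult_sum) auto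
  also have "\<dots> = (\<Sum>j<n. if j < m then V $$ (i, j) * of_real (d j) * cnj (W $$ (l, j)) else 0)"
    using assms by (intro sum.cong) (auto simp: mult_rdiag_index[of V p m] simp del: index_mult_mat(1))
  also have "\<dots> = (\<Sum>j<min m n. V $$ (i, j) * of_real (d j) * cnj (W $$ (l, j)))"
    by (intro sum.mono_neutral_cong_right) auto
  finally show ?thesis .
qed

lemma rdiag_mult_rdiag:
  "rdiag n m d * rdiag m n d = mat_diag n (\<lambda>i. complex_of_real (if i < m then (d i)\<^sup>2 else 0))"
proof (rule eq_matI)
  fix i j
  assume "i < dim_row (mat_diag n (\<lambda>i. complex_of_real (if i < m then (d i)\<^sup>2 else 0)))"
    "j < dim_col (mat_diag n (\<lambda>i. complex_of_real (if i < m then (d i)\<^sup>2 else 0)))"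
  then have ij: "i < n" "j < n" by auto
  have "(rdiag n m d * rdiag m n d) $$ (i, j) = (if j < m then rdiag n m d $$ (i, j) * of_real (d j) else 0)"
    using ij by (intro mult_rdiag_index[of _ n]) auto
  then show "(rdiag n m d * rdiag m n d) $$ (i, j) =
      mat_diag n (\<lambda>i. complex_of_real (if i < m then (d i)\<^sup>2 else 0)) $$ (i, j)"
    using ij by (simp add: rdiag_index mat_diag_def power2_eq_square)
qed auto

text \<open>All \<open>min m n\<close> singular values are kept, including zeros, so that the rank is not part of the data.\<close>

definition svd :: "nat \<Rightarrow> nat \<Rightarrow> complex mat \<Rightarrow> complex mat \<Rightarrow> (nat \<Rightarrow> real) \<Rightarrow> complex mat \<Rightarrow> bool"
  where "svd m n F V s W \<longleftrightarrow> unitary_mat m V \<and> unitary_mat n W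
     \<and> (\<forall>i<min m n. 0 \<le> s i) \<and> antimono_on {..<min m n} s \<and> F = V * rdiag m n s * W\<^sup>\<dagger>"

lemma svdD:
  assumes "svd m n F V s W"
  shows "unitary_mat m V" "unitary_mat n W" "\<And>i. i < min m n \<Longrightarrow> 0 \<le> s i"
    "\<And>i j. i \<le> j \<Longrightarrow> j < min m n \<Longrightarrow> s j \<le> s i" "F = V * rdiag m n s * W\<^sup>\<dagger>"
    "F \<in> carrier_mat m n"
  using assms by (auto simp: svd_def monotone_on_def unitary_mat_def)

lemma svd_mult_right:
  assumes "svd m n F V s W"
  shows "F * W = V * rdiag m n s" "F\<^sup>\<dagger> * V = W * rdiag n m s"
proof -
  note V = svdD(1)[OF assms] and W = svdD(2)[OF assms]
  note c = unitary_matD(1)[OF V] unitary_matD(1)[OF W]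
  show "F * W = V * rdiag m n s"
    unfolding svdD(5)[OF assms] using c unitary_matD(2)[OF W]
    by (simp add: mat_word right_mult_one_mat[of _ m n])
  show "F\<^sup>\<dagger> * V = W * rdiag n m s"
    unfolding svdD(5)[OF assms] using c unitary_matD(2)[OF V]
    by (simp add: mat_word right_mult_one_mat[of _ n m])
qed

lemma svd_adjoint:
  assumes "svd m n F V s W"
  shows "svd n m (F\<^sup>\<dagger>) W s V"
  using assms unitary_matD(1)[OF svdD(1)[OF assms]] unitary_matD(1)[OF svdD(2)[OF assms]]
  by (auto simp: svd_def mat_word min.commute)

text \<open>Right singular vectors are eigenvectors \<open>w\<^sub>j\<close> of \<open>F\<^sup>\<dagger> F\<close>. Their images \<open>F w\<^sub>j\<close> are orthogonal with squared
  norms the eigenvalues, so the nonzero ones, normalized, start an orthonormal basis of left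
  singular vectors.\<close>

lemma svd_exists:
  assumes F: "F \<in> carrier_mat m n"
  shows "\<exists>V s W. svd m n F V s W"
proof -
  have FF: "F\<^sup>\<dagger> * F \<in> carrier_mat n n" "(F\<^sup>\<dagger> * F)\<^sup>\<dagger> = F\<^sup>\<dagger> * F" using F by (auto simp: mat_word)
  obtain W \<mu> where sd: "spectral_dec n (F\<^sup>\<dagger> * F) W \<mu>" using hermitian_spectral_dec[OF FF] by blast
  then have W: "unitary_mat n W" and anti: "antimono_on {..<n} \<mu>"
    and FW: "F\<^sup>\<dagger> * F = W * mat_diag n (\<lambda>i. complex_of_real (\<mu> i)) * W\<^sup>\<dagger>"
    by (auto simp: spectral_dec_def)
  note Wc = unitary_matD(1)[OF W]
  define G where "G = F * W"
  have G: "G \<in> carrier_mat m n" using F Wc by (simp add: G_def)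
  have "G\<^sup>\<dagger> * G = W\<^sup>\<dagger> * (F\<^sup>\<dagger> * F) * W" using F Wc by (simp add: G_def mat_word)
  also have "\<dots> = mat_diag n (\<lambda>i. complex_of_real (\<mu> i))"
    unfolding FW by (rule conj_unitary_cancel[OF W]) simp
  finally have GG: "G\<^sup>\<dagger> * G = mat_diag n (\<lambda>i. complex_of_real (\<mu> i))" .
  have G_orth: "(\<Sum>l<m. cnj (G $$ (l, i)) * G $$ (l, j)) = (if i = j then of_real (\<mu> j) else 0)"
    if "i < n" "j < n" for i j
  proof -
    have "(\<Sum>l<m. cnj (G $$ (l, i)) * G $$ (l, j)) = (G\<^sup>\<dagger> * G) $$ (i, j)"
      using that G by (subst index_mult_sum[of _ n m _ n]) (auto intro!: sum.cong)
    then show ?thesis using that by (simp only: GG) (simp add: mat_diag_def)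
  qed
  have G_norm: "(\<Sum>l<m. (cmod (G $$ (l, j)))\<^sup>2) = \<mu> j" if "j < n" for j
  proof -
    have "(\<Sum>l<m. cnj (G $$ (l, j)) * G $$ (l, j)) = of_real (\<Sum>l<m. (cmod (G $$ (l, j)))\<^sup>2)"
      by (simp add: complex_norm_square mult.commute del: of_real_power)
    then have "complex_of_real (\<Sum>l<m. (cmod (G $$ (l, j)))\<^sup>2) = of_real (\<mu> j)"
      using G_orth[OF that that] by simp
    then show ?thesis by (simp only: of_real_eq_iff)
  qed
  have mu0: "0 \<le> \<mu> j" if "j < n" for j
    unfolding G_norm[OF that, symmetric] by (intro sum_nonneg) auto
  define J where "J = {j. j < n \<and> \<mu> j \<noteq> 0}"
  define r where "r = card J"
  have J: "J = {..<r}"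
    unfolding r_def
  proof (rule initial_segment_eq_lessThan)
    fix i j assume ij: "i \<le> j" "j \<in> J"
    then have "\<mu> j \<le> \<mu> i" using monotone_onD[OF anti, of i j] by (auto simp: J_def)
    then show "i \<in> J" using ij mu0[of j] by (auto simp: J_def)
  qed (simp add: J_def)
  have rn: "r \<le> n" using card_mono[of "{..<n}" J] by (auto simp: J_def r_def)
  have mu_pos: "0 < \<mu> j" if "j < r" for j
  proof -
    have "j \<in> J" using J that by simp
    then show ?thesis using mu0[of j] by (simp add: J_def less_le)
  qed
  have mu_0: "\<mu> j = 0" if "j < n" "r \<le> j" for j
  proof -
    have "j \<notin> J" using J that by simp
    then show ?thesis using that by (simp add: J_def)
  qed
  define s where "s j = sqrt (\<mu> j)" for j
  define Q where "Q = mat m r (\<lambda>(i, j). G $$ (i, j) / of_real (s j))"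
  have Q: "Q \<in> carrier_mat m r" by (simp add: Q_def)
  have "Q\<^sup>\<dagger> * Q = 1\<^sub>m r"
    unfolding isometry_iff[OF Q]
  proof (intro allI impI)
    fix i j assume ij: "i < r" "j < r"
    have "(\<Sum>l<m. cnj (Q $$ (l, i)) * Q $$ (l, j)) =
        (\<Sum>l<m. cnj (G $$ (l, i)) * G $$ (l, j)) / (of_real (s i) * of_real (s j))"
      using ij by (simp add: Q_def sum_divide_distrib)
    also have "\<dots> = (if i = j then 1 else 0)"
      using ij rn mu_pos[of j] G_orth[of i j]
      by (auto simp: s_def of_real_mult[symmetric] simp del: of_real_mult)
    finally show "(\<Sum>l<m. cnj (Q $$ (l, i)) * Q $$ (l, j)) = (if i = j then 1 else 0)" .
  qed
  from isometry_completion[OF Q this] obtain V where rm: "r \<le> m" and V: "unitary_mat m V"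
    and VQ: "\<And>i j. i < m \<Longrightarrow> j < r \<Longrightarrow> V $$ (i, j) = Q $$ (i, j)" by blast
  note Vc = unitary_matD(1)[OF V]
  have "G = V * rdiag m n s"
  proof (rule eq_matI)
    fix i j assume "i < dim_row (V * rdiag m n s)" "j < dim_col (V * rdiag m n s)"
    then have ij: "i < m" "j < n" using Vc by auto
    show "G $$ (i, j) = (V * rdiag m n s) $$ (i, j)"
    proof (cases "j < r")
      case True
      then show ?thesis
        using ij rm mu_pos[OF True] VQ[of i j] mult_rdiag_index[OF Vc ij, of s]
        by (simp add: Q_def s_def del: index_mult_mat(1))
    next
      case False
      then have "(\<Sum>l<m. (cmod (G $$ (l, j)))\<^sup>2) = 0" using G_norm ij mu_0 by simp
      then have "G $$ (i, j) = 0" using ij by (subst (asm) sum_nonneg_eq_0_iff) auto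
      then show ?thesis
        using False ij mu_0[of j] mult_rdiag_index[OF Vc ij, of s]
        by (simp add: s_def del: index_mult_mat(1))
    qed
  qed (use G Vc in auto)
  moreover have "F = G * W\<^sup>\<dagger>"
    using F Wc unitary_matD(3)[OF W] by (simp add: G_def mat_word)
  ultimately have "F = V * rdiag m n s * W\<^sup>\<dagger>" by simp
  moreover have "antimono_on {..<min m n} s"
    using monotone_onD[OF anti] by (intro monotone_onI) (auto simp: s_def)
  ultimately have "svd m n F V s W"
    using V W mu0 by (auto simp: svd_def s_def)
  then show ?thesis by blast
qed


section \<open>Singular values and rank\<close>

text \<open>If \<open>P\<close> and \<open>R\<close> have the same square, then in eigenbases the change-of-basis entry between
  eigenvalues \<open>a\<close> and \<open>b\<close> is annihilated by \<open>a\<^sup>2 - b\<^sup>2\<close>, hence by \<open>a - b\<close> when \<open>a, b \<ge> 0\<close>.\<close>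

lemma psd_square_root_unique:
  assumes T: "unitary_mat n T" and S: "unitary_mat n S"
    and a: "\<And>i. i < n \<Longrightarrow> 0 \<le> a i" and b: "\<And>i. i < n \<Longrightarrow> 0 \<le> b i"
    and P: "P = T * mat_diag n (\<lambda>i. complex_of_real (a i)) * T\<^sup>\<dagger>"
    and R: "R = S * mat_diag n (\<lambda>i. complex_of_real (b i)) * S\<^sup>\<dagger>"
    and PR: "P * P = R * R"
  shows "P = R"
proof -
  define A B where "A = mat_diag n (\<lambda>i. complex_of_real (a i))"
    and "B = mat_diag n (\<lambda>i. complex_of_real (b i))"
  have c: "A \<in> carrier_mat n n" "B \<in> carrier_mat n n" "T \<in> carrier_mat n n" "S \<in> carrier_mat n n"
    using unitary_matD(1)[OF T] unitary_matD(1)[OF S] by (simp_all add: A_def B_def)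
  note cancel = unitary_cancel[OF T] unitary_cancel[OF S]
  define M where "M = T\<^sup>\<dagger> * S"
  have M: "M \<in> carrier_mat n n" using c by (auto simp: M_def)
  have PP: "P * P = T * (A * A) * T\<^sup>\<dagger>" and RR: "R * R = S * (B * B) * S\<^sup>\<dagger>"
    using c unfolding P R A_def[symmetric] B_def[symmetric] by (simp_all add: mult_assoc_dim cancel)
  have "(A * A) * M = T\<^sup>\<dagger> * (P * P) * S"
    unfolding PP M_def using c by (simp add: mult_assoc_dim cancel)
  also have "\<dots> = M * (B * B)"
    unfolding PR RR M_def using c unitary_matD(2)[OF S] by (simp add: mult_assoc_dim cancel)
  finally have AM: "(A * A) * M = M * (B * B)" .
  have "A * M = M * B"
  proof (rule eq_matI)
    fix i j assume "i < dim_row (M * B)" "j < dim_col (M * B)"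
    then have ij: "i < n" "j < n" using M c by auto
    have "((A * A) * M) $$ (i, j) = (M * (B * B)) $$ (i, j)" by (simp only: AM)
    then have "complex_of_real (a i * a i) * M $$ (i, j) = M $$ (i, j) * complex_of_real (b j * b j)"
      using ij unfolding A_def B_def mat_diag_diag mat_diag_mult_left[OF M] mat_diag_mult_right[OF M]
      by simp
    then have "complex_of_real (a i * a i - b j * b j) * M $$ (i, j) = 0"
      by (simp add: algebra_simps)
    then have "a i * a i = b j * b j \<or> M $$ (i, j) = 0"
      by (simp only: mult_eq_0_iff of_real_eq_0_iff right_minus_eq)
    then have "a i = b j \<or> M $$ (i, j) = 0"
      using a[OF ij(1)] b[OF ij(2)] by (metis real_sqrt_mult_self abs_of_nonneg real_sqrt_mult)
    then show "(A * M) $$ (i, j) = (M * B) $$ (i, j)"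
      using ij unfolding A_def B_def mat_diag_mult_left[OF M] mat_diag_mult_right[OF M] by auto
  qed (use M c in auto)
  moreover have "P = T * (A * M) * S\<^sup>\<dagger>"
    unfolding P A_def[symmetric] M_def using c unitary_matD(3)[OF S] by (simp add: mult_assoc_dim cancel)
  moreover have "R = T * (M * B) * S\<^sup>\<dagger>"
    unfolding R B_def[symmetric] M_def using c unitary_matD(3)[OF T]
    by (simp add: mult_assoc_dim cancel)
  ultimately show ?thesis by simp
qed

lemma psd_spectral_dec:
  assumes "psd_mat n P" "spectral_dec n P T \<alpha>" "i < n"
  shows "0 \<le> \<alpha> i"
proof -
  have T: "unitary_mat n T" using assms by (simp add: spectral_dec_def)
  note Tc = unitary_matD(1)[OF T]
  define v where "v = col T i"
  have v: "v \<in> carrier_vec n" using Tc by (simp add: v_def col_def)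
  have Tv: "(T\<^sup>\<dagger> *\<^sub>v v) $ j = (if j = i then 1 else 0)" if "j < n" for j
  proof -
    have "(T\<^sup>\<dagger> *\<^sub>v v) $ j = (T\<^sup>\<dagger> * T) $$ (j, i)" using that assms(3) Tc by (simp add: v_def)
    then show ?thesis using that assms(3) unitary_matD(2)[OF T] by simp
  qed
  have "0 \<le> Re ((P *\<^sub>v v) \<bullet>c v)" using assms(1) v by (simp add: psd_mat_def)
  also have "\<dots> = (\<Sum>j<n. \<alpha> j * (cmod ((T\<^sup>\<dagger> *\<^sub>v v) $ j))\<^sup>2)"
    using assms(2) quadratic_form_diag[OF Tc v, of \<alpha>] by (simp add: spectral_dec_def)
  also have "\<dots> = (\<Sum>j<n. if j = i then \<alpha> i else 0)"
    using Tv by (intro sum.cong) auto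
  also have "\<dots> = \<alpha> i" using assms(3) by simp
  finally show ?thesis .
qed

text \<open>The description by \<open>THE\<close> is met because any other positive semidefinite root has a spectral
  decomposition as well, to which the uniqueness above applies.\<close>

lemma psd_sqrt_diag:
  assumes T: "unitary_mat n T" and a: "\<And>i. i < n \<Longrightarrow> 0 \<le> a i"
  shows "psd_sqrt (T * mat_diag n (\<lambda>i. complex_of_real ((a i)\<^sup>2)) * T\<^sup>\<dagger>) =
    T * mat_diag n (\<lambda>i. complex_of_real (a i)) * T\<^sup>\<dagger>"
proof -
  define P where "P = T * mat_diag n (\<lambda>i. complex_of_real (a i)) * T\<^sup>\<dagger>"
  note Tc = unitary_matD(1)[OF T]
  have "P * P = T * (mat_diag n (\<lambda>i. complex_of_real (a i)) * mat_diag n (\<lambda>i. complex_of_real (a i))) * T\<^sup>\<dagger>"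
    unfolding P_def using Tc by (simp add: mult_assoc_dim unitary_cancel[OF T] del: mat_diag_diag)
  then have PP: "P * P = T * mat_diag n (\<lambda>i. complex_of_real ((a i)\<^sup>2)) * T\<^sup>\<dagger>"
    by (simp add: power2_eq_square)
  have psdP: "psd_mat n P" unfolding P_def by (rule psd_mat_diag[OF T a])
  have dim: "dim_row (P * P) = n" using psdP by (auto simp: psd_mat_def)
  have "(THE P'. psd_mat n P' \<and> P' * P' = P * P) = P"
  proof (rule the_equality)
    fix R assume R: "psd_mat n R \<and> R * R = P * P"
    then have "R \<in> carrier_mat n n" "R\<^sup>\<dagger> = R" by (auto simp: psd_mat_def)
    then obtain S \<beta> where sd: "spectral_dec n R S \<beta>" using hermitian_spectral_dec by blast
    have "0 \<le> \<beta> i" if "i < n" for i using psd_spectral_dec[OF _ sd that] R by blast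
    then show "R = P"
      using psd_square_root_unique[of n S T \<beta> a R P] sd R T a by (auto simp: spectral_dec_def P_def)
  qed (use psdP in simp)
  then have "psd_sqrt (P * P) = P" unfolding psd_sqrt_def dim .
  then show ?thesis unfolding PP unfolding P_def .
qed

lemma char_poly_diag_conj:
  assumes T: "unitary_mat n T"
  shows "char_poly (T * mat_diag n f * T\<^sup>\<dagger>) = (\<Prod>i\<leftarrow>[0..<n]. [:- f i, 1:])"
proof -
  note Tc = unitary_matD(1)[OF T]
  have "similar_mat (T * mat_diag n f * T\<^sup>\<dagger>) (mat_diag n f)"
    using similar_mat_witI[OF unitary_matD(3,2)[OF T] refl
        mult_carrier_mat[OF mult_carrier_mat[OF Tc mat_diag_dim] adjoint_carrier[OF Tc]]
        mat_diag_dim Tc adjoint_carrier[OF Tc]]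
    by (auto simp: similar_mat_def)
  then have "char_poly (T * mat_diag n f * T\<^sup>\<dagger>) = char_poly (mat_diag n f)"
    by (rule char_poly_similar)
  also have "\<dots> = (\<Prod>e\<leftarrow>diag_mat (mat_diag n f). [:- e, 1:])"
    by (rule char_poly_upper_triangular[of _ n]) (auto simp: mat_diag_def)
  also have "diag_mat (mat_diag n f) = map f [0..<n]"
    by (auto simp: diag_mat_def mat_diag_def)
  finally show ?thesis by (simp add: comp_def)
qed

lemma proots_prod_linear: "proots (\<Prod>e\<leftarrow>es. [:- e, 1:]) = mset (es :: complex list)"
proof (induction es)
  case (Cons e es)
  have "(\<Prod>e\<leftarrow>es. [:- e, 1:]) \<noteq> 0" by (auto simp: prod_list_zero_iff)
  then have "proots ([:- e, 1:] * (\<Prod>e\<leftarrow>es. [:- e, 1:])) = proots [:- e, 1:] + mset es"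
    by (subst proots_mult) (auto simp: Cons.IH)
  then show ?case by simp
qed simp

lemma eigenvalues_desc_diag:
  assumes T: "unitary_mat n T" and anti: "antimono_on {..<n} a"
  shows "eigenvalues_desc (T * mat_diag n (\<lambda>i. complex_of_real (a i)) * T\<^sup>\<dagger>) = map a [0..<n]"
proof -
  have "char_poly (T * mat_diag n (\<lambda>i. complex_of_real (a i)) * T\<^sup>\<dagger>) =
      (\<Prod>e\<leftarrow>map (\<lambda>i. complex_of_real (a i)) [0..<n]. [:- e, 1:])"
    unfolding char_poly_diag_conj[OF T] map_map comp_def ..
  then have "image_mset Re (proots (char_poly (T * mat_diag n (\<lambda>i. complex_of_real (a i)) * T\<^sup>\<dagger>))) =
      image_mset Re (mset (map (\<lambda>i. complex_of_real (a i)) [0..<n]))"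
    by (simp only: proots_prod_linear)
  also have "\<dots> = mset (map a [0..<n])"
    unfolding mset_map[symmetric] map_map comp_def Re_complex_of_real ..
  also have "\<dots> = mset (rev (map a [0..<n]))" by (simp only: mset_rev)
  finally have m: "image_mset Re (proots (char_poly (T * mat_diag n (\<lambda>i. complex_of_real (a i)) * T\<^sup>\<dagger>))) =
      mset (rev (map a [0..<n]))" .
  have "sorted (rev (map a [0..<n]))"
    unfolding sorted_iff_nth_mono
  proof (intro allI impI)
    fix i j assume ij: "i \<le> j" "j < length (rev (map a [0..<n]))"
    then have "a (n - Suc i) \<le> a (n - Suc j)"
      by (intro monotone_onD[OF anti]) auto
    then show "rev (map a [0..<n]) ! i \<le> rev (map a [0..<n]) ! j" using ij by (simp add: rev_nth)
  qed
  then have "sort (rev (map a [0..<n])) = rev (map a [0..<n])" by (rule sorted_sort_id)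
  then show ?thesis
    unfolding eigenvalues_desc_def m sorted_list_of_multiset_mset by (simp only: rev_rev_ident)
qed

lemma singular_values_svd:
  assumes "svd m n F V s W"
  shows "singular_values F = vec (min m n) s"
proof -
  note V = svdD(1)[OF assms] and W = svdD(2)[OF assms]
  note c = unitary_matD(1)[OF V] unitary_matD(1)[OF W]
  define a where "a i = (if i < m then s i else 0)" for i
  have a0: "0 \<le> a i" if "i < n" for i using svdD(3)[OF assms] that by (simp add: a_def)
  have anti: "antimono_on {..<n} a"
    using svdD(4)[OF assms] svdD(3)[OF assms] by (intro monotone_onI) (auto simp: a_def)
  have "F\<^sup>\<dagger> * F = W * (rdiag n m s * rdiag m n s) * W\<^sup>\<dagger>"
    unfolding svdD(5)[OF assms] using c by (simp add: mat_word unitary_cancel[OF V])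
  also have "rdiag n m s * rdiag m n s = mat_diag n (\<lambda>i. complex_of_real ((a i)\<^sup>2))"
    unfolding rdiag_mult_rdiag by (rule arg_cong[of _ _ "mat_diag n"]) (auto simp: a_def)
  finally have "psd_sqrt (F\<^sup>\<dagger> * F) = W * mat_diag n (\<lambda>i. complex_of_real (a i)) * W\<^sup>\<dagger>"
    using psd_sqrt_diag[OF W a0] by simp
  then have "eigenvalues_desc (psd_sqrt (F\<^sup>\<dagger> * F)) = map a [0..<n]"
    using eigenvalues_desc_diag[OF W anti] by simp
  then show ?thesis
    using svdD(6)[OF assms] by (intro eq_vecI) (auto simp: singular_values_def a_def)
qed

lemma (in vec_space) span_cols:
  assumes A: "A \<in> carrier_mat n nc"
  shows "span (set (cols A)) = {A *\<^sub>v x |x. x \<in> carrier_vec nc}"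
proof -
  have sub: "set (cols A) \<subseteq> carrier_vec n" using cols_dim[of A] unfolding carrier_matD(1)[OF A] .
  have len: "length (cols A) = nc" unfolding cols_length by (rule carrier_matD(2)[OF A])
  have mc: "mat_of_cols n (cols A) = A" using mat_of_cols_cols[of A] unfolding carrier_matD(1)[OF A] .
  have "\<forall>w\<in>set (cols A). dim_vec w = n" using sub carrier_vecD by blast
  from lincomb_list_as_mat_mult[OF this]
  have lin: "lincomb_list c (cols A) = A *\<^sub>v vec nc c" for c unfolding mc len .
  have "span (set (cols A)) = span_list (cols A)" by (rule span_list_as_span[OF sub, symmetric])
  also have "\<dots> = {A *\<^sub>v vec nc c |c. True}" unfolding span_list_def lin by blast
  also have "\<dots> = {A *\<^sub>v x |x. x \<in> carrier_vec nc}"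
  proof -
    have "vec nc (\<lambda>i. x $ i) = x" if "x \<in> carrier_vec nc" for x :: "'a vec"
      using that by (intro eq_vecI) auto
    then have "\<exists>c. u = A *\<^sub>v vec nc c" if "u \<in> {A *\<^sub>v x |x. x \<in> carrier_vec nc}" for u
      using that by (smt (verit) mem_Collect_eq)
    moreover have "vec nc c \<in> carrier_vec nc" for c :: "nat \<Rightarrow> 'a" by simp
    ultimately show ?thesis by blast
  qed
  finally show ?thesis .
qed

lemma (in vec_space) rank_cong_range:
  assumes "A \<in> carrier_mat n p" "B \<in> carrier_mat n q"
    "{A *\<^sub>v x |x. x \<in> carrier_vec p} = {B *\<^sub>v x |x. x \<in> carrier_vec q}"
  shows "rank A = rank B"
  unfolding rank_def span_cols[OF assms(1)] span_cols[OF assms(2)] assms(3) ..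

lemma rank_isometry:
  assumes Q: "Q \<in> carrier_mat m k" "Q\<^sup>\<dagger> * Q = 1\<^sub>m k"
  shows "vec_space.rank m Q = k"
proof -
  interpret vec_space "TYPE(complex)" m .
  have dist: "distinct (cols Q)"
  proof (rule ccontr)
    assume "\<not> distinct (cols Q)"
    then obtain i j where ij: "i < k" "j < k" "i \<noteq> j" "cols Q ! i = cols Q ! j"
      using Q(1) by (auto simp: distinct_conv_nth)
    then have eq: "col Q i = col Q j" using Q(1) by simp
    have e: "(\<Sum>l<m. cnj (Q $$ (l, i)) * Q $$ (l, j)) = (\<Sum>l<m. cnj (Q $$ (l, i)) * Q $$ (l, i))"
    proof (rule sum.cong[OF refl])
      fix l assume "l \<in> {..<m}"
      then have "Q $$ (l, i) = Q $$ (l, j)"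
        using arg_cong[OF eq, of "\<lambda>v. v $ l"] ij Q(1) by simp
      then show "cnj (Q $$ (l, i)) * Q $$ (l, j) = cnj (Q $$ (l, i)) * Q $$ (l, i)" by simp
    qed
    have "(\<Sum>l<m. cnj (Q $$ (l, i)) * Q $$ (l, j)) = 0"
      "(\<Sum>l<m. cnj (Q $$ (l, i)) * Q $$ (l, i)) = 1"
      using isometry_iff[OF Q(1)] Q(2) ij by auto
    then show False unfolding e by simp
  qed
  have "lin_indpt (set (cols Q))"
  proof
    assume "lin_dep (set (cols Q))"
    then obtain v where v: "v \<in> carrier_vec k" "v \<noteq> 0\<^sub>v k" "Q *\<^sub>v v = 0\<^sub>v m"
      using lin_depE[OF Q(1) _ dist] by blast
    have "v = Q\<^sup>\<dagger> *\<^sub>v (Q *\<^sub>v v)" using isometry_cancel(2)[OF Q, of v] v(1) by simp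
    also have "\<dots> = 0\<^sub>v k" unfolding v(3) using Q(1) by (intro eq_vecI) auto
    finally show False using v(2) by simp
  qed
  then show ?thesis by (rule lin_indpt_full_rank[OF Q(1) dist])
qed

text \<open>\<open>F\<close> has the same range as the matrix of those left singular vectors whose singular value is
  nonzero, and these are orthonormal.\<close>

lemma mat_rank_svd:
  assumes svd: "svd m n F V s W"
  shows "mat_rank F = card {i. i < min m n \<and> s i \<noteq> 0}"
    and "{i. i < min m n \<and> s i \<noteq> 0} = {..<mat_rank F}"
proof -
  note V = svdD(1)[OF svd] and W = svdD(2)[OF svd]
  note Vc = unitary_matD(1)[OF V] and Wc = unitary_matD(1)[OF W] and Fc = svdD(6)[OF svd]
  define J where "J = {i. i < min m n \<and> s i \<noteq> 0}"
  define r where "r = card J"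
  have J: "J = {..<r}"
    unfolding r_def
  proof (rule initial_segment_eq_lessThan)
    fix i j assume ij: "i \<le> j" "j \<in> J"
    then have "s j \<le> s i" "0 \<le> s j" using svdD(3,4)[OF svd] by (auto simp: J_def)
    then show "i \<in> J" using ij by (auto simp: J_def)
  qed (simp add: J_def)
  have "J \<subseteq> {..<min m n}" by (auto simp: J_def)
  from card_mono[OF _ this] have r: "r \<le> m" "r \<le> n" by (auto simp: r_def)
  have s_nz: "s j \<noteq> 0" if "j < r" for j
  proof -
    have "j \<in> J" using J that by simp
    then show ?thesis by (simp add: J_def)
  qed
  have s_0: "s j = 0" if "r \<le> j" "j < min m n" for j
  proof -
    have "j \<notin> J" using J that by simp
    then show ?thesis using that by (simp add: J_def)
  qed
  define Q where "Q = mat m r (\<lambda>(i, j). V $$ (i, j))"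
  have Q: "Q \<in> carrier_mat m r" by (simp add: Q_def)
  have QQ: "Q\<^sup>\<dagger> * Q = 1\<^sub>m r"
    using isometry_iff[OF Q] isometry_iff[OF Vc] unitary_matD(2)[OF V] r
    by (simp add: Q_def)
  have FW: "(F *\<^sub>v x) $ i = (\<Sum>j<r. Q $$ (i, j) * (of_real (s j) * (W\<^sup>\<dagger> *\<^sub>v x) $ j))"
    if x: "x \<in> carrier_vec n" and i: "i < m" for x i
  proof -
    define y where "y = W\<^sup>\<dagger> *\<^sub>v x"
    have y: "y \<in> carrier_vec n" unfolding y_def by (rule mult_mat_vec_carrier[OF adjoint_carrier[OF Wc] x])
    have "F *\<^sub>v x = (V * rdiag m n s) *\<^sub>v y"
      unfolding svdD(5)[OF svd] y_def using Vc Wc x by (simp add: mult_mat_vec_assoc_dim)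
    then have "(F *\<^sub>v x) $ i = (\<Sum>j<n. (V * rdiag m n s) $$ (i, j) * y $ j)"
      using Vc i y by (simp add: scalar_prod_def atLeast0LessThan del: index_mult_mat(1))
    also have "\<dots> = (\<Sum>j<n. (if j < m then V $$ (i, j) * of_real (s j) else 0) * y $ j)"
      using i by (intro sum.cong) (auto simp: mult_rdiag_index[OF Vc] simp del: index_mult_mat(1))
    also have "\<dots> = (\<Sum>j<r. Q $$ (i, j) * (of_real (s j) * y $ j))"
      using i r s_0 by (intro sum.mono_neutral_cong_right) (auto simp: Q_def)
    finally show ?thesis by (simp add: y_def)
  qed
  have "{F *\<^sub>v x |x. x \<in> carrier_vec n} = {Q *\<^sub>v x |x. x \<in> carrier_vec r}"
  proof (intro equalityI subsetI)
    fix u assume "u \<in> {F *\<^sub>v x |x. x \<in> carrier_vec n}"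
    then obtain x where x: "x \<in> carrier_vec n" "u = F *\<^sub>v x" by (elim CollectE exE conjE)
    have "u = Q *\<^sub>v vec r (\<lambda>j. of_real (s j) * (W\<^sup>\<dagger> *\<^sub>v x) $ j)"
    proof (rule eq_vecI)
      fix i assume "i < dim_vec (Q *\<^sub>v vec r (\<lambda>j. of_real (s j) * (W\<^sup>\<dagger> *\<^sub>v x) $ j))"
      then have i: "i < m" using Q by simp
      show "u $ i = (Q *\<^sub>v vec r (\<lambda>j. of_real (s j) * (W\<^sup>\<dagger> *\<^sub>v x) $ j)) $ i"
        unfolding x(2) FW[OF x(1) i] using Q i by (simp add: scalar_prod_def atLeast0LessThan)
    next
      show "dim_vec u = dim_vec (Q *\<^sub>v vec r (\<lambda>j. of_real (s j) * (W\<^sup>\<dagger> *\<^sub>v x) $ j))"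
        unfolding x(2) dim_mult_mat_vec using Q Fc by simp
    qed
    then show "u \<in> {Q *\<^sub>v x |x. x \<in> carrier_vec r}" 
      by (intro CollectI exI[of _ "vec r (\<lambda>j. of_real (s j) * (W\<^sup>\<dagger> *\<^sub>v x) $ j)"] conjI) simp_all
  next
    fix u assume "u \<in> {Q *\<^sub>v x |x. x \<in> carrier_vec r}"
    then obtain x where x: "x \<in> carrier_vec r" "u = Q *\<^sub>v x" by (elim CollectE exE conjE)
    define y where "y = vec n (\<lambda>j. if j < r then x $ j / of_real (s j) else 0)"
    have y: "y \<in> carrier_vec n" by (simp add: y_def)
    have z: "W *\<^sub>v y \<in> carrier_vec n" by (rule mult_mat_vec_carrier[OF Wc y])
    have WW: "W\<^sup>\<dagger> *\<^sub>v (W *\<^sub>v y) = y" using isometry_cancel(2)[OF Wc unitary_matD(2)[OF W], of y] y by simp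
    have "u = F *\<^sub>v (W *\<^sub>v y)"
    proof (rule eq_vecI)
      fix i assume "i < dim_vec (F *\<^sub>v (W *\<^sub>v y))"
      then have i: "i < m" using Fc by simp
      have "u $ i = (\<Sum>j<r. Q $$ (i, j) * x $ j)"
        unfolding x(2) using Q i x(1) by (simp add: scalar_prod_def atLeast0LessThan)
      also have "\<dots> = (\<Sum>j<r. Q $$ (i, j) * (of_real (s j) * y $ j))"
      proof (rule sum.cong[OF refl])
        fix j assume "j \<in> {..<r}"
        then have "j < r" "j < n" using r by simp_all
        then show "Q $$ (i, j) * x $ j = Q $$ (i, j) * (of_real (s j) * y $ j)"
          using s_nz[of j] by (simp add: y_def)
      qed
      finally show "u $ i = (F *\<^sub>v (W *\<^sub>v y)) $ i" unfolding FW[OF z i] WW .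
    next
      show "dim_vec u = dim_vec (F *\<^sub>v (W *\<^sub>v y))"
        unfolding x(2) dim_mult_mat_vec using Q Fc by simp
    qed
    with z show "u \<in> {F *\<^sub>v x |x. x \<in> carrier_vec n}" by (intro CollectI exI conjI)
  qed
  then have "vec_space.rank m F = vec_space.rank m Q"
    by (rule vec_space.rank_cong_range[OF Fc Q])
  then have rank: "mat_rank F = r" using rank_isometry[OF Q QQ] Fc by (simp add: mat_rank_def)
  show "mat_rank F = card {i. i < min m n \<and> s i \<noteq> 0}"
    unfolding rank r_def J_def ..
  show "{i. i < min m n \<and> s i \<noteq> 0} = {..<mat_rank F}"
    using J unfolding rank J_def .
qed

text \<open>The singular values after the rank vanish, so cutting the diagonal at the rank changes nothing.\<close>

lemma is_SVD_svd:
  assumes svd: "svd m n F V s W"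
  shows "\<exists>S. is_SVD F V S W"
proof -
  define r where "r = mat_rank F"
  have J: "{i. i < min m n \<and> s i \<noteq> 0} = {..<r}" using mat_rank_svd(2)[OF svd] by (simp add: r_def)
  have "{..<r} \<subseteq> {..<min m n}" unfolding J[symmetric] by auto
  from card_mono[OF _ this] have r: "r \<le> m" "r \<le> n" by simp_all
  have Fc: "dim_row F = m" "dim_col F = n"
    using carrier_matD[OF svdD(6)[OF svd]] by simp_all
  have s0: "s i = 0" if "i < min m n" "\<not> i < r" for i
  proof -
    have "i \<notin> {i. i < min m n \<and> s i \<noteq> 0}" unfolding J using that(2) by simp
    then show ?thesis using that(1) by simp
  qed
  have sv: "singular_values F $ i = s i" if "i < min m n" for i
    using that by (simp add: singular_values_svd[OF svd])
  have "top_left_block m n r (mat_diag r (\<lambda>i. complex_of_real (singular_values F $ i))) = rdiag m n s"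
  proof (rule eq_matI)
    fix i j assume "i < dim_row (rdiag m n s)" "j < dim_col (rdiag m n s)"
    then have ij: "i < m" "j < n" by simp_all
    show "top_left_block m n r (mat_diag r (\<lambda>i. complex_of_real (singular_values F $ i))) $$ (i, j) =
        rdiag m n s $$ (i, j)"
      using ij r s0[of i] sv[of i] unfolding top_left_block_def
      by (cases "i = j") (simp_all add: rdiag_index, simp_all add: mat_diag_def)
  qed (use r in \<open>simp_all add: top_left_block_def\<close>)
  then have "is_SVD F V (rdiag m n s) W"
    using svdD(1,2,5)[OF svd] unfolding is_SVD_def Fc r_def by simp
  then show ?thesis by blast
qed

section \<open>Partial isometries\<close>

definition leading_ones :: "nat \<Rightarrow> nat \<Rightarrow> real" where
  "leading_ones k i = (if i < k then 1 else 0)"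

lemma sq_norm_unitary_col:
  assumes "unitary_mat n U" "i < n"
  shows "sq_norm (col U i) = 1"
  using isometry_col_norm[OF unitary_matD(1,2)[OF assms(1)] assms(2)] unitary_matD(1)[OF assms(1)] assms(2)
  by (simp add: sq_norm_def)

lemma svd_mult_col:
  assumes svd: "svd m n F V s W" and i: "i < n"
  shows "F *\<^sub>v col W i = (if i < m then of_real (s i) \<cdot>\<^sub>v col V i else 0\<^sub>v m)"
proof -
  note Vc = unitary_matD(1)[OF svdD(1)[OF svd]] and Wc = unitary_matD(1)[OF svdD(2)[OF svd]]
  have "F *\<^sub>v col W i = col (F * W) i" by (rule col_mult2[OF svdD(6)[OF svd] Wc i, symmetric])
  also have "\<dots> = col (V * rdiag m n s) i" by (simp only: svd_mult_right(1)[OF svd])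
  also have "\<dots> = (if i < m then of_real (s i) \<cdot>\<^sub>v col V i else 0\<^sub>v m)"
  proof (rule eq_vecI)
    fix l assume "l < dim_vec (if i < m then complex_of_real (s i) \<cdot>\<^sub>v col V i else 0\<^sub>v m)"
    then have l: "l < m" using Vc by (simp split: if_splits)
    have "col (V * rdiag m n s) i $ l = (V * rdiag m n s) $$ (l, i)"
      using l i Vc by (simp del: index_mult_mat(1))
    also have "\<dots> = (if i < m then V $$ (l, i) * of_real (s i) else 0)"
      by (rule mult_rdiag_index[OF Vc l i])
    finally show "col (V * rdiag m n s) i $ l =
        (if i < m then complex_of_real (s i) \<cdot>\<^sub>v col V i else 0\<^sub>v m) $ l"
      using l Vc by simp
  qed (use Vc in simp)
  finally show ?thesis .
qed

text \<open>A right singular vector with nonzero singular value is orthogonal to the kernel, so a partial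
  isometry preserves its norm.\<close>

lemma partial_isometry_singular_values:
  assumes svd: "svd m n X V s W" and pi: "partial_isometry X" and i: "i < min m n" "s i \<noteq> 0"
  shows "s i = 1"
proof -
  note Xc = svdD(6)[OF svd]
  note Vc = unitary_matD(1)[OF svdD(1)[OF svd]] and Wc = unitary_matD(1)[OF svdD(2)[OF svd]]
  define f where "f = col W i"
  have f: "f \<in> carrier_vec n" using i Wc by (simp add: f_def col_def)
  have v: "col V i \<in> carrier_vec m" using i Vc by (simp add: col_def)
  have Xf: "X *\<^sub>v f = of_real (s i) \<cdot>\<^sub>v col V i"
    using svd_mult_col[OF svd, of i] i by (simp add: f_def)
  have Xv: "X\<^sup>\<dagger> *\<^sub>v col V i = of_real (s i) \<cdot>\<^sub>v f"
    using svd_mult_col[OF svd_adjoint[OF svd], of i] i by (simp add: f_def)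
  have "f \<bullet>c g = 0" if g: "g \<in> mat_kernel X" for g
  proof -
    have gc: "g \<in> carrier_vec n" and Xg: "X *\<^sub>v g = 0\<^sub>v m" using mat_kernelD[OF Xc g] by auto
    have "of_real (s i) * (f \<bullet>c g) = (X\<^sup>\<dagger> *\<^sub>v col V i) \<bullet>c g"
      unfolding Xv using f gc by simp
    also have "\<dots> = col V i \<bullet>c (X *\<^sub>v g)"
      using cscalar_adjoint[OF adjoint_carrier[OF Xc] v gc] by simp
    also have "\<dots> = 0" unfolding Xg using v by (simp add: scalar_prod_def)
    finally show ?thesis using i by simp
  qed
  then have "f \<in> orth_complement (dim_col X) (mat_kernel X)"
    using f Xc by (simp add: orth_complement_def)
  then have "eucl_norm (X *\<^sub>v f) = eucl_norm f" using pi by (simp add: partial_isometry_def)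
  then have "sq_norm (X *\<^sub>v f) = sq_norm f" by (simp add: eucl_norm_sq_norm)
  moreover have "sq_norm f = 1" using sq_norm_unitary_col[OF svdD(2)[OF svd]] i by (simp add: f_def)
  moreover have "sq_norm (X *\<^sub>v f) = (s i)\<^sup>2 * sq_norm (col V i)"
    unfolding Xf sq_norm_def by (simp add: norm_mult power_mult_distrib sum_distrib_left)
  moreover have "sq_norm (col V i) = 1" using sq_norm_unitary_col[OF svdD(1)[OF svd]] i by simp
  ultimately have "(s i)\<^sup>2 = 1" by simp
  then show ?thesis using svdD(3)[OF svd i(1)] by (simp add: power2_eq_1_iff)
qed

lemma svd_partial_isometry:
  assumes "X \<in> partial_isometries m n k"
  shows "\<exists>V W. svd m n X V (leading_ones k) W"
proof -
  have X: "X \<in> carrier_mat m n" "partial_isometry X" "mat_rank X = k"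
    using assms by (auto simp: partial_isometries_def)
  obtain V s W where svd: "svd m n X V s W" using svd_exists[OF X(1)] by blast
  have J: "{i. i < min m n \<and> s i \<noteq> 0} = {..<k}" using mat_rank_svd(2)[OF svd] X(3) by simp
  have s: "s i = leading_ones k i" if i: "i < min m n" for i
  proof (cases "i < k")
    case True
    then have "i \<in> {i. i < min m n \<and> s i \<noteq> 0}" unfolding J by simp
    then show ?thesis
      using partial_isometry_singular_values[OF svd X(2) i] True by (simp add: leading_ones_def)
  next
    case False
    then have "i \<notin> {i. i < min m n \<and> s i \<noteq> 0}" unfolding J by simp
    then show ?thesis using i False by (simp add: leading_ones_def)
  qed
  have "rdiag m n s = rdiag m n (leading_ones k)"
    using s by (intro eq_matI) (simp_all add: rdiag_index)
  then have "svd m n X V (leading_ones k) W"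
    using svd by (auto simp: svd_def leading_ones_def monotone_on_def)
  then show ?thesis by blast
qed

lemma svd_leading_ones:
  assumes V: "unitary_mat m V" and W: "unitary_mat n W"
  shows "svd m n (V * rdiag m n (leading_ones k) * W\<^sup>\<dagger>) V (leading_ones k) W"
  using assms by (auto simp: svd_def leading_ones_def monotone_on_def)

text \<open>A vector orthogonal to the kernel has no components along the right singular vectors after the
  first \<open>k\<close>, and on the first \<open>k\<close> the matrix acts isometrically.\<close>

lemma leading_ones_partial_isometry:
  assumes V: "unitary_mat m V" and W: "unitary_mat n W" and k: "k \<le> min m n"
  shows "V * rdiag m n (leading_ones k) * W\<^sup>\<dagger> \<in> partial_isometries m n k"
proof -
  define X where "X = V * rdiag m n (leading_ones k) * W\<^sup>\<dagger>"
  have svd: "svd m n X V (leading_ones k) W" unfolding X_def by (rule svd_leading_ones[OF V W])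
  note Xc = svdD(6)[OF svd] and Vc = unitary_matD(1)[OF V] and Wc = unitary_matD(1)[OF W]
  have "{i. i < min m n \<and> leading_ones k i \<noteq> 0} = {..<k}"
    using k by (auto simp: leading_ones_def)
  then have rank: "mat_rank X = k" using mat_rank_svd(1)[OF svd] by simp
  have "eucl_norm (X *\<^sub>v f) = eucl_norm f"
    if "f \<in> orth_complement (dim_col X) (mat_kernel X)" for f
  proof -
    have f: "f \<in> carrier_vec n" and orth: "\<And>g. g \<in> mat_kernel X \<Longrightarrow> f \<bullet>c g = 0"
      using that Xc by (auto simp: orth_complement_def)
    define y where "y = W\<^sup>\<dagger> *\<^sub>v f"
    have y: "y \<in> carrier_vec n" unfolding y_def by (rule mult_mat_vec_carrier[OF adjoint_carrier[OF Wc] f])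
    have y0: "y $ j = 0" if j: "j < n" "k \<le> j" for j
    proof -
      have w: "col W j \<in> carrier_vec n" using j Wc by (simp add: col_def)
      have "X *\<^sub>v col W j = 0\<^sub>v m"
        unfolding svd_mult_col[OF svd j(1)] using j Vc
        by (intro eq_vecI) (auto simp: leading_ones_def)
      then have "f \<bullet>c col W j = 0" using orth[OF mat_kernelI[OF Xc w]] by simp
      moreover have "y $ j = f \<bullet>c col W j"
        using j Wc f by (simp add: y_def scalar_prod_def atLeast0LessThan conjugate_complex_def mult.commute)
      ultimately show ?thesis by simp
    qed
    define z where "z = rdiag m n (leading_ones k) *\<^sub>v y"
    have z: "z \<in> carrier_vec m" unfolding z_def by (rule mult_mat_vec_carrier[OF rdiag_carrier y])
    have z_index: "z $ i = (if i < k then y $ i else 0)" if "i < m" for i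
    proof -
      have "z $ i = (\<Sum>j<n. rdiag m n (leading_ones k) $$ (i, j) * y $ j)"
        using that y by (simp add: z_def scalar_prod_def atLeast0LessThan)
      also have "\<dots> = (\<Sum>j<n. if j = i then (if i < k then y $ i else 0) else 0)"
        using that by (intro sum.cong) (auto simp: rdiag_index leading_ones_def)
      also have "\<dots> = (if i < k then y $ i else 0)" using k by auto
      finally show ?thesis .
    qed
    have "X *\<^sub>v f = V *\<^sub>v z"
      unfolding X_def z_def y_def using Vc Wc f by (simp add: mult_mat_vec_assoc_dim)
    then have "sq_norm (X *\<^sub>v f) = sq_norm z"
      using isometry_sq_norm[OF Vc unitary_matD(2)[OF V] z] by simp
    also have "\<dots> = (\<Sum>i<k. (cmod (y $ i))\<^sup>2)"
      unfolding sq_norm_def carrier_vecD[OF z] using k z_index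
      by (intro sum.mono_neutral_cong_right) auto
    also have "\<dots> = sq_norm y"
      unfolding sq_norm_def carrier_vecD[OF y] using k y0
      by (intro sum.mono_neutral_left) auto
    also have "\<dots> = sq_norm f"
      unfolding y_def using isometry_sq_norm[OF adjoint_carrier[OF Wc] _ f] unitary_matD(3)[OF W] by simp
    finally show ?thesis by (simp add: eucl_norm_sq_norm)
  qed
  then have "partial_isometry X" by (simp add: partial_isometry_def)
  then show ?thesis using rank Xc by (simp add: partial_isometries_def X_def[symmetric])
qed

section \<open>Sorting the diagonal\<close>

lemma unitary_permute_columns:
  assumes U: "unitary_mat n U" and p: "p permutes {..<n}" and e: "\<And>j. j < n \<Longrightarrow> \<bar>e j\<bar> = (1::real)"
  shows "unitary_mat n (mat n n (\<lambda>(i, j). U $$ (i, p j) * of_real (e j)))"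
proof (rule unitary_matI)
  define U' where "U' = mat n n (\<lambda>(i, j). U $$ (i, p j) * of_real (e j))"
  have c: "U' \<in> carrier_mat n n" by (simp add: U'_def)
  note Uc = unitary_matD(1)[OF U]
  have "U'\<^sup>\<dagger> * U' = 1\<^sub>m n"
    unfolding isometry_iff[OF c]
  proof (intro allI impI)
    fix i j assume ij: "i < n" "j < n"
    have pij: "p i < n" "p j < n" using ij permutes_in_image[OF p] by auto
    have "(\<Sum>l<n. cnj (U' $$ (l, i)) * U' $$ (l, j)) =
        (\<Sum>l<n. (of_real (e i) * of_real (e j)) * (cnj (U $$ (l, p i)) * U $$ (l, p j)))"
      using ij by (intro sum.cong) (auto simp: U'_def)
    also have "\<dots> = (of_real (e i) * of_real (e j)) * (\<Sum>l<n. cnj (U $$ (l, p i)) * U $$ (l, p j))"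
      by (simp only: sum_distrib_left)
    also have "(\<Sum>l<n. cnj (U $$ (l, p i)) * U $$ (l, p j)) = (if p i = p j then 1 else 0)"
      using isometry_iff[OF Uc] unitary_matD(2)[OF U] pij by blast
    also have "p i = p j \<longleftrightarrow> i = j" using permutes_inj[OF p] by (simp add: inj_eq)
    also have "(of_real (e i) * of_real (e j)) * (if i = j then 1 else 0) = (if i = j then 1 else (0::complex))"
    proof (cases "i = j")
      case True
      have "e i * e i = 1" using e[OF ij(1)] by (metis abs_mult_self_eq mult_1)
      then show ?thesis using True by (simp add: of_real_mult[symmetric] del: of_real_mult)
    qed simp
    finally show "(\<Sum>l<n. cnj (U' $$ (l, i)) * U' $$ (l, j)) = (if i = j then 1 else 0)" .
  qed
  then show "(mat n n (\<lambda>(i, j). U $$ (i, p j) * of_real (e j)))\<^sup>\<dagger> * mat n n (\<lambda>(i, j). U $$ (i, p j) * of_real (e j)) = 1\<^sub>m n"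
    by (simp only: U'_def)
qed simp

lemma sorting_permutation:
  fixes f :: "nat \<Rightarrow> real"
  shows "\<exists>p. p permutes {..<q} \<and> antimono_on {..<q} (\<lambda>i. f (p i))"
proof -
  define xs where "xs = sort_key (\<lambda>i. - f i) [0..<q]"
  have xs: "distinct xs" "set xs = {..<q}" "length xs = q" by (auto simp: xs_def)
  define p where "p i = (if i < q then xs ! i else i)" for i
  have "bij_betw ((!) xs) {..<q} {..<q}" by (rule bij_betw_nth[OF xs(1)]) (simp_all add: xs)
  then have "bij_betw p {..<q} {..<q}" by (rule bij_betw_cong[THEN iffD1, rotated]) (simp add: p_def)
  then have "p permutes {..<q}" by (rule bij_imp_permutes) (simp add: p_def)
  moreover have "antimono_on {..<q} (\<lambda>i. f (p i))"
  proof (rule monotone_onI)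
    fix i j assume ij: "i \<in> {..<q}" "j \<in> {..<q}" "i \<le> j"
    have "sorted (map (\<lambda>i. - f i) xs)" unfolding xs_def by (rule sorted_sort_key)
    then have "map (\<lambda>i. - f i) xs ! i \<le> map (\<lambda>i. - f i) xs ! j"
      using ij xs(3) by (intro sorted_nth_mono) simp_all
    then show "f (p i) \<ge> f (p j)" using ij xs(3) by (simp add: p_def)
  qed
  ultimately show ?thesis by blast
qed

text \<open>A diagonal with arbitrary real entries: the signs are absorbed by the left factor, the sorting
  permutation by both.\<close>

lemma svd_of_real_diagonal:
  assumes V: "unitary_mat m V" and W: "unitary_mat n W"
  shows "\<exists>p V' W'. p permutes {..<min m n} \<and>
    svd m n (V * rdiag m n d * W\<^sup>\<dagger>) V' (\<lambda>i. \<bar>d (p i)\<bar>) W'"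
proof -
  obtain p where p: "p permutes {..<min m n}" and anti: "antimono_on {..<min m n} (\<lambda>i. \<bar>d (p i)\<bar>)"
    using sorting_permutation[of "min m n" "\<lambda>i. \<bar>d i\<bar>"] by blast
  have pm: "p permutes {..<m}" and pn: "p permutes {..<n}"
    using permutes_subset[OF p] by auto
  note Vc = unitary_matD(1)[OF V] and Wc = unitary_matD(1)[OF W]
  define e where "e j = (if d (p j) < 0 then - 1 else (1::real))" for j
  define V' where "V' = mat m m (\<lambda>(i, j). V $$ (i, p j) * of_real (e j))"
  define W' where "W' = mat n n (\<lambda>(i, j). W $$ (i, p j) * of_real (1::real))"
  have V': "unitary_mat m V'" unfolding V'_def
    by (rule unitary_permute_columns[OF V pm]) (simp add: e_def)
  have W': "unitary_mat n W'" unfolding W'_def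
    by (rule unitary_permute_columns[OF W pn]) simp
  note V'c = unitary_matD(1)[OF V'] and W'c = unitary_matD(1)[OF W']
  have "V * rdiag m n d * W\<^sup>\<dagger> = V' * rdiag m n (\<lambda>i. \<bar>d (p i)\<bar>) * W'\<^sup>\<dagger>"
  proof (rule eq_matI)
    fix i l assume "i < dim_row (V' * rdiag m n (\<lambda>i. \<bar>d (p i)\<bar>) * W'\<^sup>\<dagger>)"
      "l < dim_col (V' * rdiag m n (\<lambda>i. \<bar>d (p i)\<bar>) * W'\<^sup>\<dagger>)"
    then have il: "i < m" "l < n" using V'c W'c by simp_all
    have "(V' * rdiag m n (\<lambda>i. \<bar>d (p i)\<bar>) * W'\<^sup>\<dagger>) $$ (i, l) =
        (\<Sum>j<min m n. V' $$ (i, j) * of_real \<bar>d (p j)\<bar> * cnj (W' $$ (l, j)))"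
      by (rule rdiag_sandwich_index[OF V'c W'c il])
    also have "\<dots> = (\<Sum>j<min m n. V $$ (i, p j) * of_real (d (p j)) * cnj (W $$ (l, p j)))"
      using il by (intro sum.cong) (auto simp: V'_def W'_def e_def)
    also have "\<dots> = (\<Sum>j<min m n. V $$ (i, j) * of_real (d j) * cnj (W $$ (l, j)))"
      by (rule sum.permute[OF p, symmetric, unfolded comp_def])
    also have "\<dots> = (V * rdiag m n d * W\<^sup>\<dagger>) $$ (i, l)"
      by (rule rdiag_sandwich_index[OF Vc Wc il, symmetric])
    finally show "(V * rdiag m n d * W\<^sup>\<dagger>) $$ (i, l) =
        (V' * rdiag m n (\<lambda>i. \<bar>d (p i)\<bar>) * W'\<^sup>\<dagger>) $$ (i, l)" ..
  qed (use Vc Wc V'c W'c in simp_all)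
  then have "svd m n (V * rdiag m n d * W\<^sup>\<dagger>) V' (\<lambda>i. \<bar>d (p i)\<bar>) W'"
    using V' W' anti unfolding svd_def by simp
  then show ?thesis using p by blast
qed

section \<open>Strictly convex symmetric gauges and weak majorization\<close>

lemma gauge_permute_abs:
  assumes "symmetric_gauge q \<Phi>" "p permutes {..<q}"
  shows "\<Phi> (vec q f) = \<Phi> (vec q (\<lambda>i. \<bar>f (p i)\<bar>))"
proof -
  have "\<Phi> (vec q f) = \<Phi> (vec q (\<lambda>i. \<bar>vec q f $ p i\<bar>))"
    using assms unfolding symmetric_gauge_def by (metis vec_carrier)
  also have "vec q (\<lambda>i. \<bar>vec q f $ p i\<bar>) = vec q (\<lambda>i. \<bar>f (p i)\<bar>)"
  proof (rule eq_vecI)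
    fix i assume "i < dim_vec (vec q (\<lambda>i. \<bar>f (p i)\<bar>))"
    then have "i < q" by simp
    then have "p i < q" using permutes_in_image[OF assms(2), of i] by simp
    then show "vec q (\<lambda>i. \<bar>vec q f $ p i\<bar>) $ i = vec q (\<lambda>i. \<bar>f (p i)\<bar>) $ i" using \<open>i < q\<close> by simp
  qed simp
  finally show ?thesis .
qed

lemma gauge_abs:
  assumes "symmetric_gauge q \<Phi>"
  shows "\<Phi> (vec q f) = \<Phi> (vec q (\<lambda>i. \<bar>f i\<bar>))"
  using gauge_permute_abs[OF assms permutes_id, of f] by simp

lemma gauge_strict_convexity:
  assumes g: "symmetric_gauge q \<Phi>" "strictly_convex_gauge q \<Phi>"
    and eq: "\<Phi> (vec q f) = \<Phi> (vec q h)" and i: "i < q" "f i \<noteq> h i" and t: "0 < t" "t < 1"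
  shows "\<Phi> (vec q (\<lambda>i. t * f i + (1 - t) * h i)) < \<Phi> (vec q f)"
proof -
  define c where "c = \<Phi> (vec q f)"
  have nrm: "norm_on_Rq q \<Phi>" using g(1) by (simp add: symmetric_gauge_def)
  have scale: "\<Phi> (a \<cdot>\<^sub>v vec q u) = \<bar>a\<bar> * \<Phi> (vec q u)" for a u
    using nrm by (simp add: norm_on_Rq_def)
  have nonneg: "0 \<le> \<Phi> (vec q u)" and zero: "\<Phi> (vec q u) = 0 \<longleftrightarrow> vec q u = 0\<^sub>v q" for u
    using nrm by (simp_all add: norm_on_Rq_def)
  have neq: "vec q f \<noteq> vec q h" using i by (metis index_vec)
  have "c \<noteq> 0" using neq eq zero unfolding c_def by metis
  then have c: "0 < c" using nonneg[of f] by (simp add: c_def)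
  define x y where "x = (1 / c) \<cdot>\<^sub>v vec q f" and "y = (1 / c) \<cdot>\<^sub>v vec q h"
  have xy: "x \<in> carrier_vec q" "y \<in> carrier_vec q" by (simp_all add: x_def y_def)
  have one: "\<Phi> x = 1" "\<Phi> y = 1" using c eq by (simp_all add: x_def y_def scale c_def)
  have "x $ i \<noteq> y $ i" using i c by (simp add: x_def y_def)
  then have "x \<noteq> y" by blast
  then have lt: "\<Phi> (t \<cdot>\<^sub>v x + (1 - t) \<cdot>\<^sub>v y) < 1"
    using g(2) xy one t unfolding strictly_convex_gauge_def by blast
  have "t \<cdot>\<^sub>v x + (1 - t) \<cdot>\<^sub>v y = (1 / c) \<cdot>\<^sub>v vec q (\<lambda>i. t * f i + (1 - t) * h i)"
    by (rule eq_vecI) (simp_all add: x_def y_def add_divide_distrib)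
  then have "\<Phi> (vec q (\<lambda>i. t * f i + (1 - t) * h i)) / c < 1"
    using lt c by (simp add: scale)
  then show ?thesis using c by (simp add: c_def)
qed

text \<open>A vector \<open>y \<ge> 0\<close> that weakly majorizes a decreasing \<open>d \<ge> 0\<close> is turned into \<open>d\<close> by finitely many
  moves, each of which makes one more coordinate agree and replaces \<open>y\<close> by a proper convex
  combination of \<open>y\<close> and a signed permutation of \<open>y\<close>: a transfer of mass between two
  coordinates, or the shrinking of one. Strict convexity makes every move decrease the gauge.\<close>

lemma gauge_majorization:
  assumes g: "symmetric_gauge q \<Phi>" "strictly_convex_gauge q \<Phi>"
    and d: "antimono_on {..<q} d" "\<And>i. i < q \<Longrightarrow> 0 \<le> d i"
  shows "(\<And>i. i < q \<Longrightarrow> 0 \<le> y i) \<Longrightarrow> (\<And>p. p \<le> q \<Longrightarrow> (\<Sum>i<p. d i) \<le> (\<Sum>i<p. y i)) \<Longrightarrow>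
    (\<forall>i<q. d i = y i) \<or> \<Phi> (vec q d) < \<Phi> (vec q y)"
proof (induction "card {i. i < q \<and> d i \<noteq> y i}" arbitrary: y rule: less_induct)
  case less
  note y0 = less.prems(1) and maj = less.prems(2)
  have step: ?case
    if lt: "\<Phi> (vec q y') < \<Phi> (vec q y)" and y'0: "\<And>i. i < q \<Longrightarrow> 0 \<le> y' i"
      and maj': "\<And>p. p \<le> q \<Longrightarrow> (\<Sum>i<p. d i) \<le> (\<Sum>i<p. y' i)"
      and sub: "{i. i < q \<and> d i \<noteq> y' i} \<subset> {i. i < q \<and> d i \<noteq> y i}" for y'
  proof -
    have "card {i. i < q \<and> d i \<noteq> y' i} < card {i. i < q \<and> d i \<noteq> y i}"
      by (rule psubset_card_mono[OF _ sub]) simp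
    from less.hyps[OF this y'0 maj']
    consider "\<forall>i<q. d i = y' i" | "\<Phi> (vec q d) < \<Phi> (vec q y')" by blast
    then have "\<Phi> (vec q d) \<le> \<Phi> (vec q y')"
    proof cases
      case 1
      then have "vec q d = vec q y'" by (intro eq_vecI) simp_all
      then show ?thesis by simp
    qed simp
    then show ?thesis using lt by simp
  qed
  consider (eq) "\<forall>i<q. d i = y i" | (transfer) j where "j < q" "y j < d j"
    | (shrink) "\<forall>i<q. d i \<le> y i" "\<exists>j<q. d j < y j"
    by (metis linorder_not_le order_le_less)
  then show ?case
  proof cases
    case transfer
    define j0 where "j0 = (LEAST j. j < q \<and> y j < d j)"
    have j0: "j0 < q" "y j0 < d j0" using LeastI[of "\<lambda>j. j < q \<and> y j < d j" j] transfer
      by (auto simp: j0_def)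
    have before: "d l \<le> y l" if "l < j0" for l
      using not_less_Least[of l "\<lambda>j. j < q \<and> y j < d j"] that j0(1) by (auto simp: j0_def not_less)
    have "\<exists>i<j0. d i < y i"
    proof (rule ccontr)
      assume "\<not> (\<exists>i<j0. d i < y i)"
      then have "(\<Sum>i<j0. y i) \<le> (\<Sum>i<j0. d i)"
        by (intro sum_mono) (metis lessThan_iff not_less)
      then have "(\<Sum>i<Suc j0. y i) < (\<Sum>i<Suc j0. d i)" using j0(2) by simp
      then show False using maj[of "Suc j0"] j0(1) by simp
    qed
    then obtain i where i: "i < j0" "d i < y i" by blast
    then have iq: "i < q" using j0 by simp
    \<comment> \<open>The largest transfer from \<open>i\<close> to \<open>j0\<close> that overshoots neither \<open>d i\<close> nor \<open>d j0\<close>; it is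
      less than the gap \<open>y i - y j0\<close> because \<open>d\<close> is decreasing.\<close>
    define \<delta> where "\<delta> = min (y i - d i) (d j0 - y j0)"
    have dl: "0 < \<delta>" "\<delta> \<le> y i - d i" "\<delta> \<le> d j0 - y j0" using i j0 by (auto simp: \<delta>_def)
    have "d j0 \<le> d i" using monotone_onD[OF d(1), of i j0] i j0 by simp
    then have gap: "\<delta> < y i - y j0" using dl by simp
    define \<tau> where "\<tau> l = (if l = i then j0 else if l = j0 then i else l)" for l
    have tau: "\<tau> permutes {..<q}"
    proof (rule bij_imp_permutes)
      have "\<tau> (\<tau> l) = l" for l by (simp add: \<tau>_def)
      moreover have "\<tau> l < q" if "l < q" for l using that iq j0 by (simp add: \<tau>_def)
      ultimately show "bij_betw \<tau> {..<q} {..<q}"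
        by (intro bij_betw_byWitness[where f' = \<tau>]) auto
    qed (use iq j0 in \<open>auto simp: \<tau>_def\<close>)
    define t where "t = 1 - \<delta> / (y i - y j0)"
    have t: "0 < t" "t < 1" using dl gap by (simp_all add: t_def)
    define y' where "y' = y(i := y i - \<delta>, j0 := y j0 + \<delta>)"
    have swap: "\<Phi> (vec q y) = \<Phi> (vec q (\<lambda>l. y (\<tau> l)))"
    proof -
      have "vec q (\<lambda>l. \<bar>y (\<tau> l)\<bar>) = vec q (\<lambda>l. y (\<tau> l))"
        using y0 permutes_in_image[OF tau] by (intro eq_vecI) auto
      then show ?thesis using gauge_permute_abs[OF g(1) tau, of y] by simp
    qed
    have "\<Phi> (vec q (\<lambda>l. t * y l + (1 - t) * y (\<tau> l))) < \<Phi> (vec q y)"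
      by (rule gauge_strict_convexity[OF g swap iq _ t]) (use gap dl in \<open>simp add: \<tau>_def\<close>)
    moreover have "vec q (\<lambda>l. t * y l + (1 - t) * y (\<tau> l)) = vec q y'"
    proof (rule eq_vecI)
      fix l assume "l < dim_vec (vec q y')"
      have u: "(1 - t) * (y i - y j0) = \<delta>" using gap dl by (simp add: t_def)
      have "t * y i + (1 - t) * y j0 = y i - \<delta>" using u by (simp add: algebra_simps)
      moreover have "t * y j0 + (1 - t) * y i = y j0 + \<delta>" using u by (simp add: algebra_simps)
      moreover have "t * y l + (1 - t) * y l = y l" by (simp add: algebra_simps)
      ultimately show "vec q (\<lambda>l. t * y l + (1 - t) * y (\<tau> l)) $ l = vec q y' $ l"
        using \<open>l < dim_vec (vec q y')\<close> i(1) by (auto simp: y'_def \<tau>_def)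
    qed simp
    ultimately have lt: "\<Phi> (vec q y') < \<Phi> (vec q y)" by simp
    show ?thesis
    proof (rule step[OF lt])
      show "0 \<le> y' l" if "l < q" for l
        using y0[OF that] d(2)[OF iq] dl that y0[OF j0(1)] by (auto simp: y'_def)
      show "(\<Sum>l<p. d l) \<le> (\<Sum>l<p. y' l)" if p: "p \<le> q" for p
      proof -
        have y'_sum: "(\<Sum>l<p. y' l) = (\<Sum>l<p. y l) + (if i < p then - \<delta> else 0) + (if j0 < p then \<delta> else 0)"
        proof -
          have "y' l = y l + (if l = i then - \<delta> else 0) + (if l = j0 then \<delta> else 0)" for l
            using i(1) by (simp add: y'_def)
          then show ?thesis by (simp add: sum.distrib)
        qed
        show ?thesis
        proof (cases "i < p \<and> p \<le> j0")
          case True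
          have "\<delta> \<le> y i - d i" by (rule dl(2))
          also have "\<dots> \<le> (\<Sum>l<p. y l - d l)"
            using True before by (intro member_le_sum) auto
          finally show ?thesis using True y'_sum by (simp add: sum_subtractf)
        next
          case False
          then have "(\<Sum>l<p. y' l) = (\<Sum>l<p. y l)" using y'_sum i(1) by auto
          then show ?thesis using maj[OF p] by simp
        qed
      qed
      have "d i = y' i \<or> d j0 = y' j0" using i(1) by (auto simp: y'_def \<delta>_def min_def)
      moreover have "d i \<noteq> y i" "d j0 \<noteq> y j0" using i j0 by auto
      moreover have "y' l = y l" if "l \<noteq> i" "l \<noteq> j0" for l using that by (simp add: y'_def)
      ultimately show "{i. i < q \<and> d i \<noteq> y' i} \<subset> {i. i < q \<and> d i \<noteq> y i}"
        using iq j0(1) by (auto simp: psubset_eq set_eq_iff) metis+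
    qed
  next
    case shrink
    then obtain j where j: "j < q" "d j < y j" by blast
    have pos: "0 < y j" using j d(2)[OF j(1)] by simp
    \<comment> \<open>The weight for which \<open>d j\<close> is the combination of \<open>y j\<close> and \<open>- y j\<close>.\<close>
    define t where "t = (1 + d j / y j) / 2"
    have t: "0 < t" "t < 1" using j pos d(2)[OF j(1)] by (simp_all add: t_def add_pos_nonneg)
    define y' where "y' = y(j := d j)"
    have flip: "\<Phi> (vec q y) = \<Phi> (vec q (y(j := - y j)))"
    proof -
      have "(\<lambda>l. \<bar>(y(j := - y j)) l\<bar>) = (\<lambda>l. \<bar>y l\<bar>)" by auto
      then show ?thesis
        using gauge_abs[OF g(1), of y] gauge_abs[OF g(1), of "y(j := - y j)"] by simp
    qed
    have "\<Phi> (vec q (\<lambda>l. t * y l + (1 - t) * (y(j := - y j)) l)) < \<Phi> (vec q y)"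
      by (rule gauge_strict_convexity[OF g flip j(1) _ t]) (use pos in simp)
    moreover have "vec q (\<lambda>l. t * y l + (1 - t) * (y(j := - y j)) l) = vec q y'"
    proof (rule eq_vecI)
      fix l assume "l < dim_vec (vec q y')"
      have "t * y j + (1 - t) * (- y j) = d j" using pos by (simp add: t_def field_simps)
      moreover have "t * y l + (1 - t) * y l = y l" by (simp add: algebra_simps)
      ultimately show "vec q (\<lambda>l. t * y l + (1 - t) * (y(j := - y j)) l) $ l = vec q y' $ l"
        using \<open>l < dim_vec (vec q y')\<close> by (auto simp: y'_def)
    qed simp
    ultimately have lt: "\<Phi> (vec q y') < \<Phi> (vec q y)" by simp
    have le: "d l \<le> y' l" if "l < q" for l using shrink(1) that by (simp add: y'_def)
    show ?thesis
    proof (rule step[OF lt])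
      show "0 \<le> y' l" if "l < q" for l using d(2)[OF that] le[OF that] by simp
      show "(\<Sum>l<p. d l) \<le> (\<Sum>l<p. y' l)" if "p \<le> q" for p
        using le that by (intro sum_mono) simp
      show "{i. i < q \<and> d i \<noteq> y' i} \<subset> {i. i < q \<and> d i \<noteq> y i}"
        using j by (auto simp: psubset_eq set_eq_iff y'_def)
    qed
  qed simp
qed

section \<open>Singular values of a difference\<close>

text \<open>The Hermitian dilation turns singular values of \<open>F\<close> into eigenvalues: if \<open>F w = s v\<close> and
  \<open>F\<^sup>\<dagger> v = s w\<close>, then \<open>(v, \<plusminus>w)\<close> is an eigenvector for \<open>\<plusminus>s\<close>.\<close>

definition dilation :: "nat \<Rightarrow> nat \<Rightarrow> complex mat \<Rightarrow> complex mat" where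
  "dilation m n F = four_block_mat (0\<^sub>m m m) F (F\<^sup>\<dagger>) (0\<^sub>m n n)"

text \<open>The decreasing list \<open>s\<^sub>0, \<dots>, s\<^sub>q\<^sub>-\<^sub>1, 0, \<dots>, 0, -s\<^sub>q\<^sub>-\<^sub>1, \<dots>, -s\<^sub>0\<close> of length \<open>m + n\<close>, where
  \<open>q = min m n\<close>: the eigenvalue \<open>-s\<^sub>i\<close> sits at the mirror image of the position of \<open>s\<^sub>i\<close>.\<close>

definition dilation_values :: "nat \<Rightarrow> nat \<Rightarrow> (nat \<Rightarrow> real) \<Rightarrow> nat \<Rightarrow> real" where
  "dilation_values m n s j =
    (if j < min m n then s j else if j < max m n then 0 else - s (m + n - 1 - j))"

lemma sum_lessThan_add: "(\<Sum>l<m + n. f l) = (\<Sum>l<m. f l) + (\<Sum>l<n. f (m + l :: nat) :: 'a :: comm_monoid_add)"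
  by (induction n) (simp_all add: add.assoc)

lemma dilation_spectral_dec:
  assumes svd: "svd m n F V s W"
  shows "\<exists>T. spectral_dec (m + n) (dilation m n F) T (dilation_values m n s)"
proof -
  note Fc = svdD(6)[OF svd] and V = svdD(1)[OF svd] and W = svdD(2)[OF svd]
  note Vc = unitary_matD(1)[OF V] and Wc = unitary_matD(1)[OF W]
  define N where "N = m + n"
  define c where "c = 1 / sqrt (2::real)"
  have cc: "c * c = 1 / 2" by (simp add: c_def)
  \<comment> \<open>The \<open>j\<close>-th eigenvector is \<open>(a j * v, b j * w)\<close> with \<open>v, w\<close> the singular vectors of index \<open>p j\<close>. In
    the middle range only one of the two exists, and the coefficient of the other is zero.\<close>
  define p where "p j = (if j < max m n then j else N - 1 - j)" for j
  define a where "a j = (if j < min m n then c else if j < max m n then (if j < m then 1 else 0) else c)" for j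
  define b where "b j = (if j < min m n then c else if j < max m n then (if j < n then 1 else 0) else - c)" for j
  define T where "T = mat N N (\<lambda>(r, j).
    if r < m then of_real (a j) * V $$ (r, p j) else of_real (b j) * W $$ (r - m, p j))"
  have T: "T \<in> carrier_mat N N" by (simp add: T_def)
  have a0: "a j = 0" if "j < N" "m \<le> p j" for j
    using that by (auto simp: a_def p_def N_def split: if_splits)
  have b0: "b j = 0" if "j < N" "n \<le> p j" for j
    using that by (auto simp: b_def p_def N_def split: if_splits)
  have "T\<^sup>\<dagger> * T = 1\<^sub>m N"
    unfolding isometry_iff[OF T]
  proof (intro allI impI)
    fix i j assume ij: "i < N" "j < N"
    have "(\<Sum>l<N. cnj (T $$ (l, i)) * T $$ (l, j)) =
        (\<Sum>l<m. of_real (a i * a j) * (cnj (V $$ (l, p i)) * V $$ (l, p j))) +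
        (\<Sum>l<n. of_real (b i * b j) * (cnj (W $$ (l, p i)) * W $$ (l, p j)))"
      unfolding N_def sum_lessThan_add using ij
      by (intro arg_cong2[of _ _ _ _ "(+)"] sum.cong) (simp_all add: T_def N_def mult_ac)
    also have "\<dots> = of_real (a i * a j) * (\<Sum>l<m. cnj (V $$ (l, p i)) * V $$ (l, p j)) +
        of_real (b i * b j) * (\<Sum>l<n. cnj (W $$ (l, p i)) * W $$ (l, p j))"
      by (simp only: sum_distrib_left)
    also have "of_real (a i * a j) * (\<Sum>l<m. cnj (V $$ (l, p i)) * V $$ (l, p j)) =
        of_real (a i * a j) * (if p i = p j then 1 else 0)"
    proof (cases "p i < m \<and> p j < m")
      case True
      then have "(\<Sum>l<m. cnj (V $$ (l, p i)) * V $$ (l, p j)) = (if p i = p j then 1 else 0)"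
        using isometry_iff[OF Vc] unitary_matD(2)[OF V] by blast
      then show ?thesis by (simp only:)
    next
      case False
      then have "a i * a j = 0" using a0[OF ij(1)] a0[OF ij(2)] by (auto simp: not_less)
      then show ?thesis by (simp only:) simp
    qed
    also have "of_real (b i * b j) * (\<Sum>l<n. cnj (W $$ (l, p i)) * W $$ (l, p j)) =
        of_real (b i * b j) * (if p i = p j then 1 else 0)"
    proof (cases "p i < n \<and> p j < n")
      case True
      then have "(\<Sum>l<n. cnj (W $$ (l, p i)) * W $$ (l, p j)) = (if p i = p j then 1 else 0)"
        using isometry_iff[OF Wc] unitary_matD(2)[OF W] by blast
      then show ?thesis by (simp only:)
    next
      case False
      then have "b i * b j = 0" using b0[OF ij(1)] b0[OF ij(2)] by (auto simp: not_less)
      then show ?thesis by (simp only:) simp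
    qed
    also have "of_real (a i * a j) * (if p i = p j then 1 else 0) +
        of_real (b i * b j) * (if p i = p j then 1 else 0) =
        complex_of_real (if p i = p j then a i * a j + b i * b j else 0)"
      by simp
    also have "(if p i = p j then a i * a j + b i * b j else 0) = (if i = j then 1 else 0)"
      using ij cc by (auto simp: a_def b_def p_def N_def split: if_splits)
    finally show "(\<Sum>l<N. cnj (T $$ (l, i)) * T $$ (l, j)) = (if i = j then 1 else 0)" by simp
  qed
  then have uT: "unitary_mat N T" using T by (rule unitary_matI[rotated])
  define H where "H = dilation m n F"
  have H: "H \<in> carrier_mat N N" using Fc by (simp add: H_def dilation_def N_def)
  define D where "D = mat_diag N (\<lambda>i. complex_of_real (dilation_values m n s i))"
  have D: "D \<in> carrier_mat N N" by (simp add: D_def)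
  have FW: "(\<Sum>l<n. F $$ (r, l) * W $$ (l, j)) = (if j < m then V $$ (r, j) * of_real (s j) else 0)"
    if "r < m" "j < n" for r j
  proof -
    have "(\<Sum>l<n. F $$ (r, l) * W $$ (l, j)) = (F * W) $$ (r, j)"
      by (rule index_mult_sum[OF Fc Wc that, symmetric])
    also have "\<dots> = (V * rdiag m n s) $$ (r, j)" by (simp only: svd_mult_right(1)[OF svd])
    finally show ?thesis using mult_rdiag_index[OF Vc that] by simp
  qed
  have FV: "(\<Sum>l<m. cnj (F $$ (l, r)) * V $$ (l, j)) = (if j < n then W $$ (r, j) * of_real (s j) else 0)"
    if "r < n" "j < m" for r j
  proof -
    have "(\<Sum>l<m. cnj (F $$ (l, r)) * V $$ (l, j)) = (\<Sum>l<m. F\<^sup>\<dagger> $$ (r, l) * V $$ (l, j))"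
      using Fc that by (intro sum.cong) simp_all
    also have "\<dots> = (F\<^sup>\<dagger> * V) $$ (r, j)"
      by (rule index_mult_sum[OF adjoint_carrier[OF Fc] Vc that, symmetric])
    also have "\<dots> = (W * rdiag n m s) $$ (r, j)" by (simp only: svd_mult_right(2)[OF svd])
    finally show ?thesis using mult_rdiag_index[OF Wc that] by simp
  qed
  have "H * T = T * D"
  proof (rule eq_matI)
    fix r j assume "r < dim_row (T * D)" "j < dim_col (T * D)"
    then have rj: "r < N" "j < N" using T D by simp_all
    have TD: "(T * D) $$ (r, j) = T $$ (r, j) * of_real (dilation_values m n s j)"
      unfolding D_def mat_diag_mult_right[OF T] using rj by simp
    have HT: "(H * T) $$ (r, j) = (\<Sum>l<m. H $$ (r, l) * T $$ (l, j)) + (\<Sum>l<n. H $$ (r, m + l) * T $$ (m + l, j))"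
      unfolding index_mult_sum[OF H T rj] unfolding N_def sum_lessThan_add ..
    show "(H * T) $$ (r, j) = (T * D) $$ (r, j)"
    proof (cases "r < m")
      case True
      have "(\<Sum>l<m. H $$ (r, l) * T $$ (l, j)) = 0"
        using True Fc by (intro sum.neutral) (simp add: H_def dilation_def)
      moreover have "(\<Sum>l<n. H $$ (r, m + l) * T $$ (m + l, j)) = (\<Sum>l<n. of_real (b j) * (F $$ (r, l) * W $$ (l, p j)))"
        using True Fc rj by (intro sum.cong) (simp_all add: H_def dilation_def T_def N_def)
      moreover have "(\<Sum>l<n. of_real (b j) * (F $$ (r, l) * W $$ (l, p j))) =
          of_real (b j) * (if p j < m then V $$ (r, p j) * of_real (s (p j)) else 0)"
      proof (cases "p j < n")
        case True
        show ?thesis unfolding sum_distrib_left[symmetric] FW[OF \<open>r < m\<close> True] ..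
      qed (use b0[OF rj(2)] in simp)
      moreover have "of_real (b j) * (if p j < m then V $$ (r, p j) * of_real (s (p j)) else 0) =
          T $$ (r, j) * of_real (dilation_values m n s j)"
        using True rj by (auto simp: T_def a_def b_def p_def dilation_values_def N_def)
      ultimately show ?thesis unfolding HT TD by simp
    next
      case False
      have rn: "r - m < n" using False rj by (simp add: N_def)
      have "(\<Sum>l<n. H $$ (r, m + l) * T $$ (m + l, j)) = 0"
        using False Fc rj by (intro sum.neutral) (simp add: H_def dilation_def N_def)
      moreover have "(\<Sum>l<m. H $$ (r, l) * T $$ (l, j)) = (\<Sum>l<m. of_real (a j) * (cnj (F $$ (l, r - m)) * V $$ (l, p j)))"
        using False Fc rj rn by (intro sum.cong) (simp_all add: H_def dilation_def T_def N_def)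
      moreover have "(\<Sum>l<m. of_real (a j) * (cnj (F $$ (l, r - m)) * V $$ (l, p j))) =
          of_real (a j) * (if p j < n then W $$ (r - m, p j) * of_real (s (p j)) else 0)"
      proof (cases "p j < m")
        case True
        show ?thesis unfolding sum_distrib_left[symmetric] FV[OF rn True] ..
      qed (use a0[OF rj(2)] in simp)
      moreover have "of_real (a j) * (if p j < n then W $$ (r - m, p j) * of_real (s (p j)) else 0) =
          T $$ (r, j) * of_real (dilation_values m n s j)"
        using False rj by (auto simp: T_def a_def b_def p_def dilation_values_def N_def)
      ultimately show ?thesis unfolding HT TD by simp
    qed
  qed (use H T D in simp_all)
  then have "H * T * T\<^sup>\<dagger> = T * D * T\<^sup>\<dagger>" by (rule arg_cong)
  moreover have "H * T * T\<^sup>\<dagger> = H"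
    using H T unitary_matD(3)[OF uT] by (simp add: mult_assoc_dim)
  ultimately have HD: "H = T * D * T\<^sup>\<dagger>" by simp
  have "antimono_on {..<N} (dilation_values m n s)"
  proof (rule monotone_onI)
    fix i j assume ij: "i \<in> {..<N}" "j \<in> {..<N}" "i \<le> j"
    have small: "N - 1 - l < min m n" if "\<not> l < max m n" "l < N" for l
      using that by (auto simp: N_def)
    show "dilation_values m n s j \<le> dilation_values m n s i"
    proof (cases "j < min m n")
      case True
      then show ?thesis using ij svdD(4)[OF svd, of i j] by (simp add: dilation_values_def)
    next
      case j: False
      show ?thesis
      proof (cases "j < max m n")
        case True
        then show ?thesis using ij j svdD(3)[OF svd, of i]
          by (simp add: dilation_values_def del: min_less_iff_conj)
      next
        case j2: False
        then have vj: "dilation_values m n s j = - s (N - 1 - j)"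
          using j by (simp add: dilation_values_def N_def del: min_less_iff_conj)
        have sj: "0 \<le> s (N - 1 - j)" using svdD(3)[OF svd small[OF j2]] ij by simp
        show ?thesis
        proof (cases "i < max m n")
          case True
          then have "0 \<le> dilation_values m n s i"
            using svdD(3)[OF svd, of i] by (simp add: dilation_values_def)
          then show ?thesis using vj sj by simp
        next
          case False
          moreover have "\<not> i < min m n" using False by linarith
          ultimately have vi: "dilation_values m n s i = - s (N - 1 - i)"
            by (simp add: dilation_values_def N_def del: min_less_iff_conj)
          have "s (N - 1 - i) \<le> s (N - 1 - j)"
            using svdD(4)[OF svd _ small[OF False], of "N - 1 - j"] ij by simp
          then show ?thesis using vi vj by simp
        qed
      qed
    qed
  qed
  then have "spectral_dec N H T (dilation_values m n s)"
    using uT HD by (simp add: spectral_dec_def D_def)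
  then show ?thesis unfolding N_def H_def by blast
qed

text \<open>Mirsky's inequality. The eigenvalues of the dilation of \<open>F\<close> are \<open>\<plusminus>s\<close> and zeros, so the sign of
  each difference \<open>s i - x i\<close> is chosen by taking either the eigenvalue \<open>s i\<close> or its mirror image
  in the Lidskii--Wielandt inequality.\<close>

lemma mirsky:
  assumes F: "svd m n F V s W" and X: "svd m n X V' x W'" and Y: "svd m n (F - X) V'' y W''"
    and I: "I \<subseteq> {..<min m n}"
  shows "(\<Sum>i\<in>I. \<bar>s i - x i\<bar>) \<le> (\<Sum>i<card I. y i)"
proof -
  note Fc = svdD(6)[OF F] and Xc = svdD(6)[OF X]
  obtain T where T: "spectral_dec (m + n) (dilation m n F) T (dilation_values m n s)"
    using dilation_spectral_dec[OF F] by blast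
  obtain S where S: "spectral_dec (m + n) (dilation m n X) S (dilation_values m n x)"
    using dilation_spectral_dec[OF X] by blast
  obtain R where R: "spectral_dec (m + n) (dilation m n (F - X)) R (dilation_values m n y)"
    using dilation_spectral_dec[OF Y] by blast
  have diff: "dilation m n F - dilation m n X = dilation m n (F - X)"
    using Fc Xc by (intro eq_matI) (auto simp: dilation_def)
  define g where "g i = (if x i \<le> s i then i else m + n - 1 - i)" for i
  have inj: "inj_on g I"
  proof (rule inj_onI)
    fix i j assume ij: "i \<in> I" "j \<in> I" "g i = g j"
    then have "i < m" "i < n" "j < m" "j < n" using I by auto
    then show "i = j" using ij(3) by (simp add: g_def split: if_splits)
  qed
  have gI: "g ` I \<subseteq> {..<m + n}" using I by (auto simp: g_def subset_iff)
  have mirror: "dilation_values m n u (m + n - 1 - i) = - u i" if "i < min m n" for u i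
    using that by (auto simp: dilation_values_def)
  have direct: "dilation_values m n u i = u i" if "i < min m n" for u i
    using that by (simp add: dilation_values_def)
  have "(\<Sum>i\<in>I. \<bar>s i - x i\<bar>) = (\<Sum>i\<in>I. dilation_values m n s (g i) - dilation_values m n x (g i))"
  proof (rule sum.cong[OF refl])
    fix i assume "i \<in> I"
    then have i: "i < min m n" using I by blast
    show "\<bar>s i - x i\<bar> = dilation_values m n s (g i) - dilation_values m n x (g i)"
      unfolding g_def using mirror[OF i] direct[OF i] by simp
  qed
  also have "\<dots> = (\<Sum>j\<in>g ` I. dilation_values m n s j - dilation_values m n x j)"
    by (simp add: sum.reindex[OF inj])
  also have "\<dots> \<le> (\<Sum>i<card (g ` I). dilation_values m n y i)"
    by (rule lidskii[OF S T R[folded diff] gI])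
  also have "\<dots> = (\<Sum>i<card I. dilation_values m n y i)" by (simp add: card_image[OF inj])
  also have "\<dots> = (\<Sum>i<card I. y i)"
  proof (rule sum.cong[OF refl])
    fix i assume "i \<in> {..<card I}"
    moreover have "card I \<le> min m n" using card_mono[OF _ I] by simp
    ultimately show "dilation_values m n y i = y i" by (intro direct) simp
  qed
  finally show ?thesis .
qed

section \<open>The trace inequality and its equality case\<close>

lemma mat_trace_gram:
  assumes svd: "svd m n F V s W"
  shows "mat_trace (F\<^sup>\<dagger> * F) = of_real (\<Sum>i<min m n. (s i)\<^sup>2)"
proof -
  note V = svdD(1)[OF svd] and W = svdD(2)[OF svd]
  note Vc = unitary_matD(1)[OF V] and Wc = unitary_matD(1)[OF W]
  define D where "D = mat_diag n (\<lambda>i. complex_of_real (if i < m then (s i)\<^sup>2 else 0))"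
  have D: "D \<in> carrier_mat n n" by (simp add: D_def)
  have "F\<^sup>\<dagger> * F = W * (rdiag n m s * rdiag m n s) * W\<^sup>\<dagger>"
    unfolding svdD(5)[OF svd] using Vc Wc by (simp add: mat_word unitary_cancel[OF V])
  then have "F\<^sup>\<dagger> * F = W * D * W\<^sup>\<dagger>" by (simp only: rdiag_mult_rdiag D_def)
  then have "mat_trace (F\<^sup>\<dagger> * F) = mat_trace (W\<^sup>\<dagger> * (W * D))"
    using mat_trace_comm[OF mult_carrier_mat[OF Wc D] adjoint_carrier[OF Wc]] by simp
  also have "W\<^sup>\<dagger> * (W * D) = D" using unitary_cancel(1)[OF W, of D] D by simp
  also have "mat_trace D = (\<Sum>i<n. of_real (if i < m then (s i)\<^sup>2 else 0))"
    by (simp add: mat_trace_def D_def mat_diag_def)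
  also have "\<dots> = of_real (\<Sum>i<n. if i < m then (s i)\<^sup>2 else 0)" by (simp only: of_real_sum)
  also have "(\<Sum>i<n. if i < m then (s i)\<^sup>2 else 0) = (\<Sum>i<min m n. (s i)\<^sup>2)"
    by (rule sum.mono_neutral_cong_right) auto
  finally show ?thesis .
qed

lemma Re_trace_gram_minus:
  assumes F: "F \<in> carrier_mat m n" and U: "U \<in> carrier_mat m n"
  shows "Re (mat_trace ((F - U)\<^sup>\<dagger> * (F - U))) =
    Re (mat_trace (F\<^sup>\<dagger> * F)) - 2 * Re (mat_trace (U\<^sup>\<dagger> * F)) + Re (mat_trace (U\<^sup>\<dagger> * U))"
proof -
  note FH = adjoint_carrier[OF F] and UH = adjoint_carrier[OF U]
  have "(F - U)\<^sup>\<dagger> * (F - U) = (F\<^sup>\<dagger> - U\<^sup>\<dagger>) * (F - U)" by (simp only: adjoint_minus[OF F U])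
  also have "\<dots> = (F\<^sup>\<dagger> - U\<^sup>\<dagger>) * F - (F\<^sup>\<dagger> - U\<^sup>\<dagger>) * U"
    by (rule mult_minus_distrib_mat[OF minus_carrier_mat[OF UH] F U])
  also have "\<dots> = (F\<^sup>\<dagger> * F - U\<^sup>\<dagger> * F) - (F\<^sup>\<dagger> * U - U\<^sup>\<dagger> * U)"
    by (simp only: minus_mult_distrib_mat[OF FH UH F] minus_mult_distrib_mat[OF FH UH U])
  finally have "mat_trace ((F - U)\<^sup>\<dagger> * (F - U)) =
      (mat_trace (F\<^sup>\<dagger> * F) - mat_trace (U\<^sup>\<dagger> * F)) - (mat_trace (F\<^sup>\<dagger> * U) - mat_trace (U\<^sup>\<dagger> * U))"
    using F U by (simp add: mat_trace_minus[of _ n] mult_carrier_mat[OF FH F] mult_carrier_mat[OF UH F]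
        mult_carrier_mat[OF FH U] mult_carrier_mat[OF UH U] minus_carrier_mat)
  moreover have "mat_trace (F\<^sup>\<dagger> * U) = cnj (mat_trace (U\<^sup>\<dagger> * F))"
    using mat_trace_adjoint[OF mult_carrier_mat[OF UH F]] adjoint_mult[OF UH F] by simp
  ultimately show ?thesis by simp
qed

text \<open>Bessel's inequality: completed to a unitary matrix, the row has norm one.\<close>

lemma isometry_row_norm:
  assumes A: "A \<in> carrier_mat m k" "A\<^sup>\<dagger> * A = 1\<^sub>m k" and j: "j < m"
  shows "(\<Sum>i<k. (cmod (A $$ (j, i)))\<^sup>2) \<le> 1"
proof -
  obtain U where km: "k \<le> m" and U: "unitary_mat m U"
    and UA: "\<And>i. i < k \<Longrightarrow> U $$ (j, i) = A $$ (j, i)"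
    using isometry_completion[OF A] j by blast
  note Uc = unitary_matD(1)[OF U]
  have "(\<Sum>i<k. (cmod (A $$ (j, i)))\<^sup>2) = (\<Sum>i<k. (cmod (U $$ (j, i)))\<^sup>2)"
    by (rule sum.cong) (simp_all add: UA)
  also have "\<dots> \<le> (\<Sum>i<m. (cmod (U $$ (j, i)))\<^sup>2)"
    using km by (intro sum_mono2) auto
  also have "\<dots> = (\<Sum>i<m. (cmod (U\<^sup>\<dagger> $$ (i, j)))\<^sup>2)"
    using Uc j by (intro sum.cong) simp_all
  also have "\<dots> = 1"
    using isometry_col_norm[OF adjoint_carrier[OF Uc] _ j] unitary_matD(3)[OF U] by simp
  finally show ?thesis .
qed

text \<open>With the threshold \<open>t = s (k - 1)\<close>, the sum of \<open>(s j - t) * c j\<close> is largest when the weights are one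
  for \<open>j < k\<close> and zero otherwise, and the sum of \<open>t * c j\<close> is at most \<open>t * k\<close>.\<close>

lemma weighted_sum_le_top_sum:
  fixes s c :: "nat \<Rightarrow> real"
  assumes k: "1 \<le> k" "k \<le> q" and s: "\<And>i j. i \<le> j \<Longrightarrow> j < q \<Longrightarrow> s j \<le> s i" "\<And>i. i < q \<Longrightarrow> 0 \<le> s i"
    and c: "\<And>j. j < q \<Longrightarrow> 0 \<le> c j" "\<And>j. j < q \<Longrightarrow> c j \<le> 1" "(\<Sum>j<q. c j) \<le> k"
  shows "(\<Sum>j<q. s j * c j) \<le> (\<Sum>j<k. s j)"
proof -
  define t where "t = s (k - 1)"
  have t: "0 \<le> t" using s(2) k by (simp add: t_def)
  have "(\<Sum>j<q. s j * c j) \<le> (\<Sum>j<q. t * c j + (if j < k then s j - t else 0))"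
  proof (rule sum_mono)
    fix j assume "j \<in> {..<q}"
    then have j: "j < q" by simp
    show "s j * c j \<le> t * c j + (if j < k then s j - t else 0)"
    proof (cases "j < k")
      case True
      then have "0 \<le> s j - t" using s(1)[of j "k - 1"] k by (simp add: t_def)
      then have "(s j - t) * c j \<le> s j - t" using c(2)[OF j] by (simp add: mult_left_le)
      then show ?thesis using True by (simp add: algebra_simps)
    next
      case False
      then have "s j \<le> t" using s(1)[of "k - 1" j] j k by (simp add: t_def)
      then show ?thesis using False c(1)[OF j] by (simp add: mult_right_mono)
    qed
  qed
  also have "\<dots> = t * (\<Sum>j<q. c j) + (\<Sum>j<q. if j < k then s j - t else 0)"
    by (simp add: sum.distrib sum_distrib_left)
  also have "(\<Sum>j<q. if j < k then s j - t else 0) = (\<Sum>j<k. s j - t)"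
    using k by (intro sum.mono_neutral_cong_right) auto
  also have "(\<Sum>j<k. s j - t) = (\<Sum>j<k. s j) - k * t" by (simp add: sum_subtractf)
  also have "t * (\<Sum>j<q. c j) \<le> t * k" using c(3) t by (rule mult_left_mono)
  finally show ?thesis by (simp add: mult.commute)
qed

text \<open>In singular bases the trace is the sum of \<open>s\<^sub>j \<langle>P\<^sup>\<dagger> v\<^sub>j, Q\<^sup>\<dagger> w\<^sub>j\<rangle>\<close>. The real part of the inner product is at
  most the mean of the two squared norms. By Bessel these weights are at most one, and since \<open>P\<close> and
  \<open>Q\<close> have \<open>k\<close> orthonormal columns each, they add up to at most \<open>k\<close>.\<close>

lemma trace_inequality:
  assumes svd: "svd m n F V s W" and k: "1 \<le> k" "k \<le> min m n"
    and P: "P \<in> carrier_mat m k" "P\<^sup>\<dagger> * P = 1\<^sub>m k"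
    and Q: "Q \<in> carrier_mat n k" "Q\<^sup>\<dagger> * Q = 1\<^sub>m k"
  shows "Re (mat_trace (P\<^sup>\<dagger> * F * Q)) \<le> (\<Sum>i<k. s i)"
proof -
  define q where "q = min m n"
  note V = svdD(1)[OF svd] and W = svdD(2)[OF svd]
  note Vc = unitary_matD(1)[OF V] and Wc = unitary_matD(1)[OF W]
  define A B where "A = V\<^sup>\<dagger> * P" and "B = W\<^sup>\<dagger> * Q"
  have A: "A \<in> carrier_mat m k" "A\<^sup>\<dagger> * A = 1\<^sub>m k"
    unfolding A_def using isometry_mult[OF adjoint_carrier[OF Vc] _ P] unitary_matD(3)[OF V] by simp_all
  have B: "B \<in> carrier_mat n k" "B\<^sup>\<dagger> * B = 1\<^sub>m k"
    unfolding B_def using isometry_mult[OF adjoint_carrier[OF Wc] _ Q] unitary_matD(3)[OF W] by simp_all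
  have PFQ: "P\<^sup>\<dagger> * F * Q = A\<^sup>\<dagger> * rdiag m n s * (B\<^sup>\<dagger>)\<^sup>\<dagger>"
    unfolding svdD(5)[OF svd] A_def B_def using Vc Wc P(1) Q(1) by (simp add: mat_word)
  have Ad: "A\<^sup>\<dagger> \<in> carrier_mat k m" and Bd: "B\<^sup>\<dagger> \<in> carrier_mat k n" using A B by simp_all
  have mn: "j < m" "j < n" if "j < q" for j using that by (simp_all add: q_def)
  define c where "c j = ((\<Sum>i<k. (cmod (A $$ (j, i)))\<^sup>2) + (\<Sum>i<k. (cmod (B $$ (j, i)))\<^sup>2)) / 2" for j
  have "Re (mat_trace (P\<^sup>\<dagger> * F * Q)) =
      (\<Sum>i<k. Re ((A\<^sup>\<dagger> * rdiag m n s * (B\<^sup>\<dagger>)\<^sup>\<dagger>) $$ (i, i)))"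
    unfolding PFQ mat_trace_def using A(1) by (simp del: index_mult_mat(1) adjoint_adjoint)
  also have "\<dots> = (\<Sum>i<k. \<Sum>j<q. s j * Re (cnj (A $$ (j, i)) * B $$ (j, i)))"
  proof (rule sum.cong[OF refl])
    fix i assume "i \<in> {..<k}"
    then have i: "i < k" by simp
    have "(A\<^sup>\<dagger> * rdiag m n s * (B\<^sup>\<dagger>)\<^sup>\<dagger>) $$ (i, i) =
        (\<Sum>j<min m n. A\<^sup>\<dagger> $$ (i, j) * of_real (s j) * cnj (B\<^sup>\<dagger> $$ (i, j)))"
      by (rule rdiag_sandwich_index[OF Ad Bd i i])
    also have "\<dots> = (\<Sum>j<q. of_real (s j) * (cnj (A $$ (j, i)) * B $$ (j, i)))"
      unfolding q_def[symmetric] using i A(1) B(1) mn by (intro sum.cong) simp_all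
    finally show "Re ((A\<^sup>\<dagger> * rdiag m n s * (B\<^sup>\<dagger>)\<^sup>\<dagger>) $$ (i, i)) =
        (\<Sum>j<q. s j * Re (cnj (A $$ (j, i)) * B $$ (j, i)))"
      by (simp only: Re_sum Re_complex_of_real times_complex.sel Im_complex_of_real mult_zero_left diff_zero)
  qed
  also have "\<dots> = (\<Sum>j<q. \<Sum>i<k. s j * Re (cnj (A $$ (j, i)) * B $$ (j, i)))" by (rule sum.swap)
  also have "\<dots> \<le> (\<Sum>j<q. s j * c j)"
  proof (rule sum_mono)
    fix j assume "j \<in> {..<q}"
    then have "0 \<le> s j" using svdD(3)[OF svd] by (simp add: q_def)
    have "(\<Sum>i<k. Re (cnj (A $$ (j, i)) * B $$ (j, i))) \<le>
        (\<Sum>i<k. ((cmod (A $$ (j, i)))\<^sup>2 + (cmod (B $$ (j, i)))\<^sup>2) / 2)"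
    proof (rule sum_mono)
      fix i
      have "Re (cnj (A $$ (j, i)) * B $$ (j, i)) \<le> cmod (A $$ (j, i)) * cmod (B $$ (j, i))"
        by (metis complex_Re_le_cmod complex_mod_cnj norm_mult)
      also have "\<dots> \<le> ((cmod (A $$ (j, i)))\<^sup>2 + (cmod (B $$ (j, i)))\<^sup>2) / 2"
        using sum_squares_bound[of "cmod (A $$ (j, i))" "cmod (B $$ (j, i))"] by simp
      finally show "Re (cnj (A $$ (j, i)) * B $$ (j, i)) \<le> ((cmod (A $$ (j, i)))\<^sup>2 + (cmod (B $$ (j, i)))\<^sup>2) / 2" .
    qed
    also have "\<dots> = c j" by (simp only: c_def sum_divide_distrib[symmetric] sum.distrib)
    finally show "(\<Sum>i<k. s j * Re (cnj (A $$ (j, i)) * B $$ (j, i))) \<le> s j * c j"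
      unfolding sum_distrib_left[symmetric] using \<open>0 \<le> s j\<close> by (rule mult_left_mono)
  qed
  also have "\<dots> \<le> (\<Sum>j<k. s j)"
  proof (rule weighted_sum_le_top_sum[OF k(1)])
    show "k \<le> q" using k by (simp add: q_def)
    show "s j \<le> s i" if "i \<le> j" "j < q" for i j using svdD(4)[OF svd that[unfolded q_def]] .
    show "0 \<le> s i" if "i < q" for i using svdD(3)[OF svd that[unfolded q_def]] .
    show "0 \<le> c j" for j by (simp add: c_def sum_nonneg)
    show "c j \<le> 1" if "j < q" for j
      using isometry_row_norm[OF A mn(1)[OF that]] isometry_row_norm[OF B mn(2)[OF that]] by (simp add: c_def)
    have colA: "(\<Sum>j<q. \<Sum>i<k. (cmod (A $$ (j, i)))\<^sup>2) \<le> k"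
    proof -
      have "(\<Sum>j<q. \<Sum>i<k. (cmod (A $$ (j, i)))\<^sup>2) \<le> (\<Sum>j<m. \<Sum>i<k. (cmod (A $$ (j, i)))\<^sup>2)"
        by (intro sum_mono2) (auto simp: q_def intro: sum_nonneg)
      also have "\<dots> = (\<Sum>i<k. \<Sum>j<m. (cmod (A $$ (j, i)))\<^sup>2)" by (rule sum.swap)
      also have "\<dots> = (\<Sum>i<k. 1)" by (rule sum.cong) (simp_all add: isometry_col_norm[OF A])
      finally show ?thesis by simp
    qed
    have colB: "(\<Sum>j<q. \<Sum>i<k. (cmod (B $$ (j, i)))\<^sup>2) \<le> k"
    proof -
      have "(\<Sum>j<q. \<Sum>i<k. (cmod (B $$ (j, i)))\<^sup>2) \<le> (\<Sum>j<n. \<Sum>i<k. (cmod (B $$ (j, i)))\<^sup>2)"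
        by (intro sum_mono2) (auto simp: q_def intro: sum_nonneg)
      also have "\<dots> = (\<Sum>i<k. \<Sum>j<n. (cmod (B $$ (j, i)))\<^sup>2)" by (rule sum.swap)
      also have "\<dots> = (\<Sum>i<k. 1)" by (rule sum.cong) (simp_all add: isometry_col_norm[OF B])
      finally show ?thesis by simp
    qed
    show "(\<Sum>j<q. c j) \<le> real k"
      unfolding c_def sum_divide_distrib[symmetric] sum.distrib using colA colB by simp
  qed
  finally show ?thesis .
qed

text \<open>Equality forces \<open>F Q\<close> to have the polar form \<open>P A\<close> with \<open>A\<close> positive semidefinite. From a
  singular value decomposition \<open>F Q = V\<^sub>1 \<Sigma>\<^sub>1 Z\<^sup>\<dagger>\<close> the trace equals \<open>\<Sum>\<^sub>j a j * (1 - \<parallel>v\<^sub>j - P z\<^sub>j\<parallel>\<^sup>2 / 2)\<close>, while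
  the trace inequality bounds \<open>\<Sum>\<^sub>j a j\<close> by the same value, so \<open>v\<^sub>j = P z\<^sub>j\<close> whenever \<open>a j \<noteq> 0\<close>.\<close>

lemma trace_equality_polar:
  assumes svd: "svd m n F V s W" and k: "1 \<le> k" "k \<le> min m n"
    and P: "P \<in> carrier_mat m k" "P\<^sup>\<dagger> * P = 1\<^sub>m k"
    and Q: "Q \<in> carrier_mat n k" "Q\<^sup>\<dagger> * Q = 1\<^sub>m k"
    and eq: "(\<Sum>i<k. s i) \<le> Re (mat_trace (P\<^sup>\<dagger> * F * Q))"
  shows "\<exists>Z a. unitary_mat k Z \<and> (\<forall>i<k. 0 \<le> a i) \<and> antimono_on {..<k} a
    \<and> F * Q = P * (Z * mat_diag k (\<lambda>i. complex_of_real (a i)) * Z\<^sup>\<dagger>)"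
proof -
  note Fc = svdD(6)[OF svd]
  have km: "k \<le> m" "min m k = k" using k by simp_all
  obtain V1 a Z where svd1: "svd m k (F * Q) V1 a Z"
    using svd_exists[OF mult_carrier_mat[OF Fc Q(1)]] by blast
  note V1 = svdD(1)[OF svd1] and Z = svdD(2)[OF svd1]
  note V1c = unitary_matD(1)[OF V1] and Zc = unitary_matD(1)[OF Z]
  define P1 where "P1 = mat m k (\<lambda>(i, j). V1 $$ (i, j))"
  have P1: "P1 \<in> carrier_mat m k" and P1P1: "P1\<^sup>\<dagger> * P1 = 1\<^sub>m k"
    unfolding P1_def using unitary_select_columns[OF V1, of "\<lambda>j. j" k] km(1) by simp_all
  define Y where "Y = V1 * rdiag m k a"
  have Y: "Y \<in> carrier_mat m k" unfolding Y_def by (rule mult_carrier_mat[OF V1c rdiag_carrier])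
  have Y_index: "Y $$ (l, j) = V1 $$ (l, j) * of_real (a j)" if "l < m" "j < k" for l j
    unfolding Y_def using mult_rdiag_index[OF V1c that] that km(1) by simp
  have FQZ: "F * Q * Z = Y" unfolding Y_def by (rule svd_mult_right(1)[OF svd1])
  have FQ: "F * Q = Y * Z\<^sup>\<dagger>" unfolding Y_def by (rule svdD(5)[OF svd1])
  have tr_index: "mat_trace (R\<^sup>\<dagger> * Y) = (\<Sum>j<k. of_real (a j) * (\<Sum>l<m. cnj (R $$ (l, j)) * V1 $$ (l, j)))"
    if R: "R \<in> carrier_mat m k" for R
  proof -
    have "mat_trace (R\<^sup>\<dagger> * Y) = (\<Sum>j<k. (R\<^sup>\<dagger> * Y) $$ (j, j))"
      unfolding mat_trace_def using R by simp
    also have "\<dots> = (\<Sum>j<k. of_real (a j) * (\<Sum>l<m. cnj (R $$ (l, j)) * V1 $$ (l, j)))"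
    proof (rule sum.cong[OF refl])
      fix j assume "j \<in> {..<k}"
      then have j: "j < k" by simp
      have "(R\<^sup>\<dagger> * Y) $$ (j, j) = (\<Sum>l<m. R\<^sup>\<dagger> $$ (j, l) * Y $$ (l, j))"
        by (rule index_mult_sum[OF adjoint_carrier[OF R] Y j j])
      also have "\<dots> = (\<Sum>l<m. of_real (a j) * (cnj (R $$ (l, j)) * V1 $$ (l, j)))"
        using j R by (intro sum.cong) (simp_all add: Y_index)
      finally show "(R\<^sup>\<dagger> * Y) $$ (j, j) = of_real (a j) * (\<Sum>l<m. cnj (R $$ (l, j)) * V1 $$ (l, j))"
        by (simp only: sum_distrib_left)
    qed
    finally show ?thesis .
  qed
  have upper: "(\<Sum>j<k. a j) \<le> (\<Sum>j<k. s j)"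
  proof -
    have "mat_trace (P1\<^sup>\<dagger> * F * (Q * Z)) = mat_trace (P1\<^sup>\<dagger> * Y)"
      unfolding FQZ[symmetric] using P1 Fc Q(1) Zc by (simp add: mult_assoc_dim)
    also have "\<dots> = (\<Sum>j<k. of_real (a j) * (\<Sum>l<m. cnj (P1 $$ (l, j)) * V1 $$ (l, j)))"
      by (rule tr_index[OF P1])
    also have "\<dots> = (\<Sum>j<k. of_real (a j))"
    proof (rule sum.cong[OF refl])
      fix j assume "j \<in> {..<k}"
      then have j: "j < k" by simp
      have "(\<Sum>l<m. cnj (P1 $$ (l, j)) * V1 $$ (l, j)) = (\<Sum>l<m. cnj (V1 $$ (l, j)) * V1 $$ (l, j))"
        using j by (intro sum.cong) (simp_all add: P1_def)
      also have "\<dots> = 1" using isometry_iff[OF V1c] unitary_matD(2)[OF V1] j km(1) by simp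
      finally show "of_real (a j) * (\<Sum>l<m. cnj (P1 $$ (l, j)) * V1 $$ (l, j)) = of_real (a j)" by simp
    qed
    finally have "Re (mat_trace (P1\<^sup>\<dagger> * F * (Q * Z))) = (\<Sum>j<k. a j)" by simp
    then show ?thesis
      using trace_inequality[OF svd k P1 P1P1 isometry_mult[OF Q Zc unitary_matD(2)[OF Z]]] by simp
  qed
  define N where "N = P * Z"
  have N: "N \<in> carrier_mat m k" "N\<^sup>\<dagger> * N = 1\<^sub>m k"
    unfolding N_def using isometry_mult[OF P Zc unitary_matD(2)[OF Z]] by simp_all
  define e where "e j = (\<Sum>l<m. (cmod (V1 $$ (l, j) - N $$ (l, j)))\<^sup>2)" for j
  have e0: "0 \<le> e j" for j by (simp add: e_def sum_nonneg)
  have inner: "Re (\<Sum>l<m. cnj (N $$ (l, j)) * V1 $$ (l, j)) = 1 - e j / 2" if j: "j < k" for j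
  proof -
    have pol: "(cmod (v - w))\<^sup>2 = (cmod v)\<^sup>2 + (cmod w)\<^sup>2 - 2 * Re (cnj w * v)" for v w
      unfolding cmod_power2 by (simp add: power2_eq_square algebra_simps)
    have "e j = (\<Sum>l<m. (cmod (V1 $$ (l, j)))\<^sup>2) + (\<Sum>l<m. (cmod (N $$ (l, j)))\<^sup>2) -
        2 * Re (\<Sum>l<m. cnj (N $$ (l, j)) * V1 $$ (l, j))"
      unfolding e_def pol by (simp only: sum.distrib sum_subtractf Re_sum sum_distrib_left)
    also have "\<dots> = 1 + 1 - 2 * Re (\<Sum>l<m. cnj (N $$ (l, j)) * V1 $$ (l, j))"
      using isometry_col_norm[OF N j] isometry_col_norm[OF V1c unitary_matD(2)[OF V1], of j] j km(1)
      by (simp only: less_le_trans)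
    finally show ?thesis by linarith
  qed
  have "mat_trace (P\<^sup>\<dagger> * F * Q) = mat_trace (P\<^sup>\<dagger> * Y * Z\<^sup>\<dagger>)"
    using P(1) Fc Q(1) Y Zc FQ by (simp add: mult_assoc_dim)
  also have "\<dots> = mat_trace (Z\<^sup>\<dagger> * (P\<^sup>\<dagger> * Y))"
    by (rule mat_trace_comm[OF mult_carrier_mat[OF adjoint_carrier[OF P(1)] Y] adjoint_carrier[OF Zc]])
  also have "Z\<^sup>\<dagger> * (P\<^sup>\<dagger> * Y) = N\<^sup>\<dagger> * Y"
    unfolding N_def using P(1) Y Zc by (simp add: mat_word)
  finally have "Re (mat_trace (P\<^sup>\<dagger> * F * Q)) = (\<Sum>j<k. a j * (1 - e j / 2))"
    unfolding tr_index[OF N(1)] using inner by simp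
  then have "(\<Sum>j<k. s j) \<le> (\<Sum>j<k. a j) - (\<Sum>j<k. a j * e j) / 2"
    using eq by (simp add: right_diff_distrib sum_subtractf sum_divide_distrib)
  then have le0: "(\<Sum>j<k. a j * e j) \<le> 0" using upper by simp
  have a0: "0 \<le> a j" if "j < k" for j using svdD(3)[OF svd1, of j] that km by simp
  have "(\<Sum>j<k. a j * e j) = 0"
    using le0 sum_nonneg[of "{..<k}" "\<lambda>j. a j * e j"] a0 e0 by simp
  then have ae: "a j * e j = 0" if "j < k" for j
    using sum_nonneg_eq_0_iff[of "{..<k}" "\<lambda>j. a j * e j"] a0 e0 that by simp
  have YN: "Y = N * mat_diag k (\<lambda>i. complex_of_real (a i))"
  proof (rule eq_matI)
    fix l j assume "l < dim_row (N * mat_diag k (\<lambda>i. complex_of_real (a i)))"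
      "j < dim_col (N * mat_diag k (\<lambda>i. complex_of_real (a i)))"
    then have lj: "l < m" "j < k" using N(1) by simp_all
    have "V1 $$ (l, j) * of_real (a j) = N $$ (l, j) * of_real (a j)"
    proof (cases "a j = 0")
      case False
      then have "e j = 0" using ae[OF lj(2)] by simp
      then have "\<forall>l\<in>{..<m}. (cmod (V1 $$ (l, j) - N $$ (l, j)))\<^sup>2 = 0"
        unfolding e_def by (subst (asm) sum_nonneg_eq_0_iff) simp_all
      then show ?thesis using lj(1) by simp
    qed simp
    then show "Y $$ (l, j) = (N * mat_diag k (\<lambda>i. complex_of_real (a i))) $$ (l, j)"
      unfolding mat_diag_mult_right[OF N(1)] using lj by (simp add: Y_index)
  qed (use Y N(1) in simp_all)
  have "F * Q = P * (Z * mat_diag k (\<lambda>i. complex_of_real (a i)) * Z\<^sup>\<dagger>)"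
    unfolding FQ YN N_def using P(1) Zc by (simp add: mult_assoc_dim)
  moreover have "antimono_on {..<k} a" using svd1 km by (simp add: svd_def)
  ultimately show ?thesis using Z a0 by blast
qed

section \<open>A common singular value decomposition\<close>

lemma completed_column:
  assumes F: "F \<in> carrier_mat m n" and U: "unitary_mat m U" and W: "unitary_mat n W" and k: "k \<le> m" "k \<le> n"
    and P: "P \<in> carrier_mat m k" "\<And>i j. i < m \<Longrightarrow> j < k \<Longrightarrow> U $$ (i, j) = P $$ (i, j)"
    and Q: "Q \<in> carrier_mat n k" "\<And>i j. i < n \<Longrightarrow> j < k \<Longrightarrow> W $$ (i, j) = Q $$ (i, j)"
    and FQ: "F * Q = P * mat_diag k (\<lambda>i. complex_of_real (a i))"
    and ij: "i < m" "j < k"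
  shows "(U\<^sup>\<dagger> * F * W) $$ (i, j) = (if i = j then of_real (a j) else 0)"
proof -
  note Uc = unitary_matD(1)[OF U] and Wc = unitary_matD(1)[OF W]
  have jn: "j < n" "j < m" using ij k by simp_all
  have FW: "(F * W) $$ (l, j) = U $$ (l, j) * of_real (a j)" if l: "l < m" for l
  proof -
    have "(F * W) $$ (l, j) = (\<Sum>r<n. F $$ (l, r) * W $$ (r, j))"
      by (rule index_mult_sum[OF F Wc l jn(1)])
    also have "\<dots> = (\<Sum>r<n. F $$ (l, r) * Q $$ (r, j))"
      using ij(2) by (intro sum.cong) (simp_all add: Q(2))
    also have "\<dots> = (F * Q) $$ (l, j)" by (rule index_mult_sum[OF F Q(1) l ij(2), symmetric])
    also have "\<dots> = P $$ (l, j) * of_real (a j)"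
      unfolding FQ mat_diag_mult_right[OF P(1)] using l ij(2) by simp
    finally show ?thesis using P(2)[OF l ij(2)] by simp
  qed
  have "(U\<^sup>\<dagger> * F * W) $$ (i, j) = (U\<^sup>\<dagger> * (F * W)) $$ (i, j)"
    using Uc F Wc by (simp only: assoc_mult_mat[OF adjoint_carrier[OF Uc] F Wc])
  also have "\<dots> = (\<Sum>l<m. U\<^sup>\<dagger> $$ (i, l) * (F * W) $$ (l, j))"
    by (rule index_mult_sum[OF adjoint_carrier[OF Uc] mult_carrier_mat[OF F Wc] ij(1) jn(1)])
  also have "\<dots> = (\<Sum>l<m. of_real (a j) * (cnj (U $$ (l, i)) * U $$ (l, j)))"
    using Uc ij(1) FW by (intro sum.cong) (simp_all del: index_mult_mat(1))
  also have "\<dots> = of_real (a j) * (\<Sum>l<m. cnj (U $$ (l, i)) * U $$ (l, j))"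
    by (simp only: sum_distrib_left)
  also have "(\<Sum>l<m. cnj (U $$ (l, i)) * U $$ (l, j)) = (if i = j then 1 else 0)"
    using isometry_iff[OF Uc] unitary_matD(2)[OF U] ij(1) jn(2) by blast
  finally show ?thesis by simp
qed

lemma top_left_block_leading_ones:
  assumes "k \<le> m" "k \<le> n"
  shows "top_left_block m n k (1\<^sub>m k) = rdiag m n (leading_ones k)"
proof (rule eq_matI)
  fix i j assume "i < dim_row (rdiag m n (leading_ones k))" "j < dim_col (rdiag m n (leading_ones k))"
  then have ij: "i < m" "j < n" by simp_all
  show "top_left_block m n k (1\<^sub>m k) $$ (i, j) = rdiag m n (leading_ones k) $$ (i, j)"
    unfolding top_left_block_def rdiag_index[OF ij] using ij assms
    by (cases "i = j") (simp_all add: leading_ones_def)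
qed (use assms in \<open>simp_all add: top_left_block_def\<close>)

lemma rdiag_block_diag:
  assumes "k \<le> m" "k \<le> n"
  shows "rdiag m n (\<lambda>i. if i < k then a i else c (i - k)) =
    four_block_mat (mat_diag k (\<lambda>i. complex_of_real (a i))) (0\<^sub>m k (n - k)) (0\<^sub>m (m - k) k) (rdiag (m - k) (n - k) c)"
  (is "?L = ?R")
proof (rule eq_matI)
  fix i j assume "i < dim_row ?R" "j < dim_col ?R"
  then have ij: "i < m" "j < n" using assms by simp_all
  show "?L $$ (i, j) = ?R $$ (i, j)"
    unfolding rdiag_index[OF ij] using ij assms
    by (cases "i = j") (auto simp: rdiag_index mat_diag_def)
qed (use assms in simp_all)

lemma unitary_block_diag:
  assumes "unitary_mat l U" "k \<le> m" "l = m - k"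
  shows "unitary_mat m (four_block_mat (1\<^sub>m k) (0\<^sub>m k l) (0\<^sub>m l k) U)"
proof (rule unitary_matI)
  note Uc = unitary_matD(1)[OF assms(1)]
  have "four_block_mat (1\<^sub>m k) (0\<^sub>m k l) (0\<^sub>m l k) U \<in> carrier_mat (k + l) (k + l)"
    by (rule four_block_carrier_mat[OF one_carrier_mat Uc])
  then show "four_block_mat (1\<^sub>m k) (0\<^sub>m k l) (0\<^sub>m l k) U \<in> carrier_mat m m" using assms by simp
  show "(four_block_mat (1\<^sub>m k) (0\<^sub>m k l) (0\<^sub>m l k) U)\<^sup>\<dagger> * four_block_mat (1\<^sub>m k) (0\<^sub>m k l) (0\<^sub>m l k) U = 1\<^sub>m m"
    unfolding adjoint_block_diag[OF one_carrier_mat Uc] adjoint_one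
      mult_block_diag[OF one_carrier_mat one_carrier_mat adjoint_carrier[OF Uc] Uc] unitary_matD(2)[OF assms(1)]
    using assms by simp
qed

text \<open>If \<open>F\<close> maps the columns of \<open>Q\<close> to nonnegative multiples of those of \<open>P\<close>, and \<open>F\<^sup>\<dagger>\<close> conversely,
  then in completed bases \<open>F\<close> is block diagonal, and a singular value decomposition of the second
  block finishes the diagonalization. Its largest value cannot exceed the smallest \<open>a i\<close>:
  otherwise exchanging the two columns would violate the trace inequality.\<close>

lemma svd_extending_isometries:
  assumes svd: "svd m n F V s W" and k: "1 \<le> k" "k \<le> min m n"
    and P: "P \<in> carrier_mat m k" "P\<^sup>\<dagger> * P = 1\<^sub>m k"
    and Q: "Q \<in> carrier_mat n k" "Q\<^sup>\<dagger> * Q = 1\<^sub>m k"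
    and a: "\<And>i. i < k \<Longrightarrow> 0 \<le> a i" "antimono_on {..<k} a"
    and FQ: "F * Q = P * mat_diag k (\<lambda>i. complex_of_real (a i))"
    and FP: "F\<^sup>\<dagger> * P = Q * mat_diag k (\<lambda>i. complex_of_real (a i))"
    and top: "(\<Sum>i<k. s i) \<le> (\<Sum>i<k. a i)"
  shows "\<exists>V' s' W'. svd m n F V' s' W' \<and> P * Q\<^sup>\<dagger> = V' * rdiag m n (leading_ones k) * W'\<^sup>\<dagger>"
proof -
  note Fc = svdD(6)[OF svd]
  have km: "k \<le> m" and kn: "k \<le> n" using k by simp_all
  obtain U where U: "unitary_mat m U" and UP: "\<And>i j. i < m \<Longrightarrow> j < k \<Longrightarrow> U $$ (i, j) = P $$ (i, j)"
    using isometry_completion[OF P] by blast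
  obtain R where R: "unitary_mat n R" and RQ: "\<And>i j. i < n \<Longrightarrow> j < k \<Longrightarrow> R $$ (i, j) = Q $$ (i, j)"
    using isometry_completion[OF Q] by blast
  note Uc = unitary_matD(1)[OF U] and Rc = unitary_matD(1)[OF R]
  define G where "G = U\<^sup>\<dagger> * F * R"
  have G: "G \<in> carrier_mat m n"
    unfolding G_def by (rule mult_carrier_mat[OF mult_carrier_mat[OF adjoint_carrier[OF Uc] Fc] Rc])
  have col: "G $$ (i, j) = (if i = j then of_real (a j) else 0)" if "i < m" "j < k" for i j
    unfolding G_def by (rule completed_column[OF Fc U R km kn P(1) UP Q(1) RQ FQ that])
  have row: "G $$ (i, j) = (if i = j then of_real (a i) else 0)" if "i < k" "j < n" for i j
  proof -
    have "R\<^sup>\<dagger> * F\<^sup>\<dagger> * U = G\<^sup>\<dagger>" unfolding G_def using Uc Fc Rc by (simp add: mat_word)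
    moreover have "(R\<^sup>\<dagger> * F\<^sup>\<dagger> * U) $$ (j, i) = (if j = i then of_real (a i) else 0)"
      by (rule completed_column[OF adjoint_carrier[OF Fc] R U kn km Q(1) RQ P(1) UP FP that(2,1)])
    ultimately have "G\<^sup>\<dagger> $$ (j, i) = (if j = i then of_real (a i) else 0)" by (simp only:)
    then have "cnj (G $$ (i, j)) = (if j = i then of_real (a i) else 0)"
      using G that km by simp
    then have "cnj (cnj (G $$ (i, j))) = cnj (if j = i then of_real (a i) else 0)" by (simp only:)
    then show ?thesis by (simp split: if_splits)
  qed
  define E where "E = mat (m - k) (n - k) (\<lambda>(i, j). G $$ (i + k, j + k))"
  have E: "E \<in> carrier_mat (m - k) (n - k)" by (simp add: E_def)
  obtain V2 c W2 where svd2: "svd (m - k) (n - k) E V2 c W2" using svd_exists[OF E] by blast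
  note V2 = svdD(1)[OF svd2] and W2 = svdD(2)[OF svd2]
  note V2c = unitary_matD(1)[OF V2] and W2c = unitary_matD(1)[OF W2]
  define D where "D = mat_diag k (\<lambda>i. complex_of_real (a i))"
  have D: "D \<in> carrier_mat k k" by (simp add: D_def)
  have Gblk: "G = four_block_mat D (0\<^sub>m k (n - k)) (0\<^sub>m (m - k) k) E"
  proof (rule eq_matI)
    fix i j assume "i < dim_row (four_block_mat D (0\<^sub>m k (n - k)) (0\<^sub>m (m - k) k) E)"
      "j < dim_col (four_block_mat D (0\<^sub>m k (n - k)) (0\<^sub>m (m - k) k) E)"
    then have ij: "i < m" "j < n" using D E km kn by simp_all
    show "G $$ (i, j) = four_block_mat D (0\<^sub>m k (n - k)) (0\<^sub>m (m - k) k) E $$ (i, j)"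
    proof (cases "i < k \<or> j < k")
      case True
      then show ?thesis
        using ij D E km kn row[of i j] col[of i j] by (auto simp: D_def mat_diag_def)
    next
      case False
      then have "i - k < m - k" "j - k < n - k" "i - k + k = i" "j - k + k = j" using ij by auto
      then show ?thesis using False ij D E km kn by (simp add: E_def)
    qed
  qed (use G D E km kn in simp_all)
  define V3 where "V3 = four_block_mat (1\<^sub>m k) (0\<^sub>m k (m - k)) (0\<^sub>m (m - k) k) V2"
  define W3 where "W3 = four_block_mat (1\<^sub>m k) (0\<^sub>m k (n - k)) (0\<^sub>m (n - k) k) W2"
  have V3: "unitary_mat m V3" unfolding V3_def by (rule unitary_block_diag[OF V2 km refl])
  have W3: "unitary_mat n W3" unfolding W3_def by (rule unitary_block_diag[OF W2 kn refl])
  note V3c = unitary_matD(1)[OF V3] and W3c = unitary_matD(1)[OF W3]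
  have sandwich: "V3 * four_block_mat A (0\<^sub>m k (n - k)) (0\<^sub>m (m - k) k) B * W3\<^sup>\<dagger> =
      four_block_mat A (0\<^sub>m k (n - k)) (0\<^sub>m (m - k) k) (V2 * B * W2\<^sup>\<dagger>)"
    if A: "A \<in> carrier_mat k k" and B: "B \<in> carrier_mat (m - k) (n - k)" for A B
    unfolding V3_def W3_def adjoint_block_diag[OF one_carrier_mat W2c] adjoint_one
      mult_block_diag[OF one_carrier_mat A V2c B]
      mult_block_diag[OF mult_carrier_mat[OF one_carrier_mat A] one_carrier_mat
        mult_carrier_mat[OF V2c B] adjoint_carrier[OF W2c]]
    using A by simp
  define t where "t i = (if i < k then a i else c (i - k))" for i
  have "rdiag m n t = four_block_mat D (0\<^sub>m k (n - k)) (0\<^sub>m (m - k) k) (rdiag (m - k) (n - k) c)"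
    unfolding t_def D_def by (rule rdiag_block_diag[OF km kn])
  then have Gt: "G = V3 * rdiag m n t * W3\<^sup>\<dagger>"
    using sandwich[OF D rdiag_carrier[of "m - k" "n - k" c]] svdD(5)[OF svd2] Gblk by simp
  have "rdiag m n (leading_ones k) = rdiag m n (\<lambda>i. if i < k then 1 else 0)"
    by (rule arg_cong[of _ _ "rdiag m n"]) (auto simp: leading_ones_def)
  then have ones: "rdiag m n (leading_ones k) =
      four_block_mat (1\<^sub>m k) (0\<^sub>m k (n - k)) (0\<^sub>m (m - k) k) (rdiag (m - k) (n - k) (\<lambda>_. 0))"
    using rdiag_block_diag[OF km kn, of "\<lambda>_. 1" "\<lambda>_. 0"] by simp
  have rdiag0: "rdiag (m - k) (n - k) (\<lambda>_. 0) = 0\<^sub>m (m - k) (n - k)"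
    by (rule eq_matI) (simp_all add: rdiag_index)
  have ones_inv: "V3 * rdiag m n (leading_ones k) * W3\<^sup>\<dagger> = rdiag m n (leading_ones k)"
    unfolding ones rdiag0 sandwich[OF one_carrier_mat zero_carrier_mat] using V2c W2c by simp
  define Vf Wf where "Vf = U * V3" and "Wf = R * W3"
  have Vf: "unitary_mat m Vf" and Wf: "unitary_mat n Wf"
    unfolding Vf_def Wf_def by (rule unitary_mult[OF U V3], rule unitary_mult[OF R W3])
  note Vfc = unitary_matD(1)[OF Vf] and Wfc = unitary_matD(1)[OF Wf]
  have "F = U * G * R\<^sup>\<dagger>"
    unfolding G_def using Uc Fc Rc unitary_matD(3)[OF R]
    by (simp add: mult_assoc_dim unitary_cancel[OF U])
  then have Ff: "F = Vf * rdiag m n t * Wf\<^sup>\<dagger>"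
    unfolding Gt Vf_def Wf_def using Uc Rc V3c W3c by (simp add: mat_word)
  have PQ: "P * Q\<^sup>\<dagger> = Vf * rdiag m n (leading_ones k) * Wf\<^sup>\<dagger>"
  proof -
    have "Vf * rdiag m n (leading_ones k) * Wf\<^sup>\<dagger> = U * (V3 * rdiag m n (leading_ones k) * W3\<^sup>\<dagger>) * R\<^sup>\<dagger>"
      unfolding Vf_def Wf_def using Uc Rc V3c W3c by (simp add: mat_word)
    also have "\<dots> = U * rdiag m n (leading_ones k) * R\<^sup>\<dagger>" by (simp only: ones_inv)
    also have "\<dots> = P * Q\<^sup>\<dagger>"
    proof (rule eq_matI)
      fix i l assume "i < dim_row (P * Q\<^sup>\<dagger>)" "l < dim_col (P * Q\<^sup>\<dagger>)"
      then have il: "i < m" "l < n" using P Q by simp_all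
      have "(U * rdiag m n (leading_ones k) * R\<^sup>\<dagger>) $$ (i, l) =
          (\<Sum>j<min m n. U $$ (i, j) * of_real (leading_ones k j) * cnj (R $$ (l, j)))"
        by (rule rdiag_sandwich_index[OF Uc Rc il])
      also have "\<dots> = (\<Sum>j<k. P $$ (i, j) * Q\<^sup>\<dagger> $$ (j, l))"
        using k il Q(1) UP RQ
        by (intro sum.mono_neutral_cong_right) (auto simp: leading_ones_def)
      also have "\<dots> = (P * Q\<^sup>\<dagger>) $$ (i, l)"
        by (rule index_mult_sum[OF P(1) adjoint_carrier[OF Q(1)] il, symmetric])
      finally show "(U * rdiag m n (leading_ones k) * R\<^sup>\<dagger>) $$ (i, l) = (P * Q\<^sup>\<dagger>) $$ (i, l)" .
    qed (use Uc Rc P Q in simp_all)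
    finally show ?thesis ..
  qed
  have join: "t k \<le> a (k - 1)" if kq: "k < min m n"
  proof -
    define \<tau> where "\<tau> i = (if i = k - 1 then k else i)" for i
    have tau: "\<tau> i < m" "\<tau> i < n" if "i < k" for i using that kq by (auto simp: \<tau>_def)
    have tau_inj: "inj_on \<tau> {..<k}" by (auto simp: inj_on_def \<tau>_def)
    define P3 Q3 where "P3 = mat m k (\<lambda>(i, j). Vf $$ (i, \<tau> j))" and "Q3 = mat n k (\<lambda>(i, j). Wf $$ (i, \<tau> j))"
    have P3: "P3 \<in> carrier_mat m k" "P3\<^sup>\<dagger> * P3 = 1\<^sub>m k"
      unfolding P3_def by (rule unitary_select_columns[OF Vf tau_inj tau(1)], assumption)+
    have Q3: "Q3 \<in> carrier_mat n k" "Q3\<^sup>\<dagger> * Q3 = 1\<^sub>m k"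
      unfolding Q3_def by (rule unitary_select_columns[OF Wf tau_inj tau(2)], assumption)+
    have FWf: "F * Wf = Vf * rdiag m n t"
    proof -
      have "F * Wf = Vf * rdiag m n t * (Wf\<^sup>\<dagger> * Wf)"
        unfolding Ff using Vfc Wfc by (simp add: mult_assoc_dim)
      then show ?thesis unfolding unitary_matD(2)[OF Wf]
        using right_mult_one_mat[OF mult_carrier_mat[OF Vfc rdiag_carrier]] by simp
    qed
    have FQ3: "(F * Q3) $$ (l, i) = Vf $$ (l, \<tau> i) * of_real (t (\<tau> i))" if "l < m" "i < k" for l i
    proof -
      have "(F * Q3) $$ (l, i) = (\<Sum>r<n. F $$ (l, r) * Q3 $$ (r, i))"
        by (rule index_mult_sum[OF Fc Q3(1) that])
      also have "\<dots> = (\<Sum>r<n. F $$ (l, r) * Wf $$ (r, \<tau> i))"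
        using that by (intro sum.cong) (simp_all add: Q3_def)
      also have "\<dots> = (F * Wf) $$ (l, \<tau> i)"
        by (rule index_mult_sum[OF Fc Wfc that(1) tau(2)[OF that(2)], symmetric])
      also have "\<dots> = Vf $$ (l, \<tau> i) * of_real (t (\<tau> i))"
        unfolding FWf mult_rdiag_index[OF Vfc that(1) tau(2)[OF that(2)]] using tau(1)[OF that(2)] by simp
      finally show ?thesis .
    qed
    have "(P3\<^sup>\<dagger> * F * Q3) $$ (i, i) = of_real (t (\<tau> i))" if i: "i < k" for i
    proof -
      have "(P3\<^sup>\<dagger> * F * Q3) $$ (i, i) = (P3\<^sup>\<dagger> * (F * Q3)) $$ (i, i)"
        by (simp only: assoc_mult_mat[OF adjoint_carrier[OF P3(1)] Fc Q3(1)])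
      also have "\<dots> = (\<Sum>l<m. P3\<^sup>\<dagger> $$ (i, l) * (F * Q3) $$ (l, i))"
        by (rule index_mult_sum[OF adjoint_carrier[OF P3(1)] mult_carrier_mat[OF Fc Q3(1)] i i])
      also have "\<dots> = (\<Sum>l<m. of_real (t (\<tau> i)) * (cnj (Vf $$ (l, \<tau> i)) * Vf $$ (l, \<tau> i)))"
        using i FQ3 by (intro sum.cong) (simp_all add: P3_def del: index_mult_mat(1))
      also have "\<dots> = of_real (t (\<tau> i)) * (\<Sum>l<m. cnj (Vf $$ (l, \<tau> i)) * Vf $$ (l, \<tau> i))"
        by (simp only: sum_distrib_left)
      also have "(\<Sum>l<m. cnj (Vf $$ (l, \<tau> i)) * Vf $$ (l, \<tau> i)) = 1"
        using isometry_iff[OF Vfc] unitary_matD(2)[OF Vf] tau(1)[OF i] by simp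
      finally show ?thesis by simp
    qed
    then have "mat_trace (P3\<^sup>\<dagger> * F * Q3) = (\<Sum>i<k. of_real (t (\<tau> i)))"
      unfolding mat_trace_def using P3(1) by (simp del: index_mult_mat(1))
    then have "(\<Sum>i<k. t (\<tau> i)) \<le> (\<Sum>i<k. s i)"
      using trace_inequality[OF svd k P3 Q3] by simp
    also have "\<dots> \<le> (\<Sum>i<k. a i)" by (rule top)
    finally have le: "(\<Sum>i<Suc (k - 1). t (\<tau> i)) \<le> (\<Sum>i<Suc (k - 1). a i)" using k(1) by simp
    have "(\<Sum>i<k - 1. t (\<tau> i)) = (\<Sum>i<k - 1. a i)"
      by (rule sum.cong) (auto simp: \<tau>_def t_def)
    then show ?thesis using le by (simp add: \<tau>_def)
  qed
  have t0: "0 \<le> t i" if "i < min m n" for i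
  proof (cases "i < k")
    case False
    then have "0 \<le> c (i - k)" using that by (intro svdD(3)[OF svd2]) auto
    then show ?thesis using False by (simp add: t_def)
  qed (simp add: t_def a)
  have "antimono_on {..<min m n} t"
  proof (rule monotone_onI)
    fix i j assume "i \<in> {..<min m n}" "j \<in> {..<min m n}" "i \<le> j"
    then have ij: "i \<le> j" "j < min m n" by simp_all
    have block: "j - k < m - k \<and> j - k < n - k" if "k \<le> j" using that ij(2) by auto
    consider "j < k" | "i < k" "k \<le> j" | "k \<le> i" using ij by linarith
    then show "t j \<le> t i"
    proof cases
      case 1
      then show ?thesis using ij monotone_onD[OF a(2), of i j] by (simp add: t_def)
    next
      case 2
      have "t j \<le> t k"
        using svdD(4)[OF svd2, of 0 "j - k"] block[OF 2(2)] 2 by (simp add: t_def)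
      also have "t k \<le> a (k - 1)" using join 2 ij(2) by linarith
      also have "a (k - 1) \<le> a i" using monotone_onD[OF a(2), of i "k - 1"] 2 by simp
      finally show ?thesis using 2 by (simp add: t_def)
    next
      case 3
      then show ?thesis
        using svdD(4)[OF svd2, of "i - k" "j - k"] block ij(1) by (simp add: t_def)
    qed
  qed
  then have "svd m n F Vf t Wf" using Vf Wf t0 Ff by (simp add: svd_def)
  then show ?thesis using PQ by blast
qed

text \<open>Equality in the trace inequality: the two polar forms \<open>F Q = P A\<close> and \<open>F\<^sup>\<dagger> P = Q A\<close> have the same
  positive semidefinite factor \<open>A = P\<^sup>\<dagger> F Q\<close>, and passing to an eigenbasis of \<open>A\<close> changes \<open>P\<close> and \<open>Q\<close> by
  the same unitary, hence not the product \<open>P Q\<^sup>\<dagger>\<close>.\<close>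

lemma trace_equality_common_svd:
  assumes svd: "svd m n F V s W" and k: "1 \<le> k" "k \<le> min m n"
    and P: "P \<in> carrier_mat m k" "P\<^sup>\<dagger> * P = 1\<^sub>m k"
    and Q: "Q \<in> carrier_mat n k" "Q\<^sup>\<dagger> * Q = 1\<^sub>m k"
    and eq: "(\<Sum>i<k. s i) \<le> Re (mat_trace (P\<^sup>\<dagger> * F * Q))"
  shows "\<exists>V' s' W'. svd m n F V' s' W' \<and> P * Q\<^sup>\<dagger> = V' * rdiag m n (leading_ones k) * W'\<^sup>\<dagger>"
proof -
  note Fc = svdD(6)[OF svd]
  obtain Z a where Z: "unitary_mat k Z" and a: "\<forall>i<k. 0 \<le> a i" "antimono_on {..<k} a"
    and FQ: "F * Q = P * (Z * mat_diag k (\<lambda>i. complex_of_real (a i)) * Z\<^sup>\<dagger>)"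
    using trace_equality_polar[OF svd k P Q eq] by blast
  define D where "D = mat_diag k (\<lambda>i. complex_of_real (a i))"
  define A where "A = Z * D * Z\<^sup>\<dagger>"
  note Zc = unitary_matD(1)[OF Z]
  have D: "D \<in> carrier_mat k k" by (simp add: D_def)
  have A: "A \<in> carrier_mat k k" "A\<^sup>\<dagger> = A"
    using spectral_dec_hermitian[OF Z] by (simp_all add: A_def D_def)
  have FQ: "F * Q = P * A" using FQ by (simp only: A_def D_def)
  have PFQ: "P\<^sup>\<dagger> * F * Q = A"
    using isometry_cancel(1)[OF P, of A] A(1) FQ P(1) Fc Q(1) by (simp add: mult_assoc_dim)
  have adj: "Q\<^sup>\<dagger> * F\<^sup>\<dagger> * P = A"
  proof -
    have "Q\<^sup>\<dagger> * F\<^sup>\<dagger> * P = (P\<^sup>\<dagger> * F * Q)\<^sup>\<dagger>" using P(1) Fc Q(1) by (simp add: mat_word)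
    then show ?thesis by (simp only: PFQ A(2))
  qed
  have eq': "(\<Sum>i<k. s i) \<le> Re (mat_trace (Q\<^sup>\<dagger> * F\<^sup>\<dagger> * P))" using eq unfolding adj PFQ .
  have k': "k \<le> min n m" using k(2) by (simp add: min.commute)
  obtain Z' a' where Z': "unitary_mat k Z'"
    and FP': "F\<^sup>\<dagger> * P = Q * (Z' * mat_diag k (\<lambda>i. complex_of_real (a' i)) * Z'\<^sup>\<dagger>)"
    using trace_equality_polar[OF svd_adjoint[OF svd] k(1) k' Q P eq'] by blast
  define A' where "A' = Z' * mat_diag k (\<lambda>i. complex_of_real (a' i)) * Z'\<^sup>\<dagger>"
  have A': "A' \<in> carrier_mat k k" using spectral_dec_hermitian(1)[OF Z'] by (simp add: A'_def)
  have FP': "F\<^sup>\<dagger> * P = Q * A'" using FP' by (simp only: A'_def)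
  have "A = A'"
    using isometry_cancel(1)[OF Q, of A'] A' FP' P(1) Fc Q(1) adj by (simp add: mult_assoc_dim)
  then have FP: "F\<^sup>\<dagger> * P = Q * A" using FP' by (simp only:)
  define P1 Q1 where "P1 = P * Z" and "Q1 = Q * Z"
  have P1: "P1 \<in> carrier_mat m k" "P1\<^sup>\<dagger> * P1 = 1\<^sub>m k"
    unfolding P1_def using isometry_mult[OF P Zc unitary_matD(2)[OF Z]] by simp_all
  have Q1: "Q1 \<in> carrier_mat n k" "Q1\<^sup>\<dagger> * Q1 = 1\<^sub>m k"
    unfolding Q1_def using isometry_mult[OF Q Zc unitary_matD(2)[OF Z]] by simp_all
  have AZ: "A * Z = Z * D"
    unfolding A_def using Zc D unitary_matD(2)[OF Z] by (simp add: mult_assoc_dim)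
  have "F * Q1 = P * (A * Z)"
    unfolding Q1_def using FQ Fc Q(1) Zc P(1) A(1) mult_assoc_dim[of F Q Z] mult_assoc_dim[of P A Z] by simp
  then have FQ1: "F * Q1 = P1 * mat_diag k (\<lambda>i. complex_of_real (a i))"
    unfolding AZ P1_def D_def[symmetric] using P(1) Zc D by (simp add: mult_assoc_dim)
  have "F\<^sup>\<dagger> * P1 = Q * (A * Z)"
    unfolding P1_def using FP Fc Q(1) Zc P(1) A(1) mult_assoc_dim[of "F\<^sup>\<dagger>" P Z] mult_assoc_dim[of Q A Z] by simp
  then have FP1: "F\<^sup>\<dagger> * P1 = Q1 * mat_diag k (\<lambda>i. complex_of_real (a i))"
    unfolding AZ Q1_def D_def[symmetric] using Q(1) Zc D by (simp add: mult_assoc_dim)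
  have "spectral_dec k A Z a" using Z a(2) by (simp add: spectral_dec_def A_def D_def)
  then have "mat_trace A = of_real (\<Sum>i<k. a i)" by (rule mat_trace_spectral_dec)
  then have top: "(\<Sum>i<k. s i) \<le> (\<Sum>i<k. a i)" using eq unfolding PFQ by simp
  have "P1 * Q1\<^sup>\<dagger> = P * Q\<^sup>\<dagger>"
    unfolding P1_def Q1_def using P(1) Q(1) Zc by (simp add: mat_word unitary_cancel[OF Z])
  then show ?thesis
    using svd_extending_isometries[OF svd k P1 Q1 _ a(2) FQ1 FP1 top] a(1) by simp
qed

section \<open>Minimizers\<close>

theorem theorem3p3:
  fixes m n q k :: nat and F U :: "complex mat" and \<Phi> :: "real vec \<Rightarrow> real"
  assumes "m \<ge> 1" and "n \<ge> 1" and "q = min m n" and "1 \<le> k" and "k \<le> q"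
    and "F \<in> carrier_mat m n"
    and "symmetric_gauge q \<Phi>" and "strictly_convex_gauge q \<Phi>"
    and "is_arg_min (\<lambda>X. gauge_norm \<Phi> (F - X)) (\<lambda>X. X \<in> partial_isometries m n k) U"
  shows "\<exists>V S W. is_SVD F V S W
           \<and> U = V * top_left_block m n k (1\<^sub>m k) * mat_adjoint W"
proof -
  have k: "1 \<le> k" "k \<le> min m n" using assms by simp_all
  have km: "k \<le> m" "k \<le> n" using k by simp_all
  have U: "U \<in> partial_isometries m n k"
    and least: "\<And>X. X \<in> partial_isometries m n k \<Longrightarrow> gauge_norm \<Phi> (F - U) \<le> gauge_norm \<Phi> (F - X)"
    using assms(9) unfolding is_arg_min_def by (blast, meson linorder_not_less)
  have Uc: "U \<in> carrier_mat m n" using U by (simp add: partial_isometries_def)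
  obtain V s W where svdF: "svd m n F V s W" using svd_exists[OF assms(6)] by blast
  obtain V1 W1 where svdU: "svd m n U V1 (leading_ones k) W1" using svd_partial_isometry[OF U] by blast
  obtain V2 y W2 where svdY: "svd m n (F - U) V2 y W2"
    using svd_exists[OF minus_carrier_mat[OF Uc]] by blast
  note V = svdD(1)[OF svdF] and W = svdD(2)[OF svdF]
  note Vc = unitary_matD(1)[OF V] and Wc = unitary_matD(1)[OF W]
  \<comment> \<open>The competitor built from the singular bases of \<open>F\<close>; its distance to \<open>F\<close> has the singular
    values \<open>\<bar>s i - leading_ones k i\<bar>\<close> in decreasing order.\<close>
  define X where "X = V * rdiag m n (leading_ones k) * W\<^sup>\<dagger>"
  have X: "X \<in> partial_isometries m n k"
    unfolding X_def by (rule leading_ones_partial_isometry[OF V W k(2)])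
  have FX: "F - X = V * rdiag m n (\<lambda>i. s i - leading_ones k i) * W\<^sup>\<dagger>"
  proof (rule eq_matI)
    fix i l assume "i < dim_row (V * rdiag m n (\<lambda>i. s i - leading_ones k i) * W\<^sup>\<dagger>)"
      "l < dim_col (V * rdiag m n (\<lambda>i. s i - leading_ones k i) * W\<^sup>\<dagger>)"
    then have il: "i < m" "l < n" using Vc Wc by simp_all
    have "(F - X) $$ (i, l) = F $$ (i, l) - X $$ (i, l)" using il Vc Wc by (simp add: X_def)
    also have "F $$ (i, l) = (\<Sum>j<min m n. V $$ (i, j) * of_real (s j) * cnj (W $$ (l, j)))"
      unfolding svdD(5)[OF svdF] by (rule rdiag_sandwich_index[OF Vc Wc il])
    also have "X $$ (i, l) = (\<Sum>j<min m n. V $$ (i, j) * of_real (leading_ones k j) * cnj (W $$ (l, j)))"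
      unfolding X_def by (rule rdiag_sandwich_index[OF Vc Wc il])
    also have "(\<Sum>j<min m n. V $$ (i, j) * of_real (s j) * cnj (W $$ (l, j))) -
        (\<Sum>j<min m n. V $$ (i, j) * of_real (leading_ones k j) * cnj (W $$ (l, j))) =
        (\<Sum>j<min m n. V $$ (i, j) * of_real (s j - leading_ones k j) * cnj (W $$ (l, j)))"
      unfolding sum_subtractf[symmetric] by (rule sum.cong) (simp_all add: algebra_simps)
    also have "\<dots> = (V * rdiag m n (\<lambda>i. s i - leading_ones k i) * W\<^sup>\<dagger>) $$ (i, l)"
      by (rule rdiag_sandwich_index[OF Vc Wc il, symmetric])
    finally show "(F - X) $$ (i, l) = (V * rdiag m n (\<lambda>i. s i - leading_ones k i) * W\<^sup>\<dagger>) $$ (i, l)" .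
  qed (use Vc Wc assms(6) in \<open>simp_all add: X_def\<close>)
  obtain p V3 W3 where p: "p permutes {..<min m n}"
    and svdX: "svd m n (F - X) V3 (\<lambda>i. \<bar>s (p i) - leading_ones k (p i)\<bar>) W3"
    using svd_of_real_diagonal[OF V W, of "\<lambda>i. s i - leading_ones k i"] unfolding FX by blast
  define d where "d i = \<bar>s (p i) - leading_ones k (p i)\<bar>" for i
  have "d = (\<lambda>i. \<bar>s (p i) - leading_ones k (p i)\<bar>)" by (rule ext) (simp add: d_def)
  then have svdX: "svd m n (F - X) V3 d W3" using svdX by simp
  have d: "antimono_on {..<q} d" "\<And>i. i < q \<Longrightarrow> 0 \<le> d i"
    using svdX by (simp_all add: svd_def assms(3))
  have y0: "0 \<le> y i" if "i < q" for i using svdD(3)[OF svdY] that assms(3) by simp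
  have majorized: "(\<Sum>i<r. d i) \<le> (\<Sum>i<r. y i)" if r: "r \<le> q" for r
  proof -
    have inj: "inj_on p {..<r}" by (rule inj_on_subset[OF permutes_inj[OF p] subset_UNIV])
    have "p ` {..<r} \<subseteq> {..<min m n}"
    proof (rule image_subsetI)
      fix i assume "i \<in> {..<r}"
      then have "i \<in> {..<min m n}" using r assms(3) by simp
      then show "p i \<in> {..<min m n}" by (simp only: permutes_in_image[OF p])
    qed
    from mirsky[OF svdF svdU svdY this]
    have "(\<Sum>i\<in>p ` {..<r}. \<bar>s i - leading_ones k i\<bar>) \<le> (\<Sum>i<r. y i)"
      by (simp add: card_image[OF inj])
    then show ?thesis by (simp add: sum.reindex[OF inj] d_def)
  qed
  \<comment> \<open>Minimality and strict convexity leave only equality of the singular values of \<open>F - U\<close>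
    with those of \<open>F - X\<close>.\<close>
  have "gauge_norm \<Phi> (F - U) \<le> gauge_norm \<Phi> (F - X)" by (rule least[OF X])
  then have "\<Phi> (vec q y) \<le> \<Phi> (vec q d)"
    using singular_values_svd[OF svdX] singular_values_svd[OF svdY] by (simp add: gauge_norm_def assms(3))
  then have dy: "\<forall>i<q. d i = y i"
    using gauge_majorization[OF assms(7,8) d y0 majorized] by simp
  \<comment> \<open>The sum of the squared singular values is the squared Frobenius norm, so it can be expanded.\<close>
  have gram: "(\<Sum>i<q. (y i)\<^sup>2) = (\<Sum>i<q. (s i)\<^sup>2) - 2 * Re (mat_trace (U\<^sup>\<dagger> * F)) + k"
  proof -
    have "(\<Sum>i<q. (leading_ones k i)\<^sup>2) = (\<Sum>i<k. 1)"
      using assms(5) by (intro sum.mono_neutral_cong_right) (auto simp: leading_ones_def)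
    then show ?thesis
      using Re_trace_gram_minus[OF assms(6) Uc] mat_trace_gram[OF svdF] mat_trace_gram[OF svdU]
        mat_trace_gram[OF svdY] by (simp add: assms(3))
  qed
  have "(\<Sum>i<q. (y i)\<^sup>2) = (\<Sum>i<q. (d i)\<^sup>2)" using dy by simp
  also have "\<dots> = (\<Sum>i<q. (s i - leading_ones k i)\<^sup>2)"
    unfolding d_def power2_abs assms(3)
    by (rule sum.permute[OF p, of "\<lambda>i. (s i - leading_ones k i)\<^sup>2", unfolded comp_def, symmetric])
  also have "\<dots> = (\<Sum>i<q. (s i)\<^sup>2 + (if i < k then 1 - 2 * s i else 0))"
    by (rule sum.cong) (auto simp: leading_ones_def power2_diff)
  also have "\<dots> = (\<Sum>i<q. (s i)\<^sup>2) + (\<Sum>i<k. 1 - 2 * s i)"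
    unfolding sum.distrib using assms(5)
    by (intro arg_cong2[of _ _ _ _ "(+)"] refl sum.mono_neutral_cong_right) auto
  finally have trU: "Re (mat_trace (U\<^sup>\<dagger> * F)) = (\<Sum>i<k. s i)"
    using gram by (simp add: sum_subtractf sum_distrib_left[symmetric])
  \<comment> \<open>Writing \<open>U\<close> as \<open>P Q\<^sup>\<dagger>\<close> puts this into the equality case of the trace inequality.\<close>
  define P Q where "P = mat m k (\<lambda>(i, j). V1 $$ (i, j))" and "Q = mat n k (\<lambda>(i, j). W1 $$ (i, j))"
  note V1 = svdD(1)[OF svdU] and W1 = svdD(2)[OF svdU]
  note V1c = unitary_matD(1)[OF V1] and W1c = unitary_matD(1)[OF W1]
  have P: "P \<in> carrier_mat m k" and PP: "P\<^sup>\<dagger> * P = 1\<^sub>m k"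
    unfolding P_def using unitary_select_columns[OF V1, of "\<lambda>j. j" k] km by simp_all
  have Q: "Q \<in> carrier_mat n k" and QQ: "Q\<^sup>\<dagger> * Q = 1\<^sub>m k"
    unfolding Q_def using unitary_select_columns[OF W1, of "\<lambda>j. j" k] km by simp_all
  have UPQ: "U = P * Q\<^sup>\<dagger>"
  proof (rule eq_matI)
    fix i l assume "i < dim_row (P * Q\<^sup>\<dagger>)" "l < dim_col (P * Q\<^sup>\<dagger>)"
    then have il: "i < m" "l < n" using P Q by simp_all
    have "U $$ (i, l) = (\<Sum>j<min m n. V1 $$ (i, j) * of_real (leading_ones k j) * cnj (W1 $$ (l, j)))"
      unfolding svdD(5)[OF svdU] by (rule rdiag_sandwich_index[OF V1c W1c il])
    also have "\<dots> = (\<Sum>j<k. P $$ (i, j) * Q\<^sup>\<dagger> $$ (j, l))"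
      using k il by (intro sum.mono_neutral_cong_right) (auto simp: leading_ones_def P_def Q_def)
    also have "\<dots> = (P * Q\<^sup>\<dagger>) $$ (i, l)"
      by (rule index_mult_sum[OF P adjoint_carrier[OF Q] il, symmetric])
    finally show "U $$ (i, l) = (P * Q\<^sup>\<dagger>) $$ (i, l)" .
  qed (use Uc P Q in simp_all)
  have "mat_trace (P\<^sup>\<dagger> * F * Q) = mat_trace (Q * (P\<^sup>\<dagger> * F))"
    by (rule mat_trace_comm[OF mult_carrier_mat[OF adjoint_carrier[OF P] assms(6)] Q])
  also have "Q * (P\<^sup>\<dagger> * F) = U\<^sup>\<dagger> * F"
    unfolding UPQ using P Q assms(6) by (simp add: mat_word)
  finally have "(\<Sum>i<k. s i) \<le> Re (mat_trace (P\<^sup>\<dagger> * F * Q))" using trU by simp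
  from trace_equality_common_svd[OF svdF k P PP Q QQ this]
  obtain V4 t W4 where svd4: "svd m n F V4 t W4"
    and U4: "P * Q\<^sup>\<dagger> = V4 * rdiag m n (leading_ones k) * W4\<^sup>\<dagger>" by blast
  obtain S where "is_SVD F V4 S W4" using is_SVD_svd[OF svd4] by blast
  moreover have "U = V4 * top_left_block m n k (1\<^sub>m k) * W4\<^sup>\<dagger>"
    unfolding UPQ U4 top_left_block_leading_ones[OF km] ..
  ultimately show ?thesis by blast
qed

end
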